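(* Let $\mathbf{K}$ be one of the following countable structures: (i) a countably infinite set with no structure; (ii) the random $K_n$-free graph for some $n\geq 3$ (the Fraïssé limit of the class of finite graphs containing no clique of size $n$); (iii) the random $r$-uniform hypergraph for some $r\geq 2$ (the Fraïssé limit of the class of finite $r$-uniform hypergraphs). Let $G=\mathrm{Aut}(\mathbf{K})$ with the topology of pointwise convergence. Then $S(G)$ and $E(M(G))$ are not isomorphic as $G$-ambits; i.e. the canonical map of ambits $S(G)\to E(M(G))$ is not an isomorphism.
   Context: A $G$-flow is a compact Hausdorff space with a continuous right action of $G$; a $G$-ambit is a pair $(X,x_0)$ with $X$ a $G$-flow and $x_0$ having dense orbit; a map of ambits is a continuous $G$-equivariant map sending distinguished point to distinguished point. $S(G)$ is the Samuel compactification of $G$ with respect to its left uniformity (Gelfand space of bounded left-uniformly continuous functions), which with distinguished point $1_G$ and the extension of right multiplication is the greatest $G$-ambit. $M(G)$ denotes the universal minimal flow of $G$ (the unique minimal $G$-flow admitting a $G$-map onto every minimal $G$-flow). For a $G$-flow $X$, the enveloping semigroup $E(X)$ is the closure in $X^X$ (product topology) of the maps $\rho_g:x\mapsto xg$, $g\in G$, an ambit with distinguished point $\rho_{1_G}$ and action $x(f\cdot g)=(xf)g$; there is a unique map of ambits $S(G)\to E(X)$. *)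

theory Defs
  imports "HOL-Analysis.Analysis"
begin

text \<open>A structure on the countably infinite universe nat is given by a predicate R on
  subsets of nat (the set of its hyperedges). Graphs are 2-uniform such structures,
  r-uniform hypergraphs are r-uniform such structures. Groups act on nat on the left,
  and the group operation is composition (g*h = g o h).\<close>

definition Aut :: "(nat set \<Rightarrow> bool) \<Rightarrow> (nat \<Rightarrow> nat) set" where
  "Aut R = {g. bij g \<and> (\<forall>A. R (g ` A) \<longleftrightarrow> R A)}"

definition uniform_struct :: "nat \<Rightarrow> (nat set \<Rightarrow> bool) \<Rightarrow> bool" where
  "uniform_struct r R \<longleftrightarrow> (\<forall>A. R A \<longrightarrow> finite A \<and> card A = r)"

definition partial_iso :: "(nat set \<Rightarrow> bool) \<Rightarrow> (nat \<Rightarrow> nat) \<Rightarrow> nat set \<Rightarrow> nat set \<Rightarrow> bool" where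
  "partial_iso R p A B \<longleftrightarrow> bij_betw p A B \<and> (\<forall>C. C \<subseteq> A \<longrightarrow> (R (p ` C) \<longleftrightarrow> R C))"

definition ultrahomogeneous :: "(nat set \<Rightarrow> bool) \<Rightarrow> bool" where
  "ultrahomogeneous R \<longleftrightarrow>
     (\<forall>p A B. finite A \<and> finite B \<and> partial_iso R p A B \<longrightarrow> (\<exists>g\<in>Aut R. \<forall>a\<in>A. g a = p a))"

definition embeds_into :: "nat set \<Rightarrow> (nat set \<Rightarrow> bool) \<Rightarrow> (nat set \<Rightarrow> bool) \<Rightarrow> bool" where
  "embeds_into V R' R \<longleftrightarrow>
     (\<exists>f. inj_on f V \<and> (\<forall>C. C \<subseteq> V \<longrightarrow> (R' C \<longleftrightarrow> R (f ` C))))"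

definition clique_free :: "nat \<Rightarrow> (nat set \<Rightarrow> bool) \<Rightarrow> nat set \<Rightarrow> bool" where
  "clique_free n R V \<longleftrightarrow>
     \<not> (\<exists>C. C \<subseteq> V \<and> finite C \<and> card C = n \<and> (\<forall>x\<in>C. \<forall>y\<in>C. x \<noteq> y \<longrightarrow> R {x, y}))"

text \<open>R is (a copy on nat of) the Fraisse limit of the class of finite K_n-free graphs:
  it is a graph, its age is exactly that class (it is K_n-free and every finite K_n-free
  graph embeds into it), and it is ultrahomogeneous.\<close>
definition random_Kn_free_graph :: "nat \<Rightarrow> (nat set \<Rightarrow> bool) \<Rightarrow> bool" where
  "random_Kn_free_graph n R \<longleftrightarrow>
     uniform_struct 2 R \<and> clique_free n R UNIV \<and>
     (\<forall>V R'. finite V \<and> uniform_struct 2 R' \<and> (\<forall>C. R' C \<longrightarrow> C \<subseteq> V) \<and> clique_free n R' V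
              \<longrightarrow> embeds_into V R' R) \<and>
     ultrahomogeneous R"

definition random_uniform_hypergraph :: "nat \<Rightarrow> (nat set \<Rightarrow> bool) \<Rightarrow> bool" where
  "random_uniform_hypergraph r R \<longleftrightarrow>
     uniform_struct r R \<and>
     (\<forall>V R'. finite V \<and> uniform_struct r R' \<and> (\<forall>C. R' C \<longrightarrow> C \<subseteq> V)
              \<longrightarrow> embeds_into V R' R) \<and>
     ultrahomogeneous R"

definition group_top :: "(nat \<Rightarrow> nat) set \<Rightarrow> (nat \<Rightarrow> nat) topology" where
  "group_top G = subtopology (product_topology (\<lambda>_. discrete_topology (UNIV::nat set)) UNIV) G"

definition G_flow :: "(nat \<Rightarrow> nat) set \<Rightarrow> 'a topology \<Rightarrow> ('a \<Rightarrow> (nat \<Rightarrow> nat) \<Rightarrow> 'a) \<Rightarrow> bool" where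
  "G_flow G X act \<longleftrightarrow>
     compact_space X \<and> Hausdorff_space X \<and>
     (\<forall>x\<in>topspace X. \<forall>g\<in>G. act x g \<in> topspace X) \<and>
     (\<forall>x\<in>topspace X. act x id = x) \<and>
     (\<forall>x\<in>topspace X. \<forall>g\<in>G. \<forall>h\<in>G. act (act x g) h = act x (g \<circ> h)) \<and>
     continuous_map (prod_topology X (group_top G)) X (\<lambda>(x, g). act x g)"

definition orbit :: "(nat \<Rightarrow> nat) set \<Rightarrow> ('a \<Rightarrow> (nat \<Rightarrow> nat) \<Rightarrow> 'a) \<Rightarrow> 'a \<Rightarrow> 'a set" where
  "orbit G act x = (\<lambda>g. act x g) ` G"

definition G_ambit :: "(nat \<Rightarrow> nat) set \<Rightarrow> 'a topology \<Rightarrow> ('a \<Rightarrow> (nat \<Rightarrow> nat) \<Rightarrow> 'a) \<Rightarrow> 'a \<Rightarrow> bool" where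
  "G_ambit G X act x0 \<longleftrightarrow>
     G_flow G X act \<and> x0 \<in> topspace X \<and> X closure_of (orbit G act x0) = topspace X"

definition minimal_flow :: "(nat \<Rightarrow> nat) set \<Rightarrow> 'a topology \<Rightarrow> ('a \<Rightarrow> (nat \<Rightarrow> nat) \<Rightarrow> 'a) \<Rightarrow> bool" where
  "minimal_flow G X act \<longleftrightarrow>
     G_flow G X act \<and> topspace X \<noteq> {} \<and>
     (\<forall>x\<in>topspace X. X closure_of (orbit G act x) = topspace X)"

definition G_map :: "(nat \<Rightarrow> nat) set \<Rightarrow> 'a topology \<Rightarrow> ('a \<Rightarrow> (nat \<Rightarrow> nat) \<Rightarrow> 'a)
    \<Rightarrow> 'b topology \<Rightarrow> ('b \<Rightarrow> (nat \<Rightarrow> nat) \<Rightarrow> 'b) \<Rightarrow> ('a \<Rightarrow> 'b) \<Rightarrow> bool" where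
  "G_map G X actX Y actY \<pi> \<longleftrightarrow>
     continuous_map X Y \<pi> \<and> (\<forall>x\<in>topspace X. \<forall>g\<in>G. \<pi> (actX x g) = actY (\<pi> x) g)"

definition ambit_iso :: "(nat \<Rightarrow> nat) set \<Rightarrow> 'a topology \<Rightarrow> ('a \<Rightarrow> (nat \<Rightarrow> nat) \<Rightarrow> 'a) \<Rightarrow> 'a
    \<Rightarrow> 'b topology \<Rightarrow> ('b \<Rightarrow> (nat \<Rightarrow> nat) \<Rightarrow> 'b) \<Rightarrow> 'b \<Rightarrow> bool" where
  "ambit_iso G X actX x0 Y actY y0 \<longleftrightarrow>
     (\<exists>\<pi>. G_map G X actX Y actY \<pi> \<and> homeomorphic_map X Y \<pi> \<and> \<pi> x0 = y0)"

section \<open>The Samuel compactification S(G) as Gelfand space of LUC(G)\<close>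

type_synonym samuel_pt = "((nat \<Rightarrow> nat) \<Rightarrow> real) \<Rightarrow> real"

text \<open>Bounded left-uniformly continuous real functions on G (extended by 0 outside G).
  The left uniformity has entourages {(x,y). x^-1 y \<in> V}; for V the pointwise stabiliser of
  a finite set F this says exactly that x and y agree on F.\<close>
definition LUC :: "(nat \<Rightarrow> nat) set \<Rightarrow> ((nat \<Rightarrow> nat) \<Rightarrow> real) set" where
  "LUC G = {f. (\<forall>x. x \<notin> G \<longrightarrow> f x = 0) \<and> bounded (f ` G) \<and>
      (\<forall>e>0. \<exists>F. finite F \<and> (\<forall>x\<in>G. \<forall>y\<in>G. (\<forall>a\<in>F. x a = y a) \<longrightarrow> \<bar>f x - f y\<bar> < e))}"

definition unitG :: "(nat \<Rightarrow> nat) set \<Rightarrow> (nat \<Rightarrow> nat) \<Rightarrow> real" where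
  "unitG G = (\<lambda>x. if x \<in> G then 1 else 0)"

definition characters :: "(nat \<Rightarrow> nat) set \<Rightarrow> samuel_pt set" where
  "characters G = {\<phi> \<in> topspace (product_topology (\<lambda>_. euclideanreal) (LUC G)).
      (\<forall>f\<in>LUC G. \<forall>h\<in>LUC G. \<phi> (\<lambda>x. f x + h x) = \<phi> f + \<phi> h) \<and>
      (\<forall>f\<in>LUC G. \<forall>c. \<phi> (\<lambda>x. c * f x) = c * \<phi> f) \<and>
      (\<forall>f\<in>LUC G. \<forall>h\<in>LUC G. \<phi> (\<lambda>x. f x * h x) = \<phi> f * \<phi> h) \<and>
      \<phi> (unitG G) = 1}"

definition Samuel_top :: "(nat \<Rightarrow> nat) set \<Rightarrow> samuel_pt topology" where
  "Samuel_top G = subtopology (product_topology (\<lambda>_. euclideanreal) (LUC G)) (characters G)"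

text \<open>Extension of right multiplication: (phi . g)(f) = phi (y \<mapsto> f (y g)).\<close>
definition Samuel_act :: "(nat \<Rightarrow> nat) set \<Rightarrow> samuel_pt \<Rightarrow> (nat \<Rightarrow> nat) \<Rightarrow> samuel_pt" where
  "Samuel_act G \<phi> g = restrict (\<lambda>f. \<phi> (\<lambda>y. if y \<in> G then f (y \<circ> g) else 0)) (LUC G)"

definition Samuel_pt :: "(nat \<Rightarrow> nat) set \<Rightarrow> samuel_pt" where
  "Samuel_pt G = restrict (\<lambda>f. f id) (LUC G)"

text \<open>M is a universal minimal flow: minimal and maps onto every minimal G-flow. Quantification
  over all types is impossible inside a HOL formula; every minimal flow is a factor of S(G),
  hence has cardinality at most that of S(G) and is isomorphic to a flow on the type
  samuel_pt set, so quantifying over minimal flows on that type is equivalent.\<close>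
definition universal_minimal_flow :: "(nat \<Rightarrow> nat) set \<Rightarrow> 'a topology \<Rightarrow> ('a \<Rightarrow> (nat \<Rightarrow> nat) \<Rightarrow> 'a) \<Rightarrow> bool" where
  "universal_minimal_flow G M act \<longleftrightarrow>
     minimal_flow G M act \<and>
     (\<forall>(Y :: samuel_pt set topology) actY. minimal_flow G Y actY \<longrightarrow>
        (\<exists>\<pi>. G_map G M act Y actY \<pi> \<and> \<pi> ` topspace M = topspace Y))"

definition env_set :: "(nat \<Rightarrow> nat) set \<Rightarrow> 'a topology \<Rightarrow> ('a \<Rightarrow> (nat \<Rightarrow> nat) \<Rightarrow> 'a) \<Rightarrow> ('a \<Rightarrow> 'a) set" where
  "env_set G X act = (product_topology (\<lambda>_. X) (topspace X)) closure_of
      ((\<lambda>g. restrict (\<lambda>x. act x g) (topspace X)) ` G)"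

definition env_top :: "(nat \<Rightarrow> nat) set \<Rightarrow> 'a topology \<Rightarrow> ('a \<Rightarrow> (nat \<Rightarrow> nat) \<Rightarrow> 'a) \<Rightarrow> ('a \<Rightarrow> 'a) topology" where
  "env_top G X act = subtopology (product_topology (\<lambda>_. X) (topspace X)) (env_set G X act)"

definition env_act :: "'a topology \<Rightarrow> ('a \<Rightarrow> (nat \<Rightarrow> nat) \<Rightarrow> 'a) \<Rightarrow> ('a \<Rightarrow> 'a) \<Rightarrow> (nat \<Rightarrow> nat) \<Rightarrow> ('a \<Rightarrow> 'a)" where
  "env_act X act p g = restrict (\<lambda>x. act (p x) g) (topspace X)"

definition env_pt :: "'a topology \<Rightarrow> ('a \<Rightarrow> (nat \<Rightarrow> nat) \<Rightarrow> 'a) \<Rightarrow> ('a \<Rightarrow> 'a)" where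
  "env_pt X act = restrict (\<lambda>x. act x id) (topspace X)"

end

theory Submission
  imports Defs "HOL-Library.Ramsey"
begin

text \<open>The isomorphism would express every \<open>{0,1}\<close>-valued function \<open>g \<mapsto> [S(g 0, g 1)]\<close> on \<open>G\<close>
  through finitely many matrix coefficients \<open>g \<mapsto> u(x g)\<close> with \<open>x\<close> in the minimal flow and \<open>u\<close>
  continuous. By the structural Ramsey theorem (Nesetril--Roedl, proved by the partite
  construction), minimality and compactness, such a coefficient depends, on any finite set of points
  and up to a small error, only on the order type of \<open>g|F\<close> for some finite \<open>F\<close> and some linear
  order of the points. Hence finitely many coefficients take few patterns: over a base of \<open>n\<close>
  points and \<open>s\<close> copies of \<open>0\<close> they distinguish only polynomially many (in \<open>s\<close>) copies of \<open>1\<close>,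
  whereas \<open>S\<close> can be chosen to distinguish \<open>2\<^sup>s\<close> of them.\<close>

section \<open>Hales--Jewett\<close>

text \<open>The minimal flow is never described explicitly; the finite Ramsey property of the
  structure stands in for such a description. The order attached to a coefficient depends on the
  coefficient and on the finite set where it is tested, and is only known to exist, so the
  contradiction must work against every choice of finitely many orders. The relation
  \<open>S\<close> has to be fixed before the coefficients are known, and their number and the
  finite sets they depend on can be arbitrarily large. Hence \<open>S\<close> contains a shattered
  block for every \<open>n\<close>, and the rows of different blocks are kept disjoint so that the
  blocks do not disturb each other. Inside a block the images of \<open>0\<close> and
  \<open>1\<close> vary independently while the images of the other points below \<open>n\<close>
  stay fixed. Blowing up points into independent sets makes this possible: the relations of the
  structure then cannot tell two columns apart, and only the position of the image of
  \<open>1\<close> in the orders is left to do so. Finitely many coefficients suffice because a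
  continuous function on the compact enveloping semigroup is controlled, near each point, by
  finitely many coordinates.\<close>

text \<open>A variable word (a combinatorial line) is a list over \<open>nat option\<close>; \<open>None\<close> marks the
  active coordinates.\<close>

definition fill :: "nat \<Rightarrow> nat option list \<Rightarrow> nat list" where
  "fill x w = map (\<lambda>p. case p of None \<Rightarrow> x | Some y \<Rightarrow> y) w"

definition is_line :: "nat set \<Rightarrow> nat option list \<Rightarrow> bool" where
  "is_line A w \<longleftrightarrow> None \<in> set w \<and> set w \<subseteq> insert None (Some ` A)"

text \<open>\<open>fill_blocks ws\<close> parametrises the combinatorial subspace spanned by the
  lines in \<open>ws\<close>, with one parameter letter per block.\<close>

definition fill_blocks :: "nat option list list \<Rightarrow> nat list \<Rightarrow> nat list" where
  "fill_blocks ws z = concat (map2 fill z ws)"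

text \<open>A line in the parameter space of that subspace, read back as a line in the ambient
  cube.\<close>

definition glue :: "nat option list list \<Rightarrow> nat option list \<Rightarrow> nat option list" where
  "glue ws v = concat (map2 (\<lambda>p w. case p of None \<Rightarrow> w | Some y \<Rightarrow> map Some (fill y w)) v ws)"

lemma length_fill [simp]: "length (fill x w) = length w"
  by (simp add: fill_def)

lemma set_fill: "is_line A w \<Longrightarrow> x \<in> A \<Longrightarrow> set (fill x w) \<subseteq> A"
  by (auto simp: is_line_def fill_def split: option.splits)

lemma fill_map_Some [simp]: "fill x (map Some u) = u"
  by (simp add: fill_def comp_def)

lemma fill_append [simp]: "fill x (u @ v) = fill x u @ fill x v"
  by (simp add: fill_def)

lemma fill_glue:
  "length v = length ws \<Longrightarrow> fill x (glue ws v) = fill_blocks ws (fill x v)"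
proof (induction v ws rule: list_induct2)
  case Nil
  then show ?case by (simp add: fill_blocks_def glue_def fill_def)
next
  case (Cons p v w ws)
  then show ?case
    by (cases p) (simp_all add: fill_blocks_def glue_def fill_def comp_def)
qed

lemma length_glue:
  "length v = length ws \<Longrightarrow> length (glue ws v) = length (concat ws)"
proof (induction v ws rule: list_induct2)
  case Nil
  then show ?case by (simp add: glue_def)
next
  case (Cons p v w ws)
  then show ?case by (cases p) (simp_all add: glue_def)
qed

lemma is_line_glue:
  assumes "length v = length ws" "is_line A v" "\<forall>w\<in>set ws. is_line A w"
  shows "is_line A (glue ws v)"
proof -
  have "None \<in> set (glue ws v)" if "None \<in> set v"
    using assms(1,3) that
    by (induction v ws rule: list_induct2) (auto simp: glue_def is_line_def split: option.splits)
  moreover have "set (glue ws v) \<subseteq> insert None (Some ` A)" if "set v \<subseteq> insert None (Some ` A)"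
    using assms(1,3) that
  proof (induction v ws rule: list_induct2)
    case (Cons p v w ws)
    have "set (case p of None \<Rightarrow> w | Some y \<Rightarrow> map Some (fill y w)) \<subseteq> insert None (Some ` A)"
      using Cons.prems set_fill[of A w] by (cases p) (auto simp: is_line_def)
    moreover have "glue (w # ws) (p # v) =
        (case p of None \<Rightarrow> w | Some y \<Rightarrow> map Some (fill y w)) @ glue ws v"
      by (simp add: glue_def)
    ultimately show ?case using Cons by auto
  qed (simp add: glue_def)
  ultimately show ?thesis using assms(2) by (simp add: is_line_def)
qed

lemma length_fill_blocks:
  "length z = length ws \<Longrightarrow> length (fill_blocks ws z) = length (concat ws)"
  by (induction z ws rule: list_induct2) (simp_all add: fill_blocks_def)

lemma set_fill_blocks:
  assumes "length z = length ws" "\<forall>w\<in>set ws. is_line A w" "set z \<subseteq> A"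
  shows "set (fill_blocks ws z) \<subseteq> A"
  using assms
proof (induction z ws rule: list_induct2)
  case (Cons x z w ws)
  then show ?case using set_fill[of A w x] by (simp add: fill_blocks_def)
qed (simp add: fill_blocks_def)

text \<open>Shelah's step: all words of the form \<open>b\<^sup>j a\<^sup>M\<^sup>-\<^sup>j\<close> are coloured by the colouring they induce on
  the suffixes; two of them agree, and they are two points of a common line.\<close>

lemma insensitive_block:
  assumes "finite A" "a \<in> A" "b \<in> A" "finite C"
  obtains M where
    "\<And>\<xi> :: nat list \<Rightarrow> nat. (\<And>u. \<xi> u \<in> C) \<Longrightarrow>
      (\<exists>w. is_line A w \<and> length w = M \<and>
        (\<forall>u. length u = N \<longrightarrow> set u \<subseteq> A \<longrightarrow> \<xi> (fill a w @ u) = \<xi> (fill b w @ u)))"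
proof -
  define U where "U = {u. set u \<subseteq> A \<and> length u = N}"
  have "finite U" unfolding U_def using assms(1) by (rule finite_lists_length_eq)
  define M where "M = card (U \<rightarrow>\<^sub>E C)"
  have fin: "finite (U \<rightarrow>\<^sub>E C)" using \<open>finite U\<close> assms(4) by (simp add: finite_PiE)
  show thesis
  proof (rule that[of M])
    fix \<xi> :: "nat list \<Rightarrow> nat"
    assume \<xi>: "\<And>u. \<xi> u \<in> C"
    define h where "h j = (\<lambda>u\<in>U. \<xi> ((replicate j b @ replicate (M - j) a) @ u))" for j
    have "h ` {..M} \<subseteq> U \<rightarrow>\<^sub>E C" using \<xi> by (auto simp: h_def)
    then have "card (h ` {..M}) \<le> M" unfolding M_def by (rule card_mono[OF fin])
    then have "\<not> inj_on h {..M}" using card_image[of h "{..M}"] by auto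
    then obtain j k where jk: "j < k" "k \<le> M" "h j = h k"
      by (metis atMost_iff inj_onI linorder_neqE_nat)
    define w where "w = replicate j (Some b) @ replicate (k - j) None @ replicate (M - k) (Some a)"
    have "fill a w = replicate j b @ replicate (M - j) a"
      using jk by (simp add: w_def fill_def replicate_add[symmetric])
    moreover have "fill b w = replicate k b @ replicate (M - k) a"
      using jk by (simp add: w_def fill_def replicate_add[symmetric] flip: append_assoc)
    ultimately have "\<xi> (fill a w @ u) = \<xi> (fill b w @ u)" if "length u = N" "set u \<subseteq> A" for u
      using fun_cong[OF jk(3), of u] that by (simp add: h_def U_def)
    moreover have "is_line A w" using jk assms by (auto simp: w_def is_line_def)
    moreover have "length w = M" using jk by (simp add: w_def)
    ultimately show "\<exists>w. is_line A w \<and> length w = M \<and>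
        (\<forall>u. length u = N \<longrightarrow> set u \<subseteq> A \<longrightarrow> \<xi> (fill a w @ u) = \<xi> (fill b w @ u))" by blast
  qed
qed

text \<open>Induction on the number of blocks. The tail length \<open>N\<close> is fixed ahead, from
  the number of colour vectors; the first block is insensitive for all tails of this length. The
  tail is then chosen for the colouring that records the colours for all letters of the first block
  at once.\<close>

lemma insensitive_blocks:
  assumes "finite A" "a \<in> A" "b \<in> A" "finite C"
  shows "\<exists>N. \<forall>\<xi> :: nat list \<Rightarrow> nat. (\<forall>u. \<xi> u \<in> C) \<longrightarrow>
      (\<exists>ws. length ws = m \<and> (\<forall>w\<in>set ws. is_line A w) \<and> length (concat ws) = N \<and>
        (\<forall>z. length z = m \<longrightarrow> set z \<subseteq> A \<longrightarrow>
          \<xi> (fill_blocks ws z) = \<xi> (fill_blocks ws (map (id(a := b)) z))))"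
  using assms(4)
proof (induction m arbitrary: C)
  case 0
  then show ?case by (intro exI[of _ 0] allI impI exI[of _ "[]"]) simp
next
  case (Suc m)
  obtain xs where xs: "set xs = A" using assms(1) finite_list by blast
  define C' where "C' = (to_nat :: nat list \<Rightarrow> nat) ` {l. set l \<subseteq> C \<and> length l = length xs}"
  have "finite C'" unfolding C'_def using finite_lists_length_eq[OF Suc.prems] by simp
  from Suc.IH[OF this] obtain N where N: "\<And>\<xi> :: nat list \<Rightarrow> nat. (\<forall>u. \<xi> u \<in> C') \<Longrightarrow>
      (\<exists>ws. length ws = m \<and> (\<forall>w\<in>set ws. is_line A w) \<and> length (concat ws) = N \<and>
        (\<forall>z. length z = m \<longrightarrow> set z \<subseteq> A \<longrightarrow>
          \<xi> (fill_blocks ws z) = \<xi> (fill_blocks ws (map (id(a := b)) z))))"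
    by blast
  obtain M where M: "\<And>\<xi> :: nat list \<Rightarrow> nat. (\<And>u. \<xi> u \<in> C) \<Longrightarrow>
      (\<exists>w. is_line A w \<and> length w = M \<and>
        (\<forall>u. length u = N \<longrightarrow> set u \<subseteq> A \<longrightarrow> \<xi> (fill a w @ u) = \<xi> (fill b w @ u)))"
    using insensitive_block[OF assms(1-3) Suc.prems, of N] by blast
  show ?case
  proof (intro exI[of _ "M + N"] allI impI)
    fix \<xi> :: "nat list \<Rightarrow> nat"
    assume \<xi>: "\<forall>u. \<xi> u \<in> C"
    then obtain w where w: "is_line A w" "length w = M"
      and wu: "\<And>u. length u = N \<Longrightarrow> set u \<subseteq> A \<Longrightarrow> \<xi> (fill a w @ u) = \<xi> (fill b w @ u)"
      using M[of \<xi>] by blast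
    define \<xi>' where "\<xi>' u = to_nat (map (\<lambda>x. \<xi> (fill x w @ u)) xs)" for u
    have "\<forall>u. \<xi>' u \<in> C'" using \<xi> unfolding \<xi>'_def C'_def by (intro allI imageI) auto
    from N[OF this] obtain ws where ws: "length ws = m" "\<forall>w\<in>set ws. is_line A w"
      "length (concat ws) = N"
      and wz: "\<And>z. length z = m \<Longrightarrow> set z \<subseteq> A \<Longrightarrow>
        \<xi>' (fill_blocks ws z) = \<xi>' (fill_blocks ws (map (id(a := b)) z))" by blast
    have "\<xi> (fill_blocks (w # ws) z) = \<xi> (fill_blocks (w # ws) (map (id(a := b)) z))"
      if z: "length z = Suc m" "set z \<subseteq> A" for z
    proof -
      obtain x y where xy: "z = x # y" using z by (cases z) auto
      let ?y = "map (id(a := b)) y"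
      have y: "length y = m" "set y \<subseteq> A" "x \<in> A" using z xy by auto
      have y': "set ?y \<subseteq> A" using y assms by auto
      have "map (\<lambda>x. \<xi> (fill x w @ fill_blocks ws y)) xs =
            map (\<lambda>x. \<xi> (fill x w @ fill_blocks ws ?y)) xs"
        using wz[OF y(1,2)] by (simp add: \<xi>'_def)
      then have "\<xi> (fill x w @ fill_blocks ws y) = \<xi> (fill x w @ fill_blocks ws ?y)"
        using y xs by simp
      also have "\<dots> = \<xi> (fill ((id(a := b)) x) w @ fill_blocks ws ?y)"
        using wu[of "fill_blocks ws ?y"] length_fill_blocks[of ?y ws] set_fill_blocks[of ?y ws A]
          y y' ws by auto
      finally show ?thesis by (simp add: xy fill_blocks_def)
    qed
    then show "\<exists>ws. length ws = Suc m \<and> (\<forall>w\<in>set ws. is_line A w) \<and> length (concat ws) = M + N \<and>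
        (\<forall>z. length z = Suc m \<longrightarrow> set z \<subseteq> A \<longrightarrow>
          \<xi> (fill_blocks ws z) = \<xi> (fill_blocks ws (map (id(a := b)) z)))"
      using w ws by (intro exI[of _ "w # ws"]) auto
  qed
qed

text \<open>Shelah's induction on the alphabet. Blocks are chosen on which the new letter
  \<open>a\<close> cannot be told from an old letter \<open>b\<close>; a line that is monochromatic
  for the old letters in the space of blocks then takes the same colour at \<open>a\<close> as at
  \<open>b\<close>.\<close>

theorem hales_jewett:
  assumes "finite A" "finite C"
  shows "\<exists>N. \<forall>\<xi> :: nat list \<Rightarrow> nat. (\<forall>u. \<xi> u \<in> C) \<longrightarrow>
      (\<exists>w col. is_line A w \<and> length w = N \<and> (\<forall>x\<in>A. \<xi> (fill x w) = col))"
  using assms(1)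
proof induction
  case empty
  show ?case by (intro exI[of _ 1] allI impI exI[of _ "[None]"]) (simp add: is_line_def)
next
  case (insert a A)
  show ?case
  proof (cases "A = {}")
    \<comment> \<open>With a single letter there is no old letter to imitate, but every line is
      monochromatic.\<close>
    case True
    have "is_line (insert a A) [None] \<and> length [None :: nat option] = 1" by (simp add: is_line_def)
    with True show ?thesis by (metis singletonD)
  next
    case False
    then obtain b where b: "b \<in> A" by blast
    from insert.IH obtain m where m: "\<And>\<xi> :: nat list \<Rightarrow> nat. (\<forall>u. \<xi> u \<in> C) \<Longrightarrow>
      (\<exists>w col. is_line A w \<and> length w = m \<and> (\<forall>x\<in>A. \<xi> (fill x w) = col))" by blast
    from insensitive_blocks[of "insert a A" a b C m] obtain N where N:
      "\<And>\<xi> :: nat list \<Rightarrow> nat. (\<forall>u. \<xi> u \<in> C) \<Longrightarrow>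
      (\<exists>ws. length ws = m \<and> (\<forall>w\<in>set ws. is_line (insert a A) w) \<and> length (concat ws) = N \<and>
        (\<forall>z. length z = m \<longrightarrow> set z \<subseteq> insert a A \<longrightarrow>
          \<xi> (fill_blocks ws z) = \<xi> (fill_blocks ws (map (id(a := b)) z))))"
      using insert b assms by auto
    show ?thesis
    proof (intro exI[of _ N] allI impI)
      fix \<xi> :: "nat list \<Rightarrow> nat"
      assume \<xi>: "\<forall>u. \<xi> u \<in> C"
      from N[OF this] obtain ws where ws: "length ws = m" "\<forall>w\<in>set ws. is_line (insert a A) w"
        "length (concat ws) = N"
        and wz: "\<And>z. length z = m \<Longrightarrow> set z \<subseteq> insert a A \<Longrightarrow>
          \<xi> (fill_blocks ws z) = \<xi> (fill_blocks ws (map (id(a := b)) z))" by blast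
      have "\<forall>u. \<xi> (fill_blocks ws u) \<in> C" using \<xi> by blast
      from m[OF this] obtain v col where v: "is_line A v" "length v = m"
        and col: "\<And>x. x \<in> A \<Longrightarrow> \<xi> (fill_blocks ws (fill x v)) = col" by blast
      have v': "is_line (insert a A) v" using v by (auto simp: is_line_def)
      have "map (id(a := b)) (fill a v) = fill b v"
        using v(1) insert.hyps by (auto simp: fill_def is_line_def split: option.splits)
      then have "\<xi> (fill_blocks ws (fill a v)) = col"
        using wz[of "fill a v"] set_fill[OF v', of a] v(2) col[OF b] by simp
      then have "\<forall>x\<in>insert a A. \<xi> (fill x (glue ws v)) = col"
        using col v(2) ws(1) by (auto simp: fill_glue)
      then show "\<exists>w col. is_line (insert a A) w \<and> length w = N \<and>
          (\<forall>x\<in>insert a A. \<xi> (fill x w) = col)"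
        using is_line_glue[OF _ v' ws(2)] length_glue[of v ws] v(2) ws by auto
    qed
  qed
qed

section \<open>The partite construction\<close>

text \<open>\<open>(V, E, \<pi>)\<close> is a hypergraph on \<open>V\<close> together with a projection \<open>\<pi>\<close> to some index set.\<close>

definition partite_embedding ::
  "nat set \<Rightarrow> nat set set \<Rightarrow> (nat \<Rightarrow> nat) \<Rightarrow> nat set \<Rightarrow> nat set set \<Rightarrow> (nat \<Rightarrow> nat) \<Rightarrow> (nat \<Rightarrow> nat) \<Rightarrow> bool"
  where
  "partite_embedding V E \<pi> V' E' \<pi>' f \<longleftrightarrow>
     inj_on f V \<and> f ` V \<subseteq> V' \<and> (\<forall>v\<in>V. \<pi>' (f v) = \<pi> v) \<and> (\<forall>X\<subseteq>V. f ` X \<in> E' \<longleftrightarrow> X \<in> E)"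

text \<open>Embeddings rather than their images are coloured, because a group element will be seen
  through its values on \<open>F\<close>, not through the set of these values.\<close>

definition copies :: "nat set \<Rightarrow> (nat set \<Rightarrow> bool) \<Rightarrow> nat set \<Rightarrow> nat set set \<Rightarrow> (nat \<Rightarrow> nat) set" where
  "copies F R V E = {e \<in> F \<rightarrow>\<^sub>E V. inj_on e F \<and> (\<forall>C\<subseteq>F. e ` C \<in> E \<longleftrightarrow> R C)}"

definition copies_over :: "nat set \<Rightarrow> (nat set \<Rightarrow> bool) \<Rightarrow> nat set \<Rightarrow> nat set set \<Rightarrow> (nat \<Rightarrow> nat) \<Rightarrow>
    (nat \<Rightarrow> nat) \<Rightarrow> (nat \<Rightarrow> nat) set" where
  "copies_over F R V E \<pi> \<alpha> = {e \<in> copies F R V E. \<forall>z\<in>F. \<pi> (e z) = \<alpha> z}"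

lemma partite_embedding_compose:
  assumes "partite_embedding V E \<pi> V' E' \<pi>' f" "partite_embedding V' E' \<pi>' V'' E'' \<pi>'' g"
  shows "partite_embedding V E \<pi> V'' E'' \<pi>'' (g \<circ> f)"
proof -
  have "(g \<circ> f) ` X \<in> E'' \<longleftrightarrow> X \<in> E" if "X \<subseteq> V" for X
  proof -
    have "f ` X \<subseteq> V'" using that assms(1) unfolding partite_embedding_def by blast
    then have "g ` f ` X \<in> E'' \<longleftrightarrow> f ` X \<in> E'" using assms(2) by (simp add: partite_embedding_def)
    then show ?thesis using that assms(1) by (simp add: partite_embedding_def image_comp)
  qed
  moreover have "inj_on (g \<circ> f) V"
    using assms by (meson comp_inj_on inj_on_subset partite_embedding_def)
  ultimately show ?thesis using assms by (auto simp: partite_embedding_def)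
qed

lemma copies_compose:
  assumes e: "e \<in> copies F R V E"
    and f: "inj_on f V" "f ` V \<subseteq> V'" "\<forall>X\<subseteq>V. f ` X \<in> E' \<longleftrightarrow> X \<in> E"
  shows "restrict (f \<circ> e) F \<in> copies F R V' E'"
proof -
  have eF: "e ` F \<subseteq> V" using e by (auto simp: copies_def)
  have "restrict (f \<circ> e) F ` C = f ` e ` C" if "C \<subseteq> F" for C using that by force
  moreover have "inj_on (f \<circ> e) F"
    using e f eF by (auto simp: copies_def intro!: comp_inj_on intro: inj_on_subset)
  moreover have "f ` e ` C \<in> E' \<longleftrightarrow> R C" if "C \<subseteq> F" for C
  proof -
    have "e ` C \<subseteq> V" using that eF by blast
    then show ?thesis using f(3) e that by (simp add: copies_def)
  qed
  moreover have "restrict (f \<circ> e) F \<in> F \<rightarrow>\<^sub>E V'" using eF f(2) by fastforce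
  ultimately show ?thesis by (auto simp: copies_def inj_on_restrict_eq)
qed

lemma copies_over_compose:
  assumes "e \<in> copies_over F R V E \<pi> \<alpha>" "partite_embedding V E \<pi> V' E' \<pi>' f"
  shows "restrict (f \<circ> e) F \<in> copies_over F R V' E' \<pi>' \<alpha>"
proof -
  have "restrict (f \<circ> e) F \<in> copies F R V' E'"
    using assms by (intro copies_compose[of e F R V E]) (auto simp: copies_over_def partite_embedding_def)
  moreover have "e z \<in> V" if "z \<in> F" for z
    using assms that by (auto simp: copies_over_def copies_def)
  ultimately show ?thesis using assms
    by (simp add: copies_over_def partite_embedding_def)
qed

lemma finite_copies: "finite F \<Longrightarrow> finite V \<Longrightarrow> finite (copies F R V E)"
  by (rule finite_subset[of _ "F \<rightarrow>\<^sub>E V"]) (auto simp: copies_def finite_PiE)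

text \<open>One step of the construction, for a single projection \<open>\<alpha>\<close>. The
  Hales-Jewett alphabet consists of the copies of \<open>F\<close> over \<open>\<alpha>\<close>,
  listed by \<open>lam\<close>; every line of length \<open>N\<close> contributes one copy of the
  whole system \<open>(V, E)\<close>, and these copies are glued along the fibres over
  \<open>F\<close>.\<close>

locale partite_amalgam =
  fixes F :: "nat set" and R :: "nat set \<Rightarrow> bool" and V :: "nat set" and E :: "nat set set"
    and \<pi> \<alpha> :: "nat \<Rightarrow> nat" and L :: nat and lam :: "nat \<Rightarrow> nat \<Rightarrow> nat" and N :: nat
  assumes finF: "finite F" and finV: "finite V" and EV: "E \<subseteq> Pow V" and inj_\<alpha>: "inj_on \<alpha> F"
    and lam: "lam ` {..<L} = copies_over F R V E \<pi> \<alpha>"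
begin

text \<open>If the fibre of \<open>v\<close> lies over \<open>F\<close>, the copy
  \<open>lam j\<close> has exactly one point in it, which takes the place of \<open>v\<close> at the
  constant letter \<open>j\<close>. So all coordinates of a word stay in one fibre.\<close>

definition coord :: "nat \<Rightarrow> nat option \<Rightarrow> nat" where
  "coord v p = (case p of None \<Rightarrow> v | Some j \<Rightarrow> lam j (inv_into F \<alpha> (\<pi> v)))"

definition code :: "nat list + nat option list \<times> nat \<Rightarrow> nat" where
  "code = to_nat"

text \<open>Words carry no record of their line, so different lines may share points over
  \<open>F\<close>; all other points are tagged with their line and belong to it alone.\<close>

definition emb :: "nat option list \<Rightarrow> nat \<Rightarrow> nat" where
  "emb f v = code (if \<pi> v \<in> \<alpha> ` F then Inl (map (coord v) f) else Inr (f, v))"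

definition lines :: "nat option list set" where
  "lines = {f. is_line {..<L} f \<and> length f = N}"

definition V' :: "nat set" where "V' = (\<Union>f\<in>lines. emb f ` V)"

definition E' :: "nat set set" where "E' = (\<Union>f\<in>lines. (\<lambda>X. emb f ` X) ` E)"

text \<open>All letters of a word arising from a line lie in the same fibre, so the first one
  determines the projection.\<close>

definition \<pi>' :: "nat \<Rightarrow> nat" where
  "\<pi>' k = (case (from_nat k :: nat list + nat option list \<times> nat) of
      Inl w \<Rightarrow> \<pi> (hd w) | Inr q \<Rightarrow> \<pi> (snd q))"

lemma code_eq [simp]: "code x = code y \<longleftrightarrow> x = y"
  by (simp add: code_def)

lemma lam_copy: "j < L \<Longrightarrow> lam j \<in> copies_over F R V E \<pi> \<alpha>"
  using lam by blast

lemma finite_lines: "finite lines"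
proof -
  have "lines \<subseteq> {f. set f \<subseteq> insert None (Some ` {..<L}) \<and> length f = N}"
    by (auto simp: lines_def is_line_def)
  then show ?thesis by (rule finite_subset) (simp add: finite_lists_length_eq)
qed

lemma lines_None: "f \<in> lines \<Longrightarrow> \<exists>t<N. f ! t = None"
  by (auto simp: lines_def is_line_def in_set_conv_nth)

lemma lines_Some: "f \<in> lines \<Longrightarrow> t < N \<Longrightarrow> f ! t = Some j \<Longrightarrow> j < L"
  unfolding lines_def is_line_def using nth_mem by fastforce

lemma lines_length: "f \<in> lines \<Longrightarrow> length f = N"
  by (simp add: lines_def)

lemma proj_coord:
  assumes "f \<in> lines" "t < N" "\<pi> v \<in> \<alpha> ` F"
  shows "\<pi> (coord v (f ! t)) = \<pi> v"
proof (cases "f ! t")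
  case (Some j)
  then have "lam j \<in> copies_over F R V E \<pi> \<alpha>" using lam_copy lines_Some assms by blast
  moreover have "inv_into F \<alpha> (\<pi> v) \<in> F" using assms(3) by (rule inv_into_into)
  ultimately show ?thesis using Some assms(3)
    by (auto simp: coord_def copies_over_def f_inv_into_f)
qed (simp add: coord_def)

lemma proj_emb:
  assumes "f \<in> lines" shows "\<pi>' (emb f v) = \<pi> v"
proof (cases "\<pi> v \<in> \<alpha> ` F")
  case True
  have "N > 0" using lines_None[OF assms] by auto
  then have "hd (map (coord v) f) = coord v (f ! 0)"
    using lines_length[OF assms] by (cases f) auto
  then show ?thesis using True proj_coord[OF assms \<open>N > 0\<close> True]
    by (simp add: \<pi>'_def emb_def code_def)
qed (simp add: \<pi>'_def emb_def code_def)

text \<open>A point that became a word is read off at an active coordinate of the line; a tagged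
  point carries \<open>v\<close> itself.\<close>

lemma inj_emb:
  assumes f: "f \<in> lines" shows "inj (emb f)"
proof (rule injI)
  fix v w assume eq: "emb f v = emb f w"
  then have pi: "\<pi> v = \<pi> w" using proj_emb[OF f] by metis
  obtain t where t: "t < N" "f ! t = None" using lines_None[OF f] by blast
  show "v = w"
  proof (cases "\<pi> v \<in> \<alpha> ` F")
    case True
    then have "map (coord v) f = map (coord w) f" using eq pi by (simp add: emb_def)
    then have "map (coord v) f ! t = map (coord w) f ! t" by (rule arg_cong)
    then show ?thesis using t lines_length[OF f] by (simp add: coord_def)
  next
    case False
    then show ?thesis using eq pi by (simp add: emb_def)
  qed
qed

lemma coord_image_emb:
  assumes "f \<in> lines" "g \<in> lines" "emb f ` X = emb g ` Y" "\<forall>v\<in>X. \<pi> v \<in> \<alpha> ` F"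
    "\<forall>v\<in>Y. \<pi> v \<in> \<alpha> ` F" "t < N"
  shows "(\<lambda>v. coord v (f ! t)) ` X = (\<lambda>v. coord v (g ! t)) ` Y"
proof -
  define pr where "pr k = (case (from_nat k :: nat list + nat option list \<times> nat) of
      Inl w \<Rightarrow> w ! t | Inr q \<Rightarrow> 0)" for k
  have "pr (emb h v) = coord v (h ! t)" if "h \<in> lines" "\<pi> v \<in> \<alpha> ` F" for h v
    using that assms(6) lines_length[of h] by (simp add: pr_def emb_def code_def)
  then have "pr ` emb f ` X = (\<lambda>v. coord v (f ! t)) ` X"
    "pr ` emb g ` Y = (\<lambda>v. coord v (g ! t)) ` Y"
    using assms(1,2,4,5) by (force simp: image_image)+
  then show ?thesis using assms(3) by simp
qed

text \<open>At a constant coordinate everything is moved into one copy of \<open>F\<close>, where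
  being an edge depends only on the projection.\<close>

lemma coord_image_Some:
  assumes "f \<in> lines" "t < N" "f ! t = Some j" "X \<subseteq> V" "\<forall>v\<in>X. \<pi> v \<in> \<alpha> ` F"
  shows "(\<lambda>v. coord v (f ! t)) ` X \<in> E \<longleftrightarrow> R (inv_into F \<alpha> ` \<pi> ` X)"
proof -
  have "lam j \<in> copies_over F R V E \<pi> \<alpha>" using assms lam_copy lines_Some by blast
  moreover have "inv_into F \<alpha> ` \<pi> ` X \<subseteq> F" using assms(5) by (auto intro: inv_into_into)
  ultimately have "lam j ` inv_into F \<alpha> ` \<pi> ` X \<in> E \<longleftrightarrow> R (inv_into F \<alpha> ` \<pi> ` X)"
    by (auto simp: copies_over_def copies_def)
  moreover have "(\<lambda>v. coord v (f ! t)) ` X = lam j ` inv_into F \<alpha> ` \<pi> ` X"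
    by (simp add: coord_def assms(3) image_image)
  ultimately show ?thesis by simp
qed

text \<open>Two lines with a common active coordinate agree there on both sets; if the active coordinates
  are disjoint, both sets project to the same subset of the copy of \<open>F\<close>, which is an
  edge because one of the two sets is.\<close>

lemma emb_induced:
  assumes f: "f \<in> lines" and X: "X \<subseteq> V"
  shows "emb f ` X \<in> E' \<longleftrightarrow> X \<in> E"
proof
  assume "emb f ` X \<in> E'"
  then obtain g Y where g: "g \<in> lines" "Y \<in> E" and eq: "emb f ` X = emb g ` Y"
    by (auto simp: E'_def)
  have YV: "Y \<subseteq> V" using g EV by blast
  have pi: "\<pi> ` X = \<pi> ` Y"
  proof -
    have "\<pi>' ` emb f ` X = \<pi>' ` emb g ` Y" using eq by simp
    then show ?thesis by (simp add: image_image proj_emb f g)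
  qed
  show "X \<in> E"
  proof (cases "\<pi> ` Y \<subseteq> \<alpha> ` F")
    case False
    then obtain y where y: "y \<in> Y" "\<pi> y \<notin> \<alpha> ` F" by blast
    then obtain x where x: "x \<in> X" "emb f x = emb g y" using eq by (metis image_iff)
    \<comment> \<open>A private point names its line.\<close>
    then have "f = g" using y by (auto simp: emb_def split: if_splits)
    then show ?thesis using eq g inj_emb[OF f] inj_image_eq_iff by metis
  next
    case True
    then have aX: "\<forall>v\<in>X. \<pi> v \<in> \<alpha> ` F" and aY: "\<forall>v\<in>Y. \<pi> v \<in> \<alpha> ` F" using pi by blast+
    have coord: "(\<lambda>v. coord v (f ! t)) ` X = (\<lambda>v. coord v (g ! t)) ` Y" if "t < N" for t
      using coord_image_emb[OF f g(1) eq aX aY that] .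
    obtain t where t: "t < N" "f ! t = None" using lines_None[OF f] by blast
    obtain s where s: "s < N" "g ! s = None" using lines_None[OF g(1)] by blast
    show ?thesis
    proof (cases "g ! t")
      case None
      then show ?thesis using coord[OF t(1)] t g by (simp add: coord_def)
    next
      case g_t: (Some i)
      show ?thesis
      proof (cases "f ! s")
        case None
        then show ?thesis using coord[OF s(1)] s g by (simp add: coord_def)
      next
        case f_s: (Some j)
        have "(\<lambda>v. coord v (f ! s)) ` X \<in> E" using coord[OF s(1)] s g by (simp add: coord_def)
        then have "R (inv_into F \<alpha> ` \<pi> ` X)" using coord_image_Some[OF f s(1) f_s X aX] by simp
        then have "(\<lambda>v. coord v (g ! t)) ` Y \<in> E"
          using coord_image_Some[OF g(1) t(1) g_t YV aY] pi by simp
        then show ?thesis using coord[OF t(1)] t by (simp add: coord_def)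
      qed
    qed
  qed
qed (use f in \<open>auto simp: E'_def\<close>)

lemma partite_embedding_emb: "f \<in> lines \<Longrightarrow> partite_embedding V E \<pi> V' E' \<pi>' (emb f)"
  using inj_emb[of f] emb_induced[of f] proj_emb[of f]
  by (auto simp: partite_embedding_def V'_def intro: inj_on_subset)

text \<open>The points of a combinatorial line are exactly the images under \<open>emb f\<close> of
  the copies over \<open>\<alpha>\<close>: the letter \<open>x\<close> corresponds to the copy
  \<open>lam x\<close>. A monochromatic line is thus an embedding of \<open>(V, E)\<close> under
  which all these copies get one colour.\<close>

lemma mono_copy:
  fixes \<xi> :: "(nat \<Rightarrow> nat) \<Rightarrow> nat"
  assumes HJ: "\<And>\<xi> :: nat list \<Rightarrow> nat. (\<forall>u. \<xi> u \<in> {..<c}) \<Longrightarrow>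
      (\<exists>w col. is_line {..<L} w \<and> length w = N \<and> (\<forall>x\<in>{..<L}. \<xi> (fill x w) = col))"
    and \<xi>: "\<forall>e. \<xi> e < c"
  shows "\<exists>f\<in>lines. \<exists>col. \<forall>e\<in>copies_over F R V E \<pi> \<alpha>. \<xi> (restrict (emb f \<circ> e) F) = col"
proof -
  define word where "word u = (\<lambda>z\<in>F. code (Inl (map (\<lambda>j. lam j z) u)))" for u
  have "\<forall>u. \<xi> (word u) \<in> {..<c}" using \<xi> by simp
  from HJ[OF this] obtain f col where f: "is_line {..<L} f" "length f = N"
    and col: "\<And>x. x < L \<Longrightarrow> \<xi> (word (fill x f)) = col" by auto
  have "\<xi> (restrict (emb f \<circ> e) F) = col" if "e \<in> copies_over F R V E \<pi> \<alpha>" for e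
  proof -
    obtain x where x: "x < L" "e = lam x" using lam \<open>e \<in> _\<close> by blast
    have "emb f (e z) = code (Inl (map (\<lambda>j. lam j z) (fill x f)))" if z: "z \<in> F" for z
    proof -
      have pi: "\<pi> (e z) = \<alpha> z" using \<open>e \<in> _\<close> z by (simp add: copies_over_def)
      have "coord (e z) p = lam (case p of None \<Rightarrow> x | Some y \<Rightarrow> y) z" for p
        using inj_\<alpha> z by (cases p) (auto simp: coord_def x(2)[symmetric] pi)
      then show ?thesis using z by (simp add: emb_def pi fill_def comp_def)
    qed
    then have "restrict (emb f \<circ> e) F = word (fill x f)" by (auto simp: word_def)
    then show ?thesis using col x by simp
  qed
  then show ?thesis using f by (auto simp: lines_def)
qed

text \<open>A clique meeting the private part of a copy lies in that copy; otherwise the projection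
  to a coordinate carries it to a clique of \<open>(V, E)\<close>.\<close>

lemma clique_free_V':
  assumes card2: "\<forall>Y\<in>E. card Y = 2"
    and hom: "\<forall>Y\<in>E. \<pi> ` Y \<subseteq> \<alpha> ` F \<longrightarrow> R {z \<in> F. \<alpha> z \<in> \<pi> ` Y}"
    and free: "clique_free n (\<lambda>X. X \<in> E) V"
  shows "clique_free n (\<lambda>X. X \<in> E') V'"
  unfolding clique_free_def
proof
  assume "\<exists>C\<subseteq>V'. finite C \<and> card C = n \<and> (\<forall>x\<in>C. \<forall>y\<in>C. x \<noteq> y \<longrightarrow> {x, y} \<in> E')"
  then obtain Q where Q: "Q \<subseteq> V'" "finite Q" "card Q = n"
    and edge: "\<And>x y. x \<in> Q \<Longrightarrow> y \<in> Q \<Longrightarrow> x \<noteq> y \<Longrightarrow> {x, y} \<in> E'" by blast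
  show False
  proof (cases "\<exists>f v. code (Inr (f, v)) \<in> Q")
    case True
    then obtain f v where fv: "code (Inr (f, v)) \<in> Q" by blast
    have vf: "f \<in> lines \<and> v \<in> V \<and> \<pi> v \<notin> \<alpha> ` F"
      using fv Q(1) by (auto simp: V'_def emb_def split: if_splits)
    have "q \<in> emb f ` V" if q: "q \<in> Q" for q
    proof (cases "q = code (Inr (f, v))")
      case True
      then have "q = emb f v" using vf by (simp add: emb_def)
      then show ?thesis using vf by blast
    next
      case False
      then obtain g Y where g: "g \<in> lines" "Y \<in> E" "{code (Inr (f, v)), q} = emb g ` Y"
        using edge[OF fv q] False by (auto simp: E'_def)
      then obtain y where "y \<in> Y" "code (Inr (f, v)) = emb g y" by blast
      then have "g = f" by (auto simp: emb_def split: if_splits)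
      then show ?thesis using g EV by blast
    qed
    then have QV: "Q \<subseteq> emb f ` V" by blast
    define Q0 where "Q0 = {w \<in> V. emb f w \<in> Q}"
    have img: "emb f ` Q0 = Q" using QV by (auto simp: Q0_def)
    have inj: "inj_on (emb f) Q0" using inj_emb vf by (meson inj_on_subset subset_UNIV)
    have "finite Q0" "card Q0 = n"
      using img inj Q finite_imageD card_image by (metis, metis)
    moreover have "{x, y} \<in> E" if "x \<in> Q0" "y \<in> Q0" "x \<noteq> y" for x y
    proof -
      have "emb f x \<noteq> emb f y" using inj that by (meson inj_onD)
      then have "emb f ` {x, y} \<in> E'" using edge that by (simp add: Q0_def)
      then show ?thesis using emb_induced[of f "{x, y}"] vf that by (simp add: Q0_def)
    qed
    moreover have "Q0 \<subseteq> V" by (auto simp: Q0_def)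
    ultimately show False using free unfolding clique_free_def by blast
  next
    case False
    define pr where "pr k = (case (from_nat k :: nat list + nat option list \<times> nat) of
      Inl w \<Rightarrow> hd w | Inr q \<Rightarrow> 0)" for k
    have pr_emb: "pr (emb f v) = coord v (f ! 0)" if "f \<in> lines" "\<pi> v \<in> \<alpha> ` F" for f v
    proof -
      have "f \<noteq> []" using lines_None[OF that(1)] lines_length[OF that(1)] by auto
      then show ?thesis using that by (simp add: pr_def emb_def code_def hd_map hd_conv_nth)
    qed
    have N: "N > 0" if "f \<in> lines" for f using lines_None[OF that] by auto
    have pred: "{pr x, pr y} \<in> E" if xy: "x \<in> Q" "y \<in> Q" "x \<noteq> y" for x y
    proof -
      obtain g Y where g: "g \<in> lines" "Y \<in> E" "{x, y} = emb g ` Y"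
        using edge[OF xy] by (auto simp: E'_def)
      have a: "\<forall>v\<in>Y. \<pi> v \<in> \<alpha> ` F"
      proof (rule ccontr)
        assume "\<not> ?thesis"
        then obtain v where "v \<in> Y" "emb g v = code (Inr (g, v))" by (auto simp: emb_def)
        then have "code (Inr (g, v)) \<in> {x, y}" using g by (metis imageI)
        then show False using False xy by auto
      qed
      have YV: "Y \<subseteq> V" using g EV by blast
      have "pr ` {x, y} = (\<lambda>v. coord v (g ! 0)) ` Y"
        unfolding g(3) using a by (simp add: image_image pr_emb g(1))
      moreover have "(\<lambda>v. coord v (g ! 0)) ` Y \<in> E"
      proof (cases "g ! 0")
        case None
        then show ?thesis using g by (simp add: coord_def)
      next
        case (Some j)
        have "inv_into F \<alpha> ` \<pi> ` Y = {z \<in> F. \<alpha> z \<in> \<pi> ` Y}"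
        proof
          show "inv_into F \<alpha> ` \<pi> ` Y \<subseteq> {z \<in> F. \<alpha> z \<in> \<pi> ` Y}"
            using a by (auto simp: inv_into_into f_inv_into_f)
          show "{z \<in> F. \<alpha> z \<in> \<pi> ` Y} \<subseteq> inv_into F \<alpha> ` \<pi> ` Y"
            using inj_\<alpha> by (metis (mono_tags, lifting) image_eqI inv_into_f_f mem_Collect_eq subsetI)
        qed
        \<comment> \<open>The hypothesis \<open>hom\<close> turns the projection of \<open>Y\<close>
          into an edge on \<open>F\<close>, which the copy \<open>lam j\<close> maps to an edge of
          \<open>E\<close>.\<close>
        then have "R (inv_into F \<alpha> ` \<pi> ` Y)" using hom g(2) a by auto
        then show ?thesis using coord_image_Some[OF g(1) N[OF g(1)] Some YV a] by simp
      qed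
      ultimately show ?thesis by simp
    qed
    \<comment> \<open>An edge has two points and cannot collapse, so \<open>pr\<close> is injective
      on the clique.\<close>
    have neq: "pr x \<noteq> pr y" if "x \<in> Q" "y \<in> Q" "x \<noteq> y" for x y
      using pred[OF that] card2 by force
    have "inj_on pr Q" using neq by (meson inj_onI)
    then have "card (pr ` Q) = n" using Q card_image by blast
    moreover have "pr ` Q \<subseteq> V"
    proof
      fix k assume "k \<in> pr ` Q"
      then obtain q where q: "q \<in> Q" "k = pr q" by blast
      then obtain f v where fv: "f \<in> lines" "v \<in> V" "q = emb f v" using Q by (auto simp: V'_def)
      have a: "\<pi> v \<in> \<alpha> ` F" using False q fv by (auto simp: emb_def split: if_splits)
      show "k \<in> V"
      proof (cases "f ! 0")
        case None
        then show ?thesis using q fv pr_emb[OF fv(1) a] by (simp add: coord_def)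
      next
        case (Some j)
        then have "lam j \<in> copies_over F R V E \<pi> \<alpha>"
          using lam_copy lines_Some[OF fv(1) N[OF fv(1)]] by blast
        then have "lam j (inv_into F \<alpha> (\<pi> v)) \<in> V"
          using inv_into_into[OF a] by (auto simp: copies_over_def copies_def)
        then show ?thesis using q fv pr_emb[OF fv(1) a] Some by (simp add: coord_def)
      qed
    qed
    moreover have "\<forall>x\<in>pr ` Q. \<forall>y\<in>pr ` Q. x \<noteq> y \<longrightarrow> {x, y} \<in> E" using pred by auto
    ultimately show False using free Q(2) unfolding clique_free_def by blast
  qed
qed

end

text \<open>Every edge of the amalgam is the image of an old edge under an embedding of the system;
  this clause lets conditions on the size and projection of edges survive iteration.\<close>

lemma partite_step:
  assumes "finite F" "finite V" "E \<subseteq> Pow V" "inj_on \<alpha> F"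
  shows "\<exists>V' E' \<pi>'. finite V' \<and> E' \<subseteq> Pow V' \<and>
    (\<forall>X\<in>E'. \<exists>Y\<in>E. \<exists>f. partite_embedding V E \<pi> V' E' \<pi>' f \<and> X = f ` Y) \<and>
    ((\<forall>Y\<in>E. card Y = 2) \<longrightarrow> (\<forall>Y\<in>E. \<pi> ` Y \<subseteq> \<alpha> ` F \<longrightarrow> R {z \<in> F. \<alpha> z \<in> \<pi> ` Y}) \<longrightarrow>
      clique_free n (\<lambda>X. X \<in> E) V \<longrightarrow> clique_free n (\<lambda>X. X \<in> E') V') \<and>
    (\<forall>\<xi>. (\<forall>e. \<xi> e < (c::nat)) \<longrightarrow>
      (\<exists>f col. partite_embedding V E \<pi> V' E' \<pi>' f \<and>
        (\<forall>e\<in>copies_over F R V E \<pi> \<alpha>. \<xi> (restrict (f \<circ> e) F) = col)))"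
proof -
  have "finite (copies_over F R V E \<pi> \<alpha>)"
    using finite_copies[OF assms(1,2), of R E] by (simp add: copies_over_def)
  then obtain lam :: "nat \<Rightarrow> nat \<Rightarrow> nat" and L
    where lam: "copies_over F R V E \<pi> \<alpha> = lam ` {..<L}"
    using finite_imp_nat_seg_image_inj_on[of "copies_over F R V E \<pi> \<alpha>"] by (auto simp: lessThan_def)
  obtain N where HJ: "\<And>\<xi> :: nat list \<Rightarrow> nat. (\<forall>u. \<xi> u \<in> {..<c}) \<Longrightarrow>
      (\<exists>w col. is_line {..<L} w \<and> length w = N \<and> (\<forall>x\<in>{..<L}. \<xi> (fill x w) = col))"
    using hales_jewett[of "{..<L}" "{..<c}"] by auto
  interpret partite_amalgam F R V E \<pi> \<alpha> L lam N
    using assms lam by unfold_locales auto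
  show ?thesis
  proof (rule exI[of _ V'], rule exI[of _ E'], rule exI[of _ \<pi>'], intro conjI impI allI)
    show "finite V'" using finite_lines finV by (simp add: V'_def)
    show "E' \<subseteq> Pow V'" using EV by (auto simp: V'_def E'_def)
    show "\<forall>X\<in>E'. \<exists>Y\<in>E. \<exists>f. partite_embedding V E \<pi> V' E' \<pi>' f \<and> X = f ` Y"
      using partite_embedding_emb by (auto simp: E'_def)
    show "clique_free n (\<lambda>X. X \<in> E') V'"
      if "\<forall>Y\<in>E. card Y = 2" "\<forall>Y\<in>E. \<pi> ` Y \<subseteq> \<alpha> ` F \<longrightarrow> R {z \<in> F. \<alpha> z \<in> \<pi> ` Y}"
        "clique_free n (\<lambda>X. X \<in> E) V" using clique_free_V' that by blast
    fix \<xi> :: "(nat \<Rightarrow> nat) \<Rightarrow> nat" assume "\<forall>e. \<xi> e < c"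
    from mono_copy[OF HJ this] partite_embedding_emb
    show "\<exists>f col. partite_embedding V E \<pi> V' E' \<pi>' f \<and>
        (\<forall>e\<in>copies_over F R V E \<pi> \<alpha>. \<xi> (restrict (f \<circ> e) F) = col)" by blast
  qed
qed

definition mono_fibres :: "nat set \<Rightarrow> (nat set \<Rightarrow> bool) \<Rightarrow> (nat \<Rightarrow> nat) set \<Rightarrow> nat \<Rightarrow>
    nat set \<Rightarrow> nat set set \<Rightarrow> (nat \<Rightarrow> nat) \<Rightarrow> nat set \<Rightarrow> nat set set \<Rightarrow> (nat \<Rightarrow> nat) \<Rightarrow> bool" where
  "mono_fibres F R \<A> c V E \<pi> V' E' \<pi>' \<longleftrightarrow> (\<forall>\<xi>. (\<forall>e. \<xi> e < c) \<longrightarrow>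
      (\<exists>f. partite_embedding V E \<pi> V' E' \<pi>' f \<and>
        (\<forall>\<alpha>\<in>\<A>. \<exists>col. \<forall>e\<in>copies_over F R V E \<pi> \<alpha>. \<xi> (restrict (f \<circ> e) F) = col)))"

text \<open>Induction over the projections. The embedding \<open>f\<close> into the last amalgam is
  chosen first and settles the new \<open>\<alpha>\<close>; the embedding \<open>g\<close> into the
  previous one is then chosen for the colouring pulled back along \<open>f\<close>. The predicate
  \<open>P\<close> records what is known about projections of edges, and the flag
  \<open>kfree\<close> lets hypergraphs and clique-free graphs share the induction.\<close>

lemma partite_iterate:
  fixes c :: nat
  assumes "finite \<A>" "\<forall>\<alpha>\<in>\<A>. inj_on \<alpha> F" "finite F" "finite V" "E \<subseteq> Pow V"
    and "\<forall>Y\<in>E. P (\<pi> ` Y) \<and> card Y = r"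
    and "kfree \<longrightarrow> r = 2 \<and> clique_free n (\<lambda>X. X \<in> E) V \<and>
      (\<forall>\<alpha>\<in>\<A>. \<forall>Z. P Z \<longrightarrow> Z \<subseteq> \<alpha> ` F \<longrightarrow> R {z \<in> F. \<alpha> z \<in> Z})"
  shows "\<exists>V' E' \<pi>'. finite V' \<and> E' \<subseteq> Pow V' \<and> (\<forall>Y\<in>E'. P (\<pi>' ` Y) \<and> card Y = r) \<and>
    (kfree \<longrightarrow> clique_free n (\<lambda>X. X \<in> E') V') \<and>
    mono_fibres F R \<A> c V E \<pi> V' E' \<pi>'"
  using assms(1,2,7)
proof induction
  case empty
  show ?case
  proof (rule exI[of _ V], rule exI[of _ E], rule exI[of _ \<pi>], intro conjI impI allI)
    have "partite_embedding V E \<pi> V E \<pi> id" by (simp add: partite_embedding_def)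
    then show "mono_fibres F R {} c V E \<pi> V E \<pi>" unfolding mono_fibres_def by blast
    show "clique_free n (\<lambda>X. X \<in> E) V" if kfree using that empty.prems by blast
  qed (fact assms(4-6))+
next
  case (insert \<alpha> \<A>)
  have "\<forall>\<alpha>\<in>\<A>. inj_on \<alpha> F" using insert.prems by blast
  moreover have "kfree \<longrightarrow> r = 2 \<and> clique_free n (\<lambda>X. X \<in> E) V \<and>
      (\<forall>\<alpha>\<in>\<A>. \<forall>Z. P Z \<longrightarrow> Z \<subseteq> \<alpha> ` F \<longrightarrow> R {z \<in> F. \<alpha> z \<in> Z})" using insert.prems by blast
  ultimately have "\<exists>V' E' \<pi>'. finite V' \<and> E' \<subseteq> Pow V' \<and> (\<forall>Y\<in>E'. P (\<pi>' ` Y) \<and> card Y = r) \<and>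
    (kfree \<longrightarrow> clique_free n (\<lambda>X. X \<in> E') V') \<and>
    mono_fibres F R \<A> c V E \<pi> V' E' \<pi>'"
    by (rule insert.IH)
  then obtain V1 E1 \<pi>1 where 1: "finite V1" "E1 \<subseteq> Pow V1" "\<forall>Y\<in>E1. P (\<pi>1 ` Y) \<and> card Y = r"
    "kfree \<longrightarrow> clique_free n (\<lambda>X. X \<in> E1) V1"
    and c1: "mono_fibres F R \<A> c V E \<pi> V1 E1 \<pi>1"
    by (elim exE conjE) (rule that, assumption+)
  have inj: "inj_on \<alpha> F" using insert.prems by blast
  from partite_step[OF assms(3) 1(1,2) inj, of \<pi>1 R n c]
  obtain V2 E2 \<pi>2 where 2: "finite V2" "E2 \<subseteq> Pow V2"
    and img: "\<forall>X\<in>E2. \<exists>Y\<in>E1. \<exists>f. partite_embedding V1 E1 \<pi>1 V2 E2 \<pi>2 f \<and> X = f ` Y"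
    and free: "(\<forall>Y\<in>E1. card Y = 2) \<longrightarrow>
      (\<forall>Y\<in>E1. \<pi>1 ` Y \<subseteq> \<alpha> ` F \<longrightarrow> R {z \<in> F. \<alpha> z \<in> \<pi>1 ` Y}) \<longrightarrow>
      clique_free n (\<lambda>X. X \<in> E1) V1 \<longrightarrow> clique_free n (\<lambda>X. X \<in> E2) V2"
    and c2: "\<forall>\<xi>. (\<forall>e. \<xi> e < c) \<longrightarrow>
      (\<exists>f col. partite_embedding V1 E1 \<pi>1 V2 E2 \<pi>2 f \<and>
        (\<forall>e\<in>copies_over F R V1 E1 \<pi>1 \<alpha>. \<xi> (restrict (f \<circ> e) F) = col))"
    by (elim exE conjE) (rule that, assumption+)
  have edges: "\<forall>X\<in>E2. P (\<pi>2 ` X) \<and> card X = r"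
  proof
    fix X assume "X \<in> E2"
    then obtain Y f where Y: "Y \<in> E1" "partite_embedding V1 E1 \<pi>1 V2 E2 \<pi>2 f" "X = f ` Y"
      using img by blast
    then have YV: "Y \<subseteq> V1" using 1 by blast
    then have "\<pi>2 ` X = \<pi>1 ` Y" unfolding Y(3) image_image
      using Y(2) by (intro image_cong[OF refl]) (auto simp: partite_embedding_def)
    moreover have "card X = card Y"
      using Y YV by (metis card_image inj_on_subset partite_embedding_def)
    ultimately show "P (\<pi>2 ` X) \<and> card X = r" using 1 Y by auto
  qed
  have cl: "kfree \<longrightarrow> clique_free n (\<lambda>X. X \<in> E2) V2"
  proof
    assume kfree
    then have r: "r = 2" and hom: "\<And>Z. P Z \<Longrightarrow> Z \<subseteq> \<alpha> ` F \<Longrightarrow> R {z \<in> F. \<alpha> z \<in> Z}"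
      and "clique_free n (\<lambda>X. X \<in> E1) V1" using insert.prems(2) 1(4) by blast+
    moreover have "\<forall>Y\<in>E1. card Y = 2" using 1(3) r by blast
    moreover have "\<forall>Y\<in>E1. \<pi>1 ` Y \<subseteq> \<alpha> ` F \<longrightarrow> R {z \<in> F. \<alpha> z \<in> \<pi>1 ` Y}" using hom 1(3) by blast
    ultimately show "clique_free n (\<lambda>X. X \<in> E2) V2" using free by blast
  qed
  have "\<exists>f. partite_embedding V E \<pi> V2 E2 \<pi>2 f \<and>
        (\<forall>\<alpha>\<in>insert \<alpha> \<A>. \<exists>col. \<forall>e\<in>copies_over F R V E \<pi> \<alpha>. \<xi> (restrict (f \<circ> e) F) = col)"
    if \<xi>: "\<forall>e. \<xi> e < c" for \<xi>
  proof -
    from spec[OF c2, of \<xi>] \<xi> obtain f col where f: "partite_embedding V1 E1 \<pi>1 V2 E2 \<pi>2 f"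
      "\<forall>e\<in>copies_over F R V1 E1 \<pi>1 \<alpha>. \<xi> (restrict (f \<circ> e) F) = col" by blast
    have "\<forall>e. \<xi> (restrict (f \<circ> e) F) < c" using \<xi> by simp
    with spec[OF c1[unfolded mono_fibres_def], of "\<lambda>e. \<xi> (restrict (f \<circ> e) F)"] obtain g where g: "partite_embedding V E \<pi> V1 E1 \<pi>1 g"
      "\<forall>\<alpha>\<in>\<A>. \<exists>col. \<forall>e\<in>copies_over F R V E \<pi> \<alpha>. \<xi> (restrict (f \<circ> restrict (g \<circ> e) F) F) = col"
      by blast
    have restr: "restrict (f \<circ> restrict (g \<circ> e) F) F = restrict ((f \<circ> g) \<circ> e) F" for e
      by (auto simp: fun_eq_iff)
    have "partite_embedding V E \<pi> V2 E2 \<pi>2 (f \<circ> g)" using partite_embedding_compose f g by blast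
    moreover have "\<xi> (restrict ((f \<circ> g) \<circ> e) F) = col" if "e \<in> copies_over F R V E \<pi> \<alpha>" for e
      using f(2) copies_over_compose[OF that g(1)] restr by metis
    moreover have "\<exists>col. \<forall>e\<in>copies_over F R V E \<pi> \<beta>. \<xi> (restrict ((f \<circ> g) \<circ> e) F) = col"
      if "\<beta> \<in> \<A>" for \<beta> using g(2) that unfolding restr by blast
    ultimately show ?thesis by (intro exI[of _ "f \<circ> g"]) blast
  qed
  then have "mono_fibres F R (insert \<alpha> \<A>) c V E \<pi> V2 E2 \<pi>2" by (simp add: mono_fibres_def)
  then show ?case using 2 edges cl by blast
qed

text \<open>One colouring \<open>\<xi>'\<close> of projections serves all \<open>\<beta>\<close> in
  \<open>\<B>\<close>. A Ramsey theorem on the index set can therefore be applied to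
  \<open>\<xi>'\<close> first, and the \<open>\<beta>\<close> it singles out then yields the copy
  \<open>f\<close> of \<open>N\<close>.\<close>

definition fibre_colouring :: "nat set \<Rightarrow> (nat set \<Rightarrow> bool) \<Rightarrow> nat set \<Rightarrow> (nat \<Rightarrow> nat) set \<Rightarrow>
    (nat \<Rightarrow> nat) set \<Rightarrow> nat \<Rightarrow> nat set \<Rightarrow> nat set set \<Rightarrow> bool" where
  "fibre_colouring F R N \<A> \<B> c V E \<longleftrightarrow>
    (\<forall>\<xi>. (\<forall>e. \<xi> e < c) \<longrightarrow> (\<exists>\<xi>'. (\<forall>e. \<xi>' e < c) \<and> (\<forall>\<beta>\<in>\<B>.
      (\<exists>f. inj_on f N \<and> f ` N \<subseteq> V \<and> (\<forall>X\<subseteq>N. f ` X \<in> E \<longleftrightarrow> R X) \<and>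
        (\<forall>e\<in>copies F R N {X. X \<subseteq> N \<and> R X}. restrict (\<beta> \<circ> e) F \<in> \<A> \<longrightarrow>
          \<xi> (restrict (f \<circ> e) F) = \<xi>' (restrict (\<beta> \<circ> e) F))))))"

text \<open>The partite construction applied to the disjoint union of copies of \<open>N\<close>, one over each
  map in \<open>\<B>\<close>.\<close>

lemma partite_construction:
  fixes c :: nat and \<B> :: "(nat \<Rightarrow> nat) set"
  assumes "finite \<A>" "\<forall>\<alpha>\<in>\<A>. inj_on \<alpha> F" "finite F" "finite N" "finite \<B>"
    and unif: "\<forall>X. X \<subseteq> N \<longrightarrow> R X \<longrightarrow> card X = r"
    and P: "\<forall>\<beta>\<in>\<B>. \<forall>X. X \<subseteq> N \<longrightarrow> R X \<longrightarrow> P (\<beta> ` X)"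
    and kfree: "kfree \<longrightarrow> r = 2 \<and> n > 0 \<and> clique_free n R N \<and>
      (\<forall>\<alpha>\<in>\<A>. \<forall>Z. P Z \<longrightarrow> Z \<subseteq> \<alpha> ` F \<longrightarrow> R {z \<in> F. \<alpha> z \<in> Z})"
  shows "\<exists>V E. finite V \<and> E \<subseteq> Pow V \<and> (\<forall>Y\<in>E. card Y = r) \<and>
    (kfree \<longrightarrow> clique_free n (\<lambda>X. X \<in> E) V) \<and>
    fibre_colouring F R N \<A> \<B> c V E"
proof (cases "c = 0")
  case True
  have "clique_free n (\<lambda>X. X \<in> {}) {}" if "n > 0" using that by (auto simp: clique_free_def)
  moreover have "fibre_colouring F R N \<A> \<B> c {} {}"
    unfolding fibre_colouring_def using True by blast
  ultimately show ?thesis using kfree by (intro exI[of _ "{} :: nat set"] exI[of _ "{} :: nat set set"]) auto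
next
  case False
  obtain bet :: "nat \<Rightarrow> nat \<Rightarrow> nat" and J where bet: "\<B> = bet ` {..<J}"
    using finite_imp_nat_seg_image_inj_on[OF assms(5)] by (auto simp: lessThan_def)
  define pt where "pt j v = prod_encode (j, v)" for j v :: nat
  have pt_eq [simp]: "pt j v = pt i w \<longleftrightarrow> j = i \<and> v = w" for i j v w
    by (simp add: pt_def)
  define V where "V = (\<Union>j<J. pt j ` N)"
  define E where "E = (\<Union>j<J. (\<lambda>X. pt j ` X) ` {X. X \<subseteq> N \<and> R X})"
  define \<pi> where "\<pi> k = (case prod_decode k of (j, v) \<Rightarrow> bet j v)" for k
  have pi_pt [simp]: "\<pi> (pt j v) = bet j v" for j v by (simp add: \<pi>_def pt_def)
  have inj_pt: "inj (pt j)" for j by (auto intro: injI)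
  have edge_pt: "pt j ` X \<in> E \<longleftrightarrow> R X" if "j < J" "X \<subseteq> N" for j X
  proof
    assume "pt j ` X \<in> E"
    then obtain i Y where Y: "pt j ` X = pt i ` Y" "Y \<subseteq> N" "R Y" by (auto simp: E_def)
    have "X = Y"
    proof (cases "X = {}")
      case True
      then show ?thesis using Y by auto
    next
      case False
      then obtain x where "x \<in> X" by blast
      then have "i = j" using Y(1) by (metis image_iff pt_eq)
      then show ?thesis using Y(1) inj_pt inj_image_eq_iff by metis
    qed
    then show "R X" using Y by simp
  qed (use that in \<open>auto simp: E_def\<close>)
  have "finite V" using assms(4) by (simp add: V_def)
  moreover have EV: "E \<subseteq> Pow V" by (auto simp: V_def E_def)
  moreover have "\<forall>Y\<in>E. P (\<pi> ` Y) \<and> card Y = r"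
  proof
    fix Y assume "Y \<in> E"
    then obtain j X where X: "j < J" "X \<subseteq> N" "R X" "Y = pt j ` X" by (auto simp: E_def)
    then have "\<pi> ` Y = bet j ` X" by (simp add: image_image)
    moreover have "card Y = card X"
      unfolding X(4) using inj_pt by (meson card_image inj_on_subset subset_UNIV)
    ultimately show "P (\<pi> ` Y) \<and> card Y = r" using X P unif bet by auto
  qed
  moreover have "clique_free n (\<lambda>X. X \<in> E) V" if "n > 0" "clique_free n R N"
    unfolding clique_free_def
  proof
    assume "\<exists>C\<subseteq>V. finite C \<and> card C = n \<and> (\<forall>x\<in>C. \<forall>y\<in>C. x \<noteq> y \<longrightarrow> {x, y} \<in> E)"
    then obtain C where C: "C \<subseteq> V" "finite C" "card C = n"
      "\<And>x y. x \<in> C \<Longrightarrow> y \<in> C \<Longrightarrow> x \<noteq> y \<Longrightarrow> {x, y} \<in> E" by blast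
    then obtain q where q: "q \<in> C" using \<open>n > 0\<close> by fastforce
    then obtain j v where jv: "j < J" "v \<in> N" "q = pt j v" using C by (auto simp: V_def)
    have sub: "C \<subseteq> pt j ` N"
    proof
      fix y assume y: "y \<in> C"
      show "y \<in> pt j ` N"
      proof (cases "y = q")
        case False
        then have "{q, y} \<in> E" using C(4)[OF q y] by simp
        then obtain i X where X: "X \<subseteq> N" "{q, y} = pt i ` X" by (auto simp: E_def)
        then have "i = j" using jv by (metis image_iff insertI1 pt_eq)
        then show ?thesis using X by blast
      qed (use jv in blast)
    qed
    define D where "D = {v \<in> N. pt j v \<in> C}"
    have img: "pt j ` D = C" using sub by (auto simp: D_def)
    have inj: "inj_on (pt j) D" using inj_pt by (meson inj_on_subset subset_UNIV)
    have "finite D" "card D = n" using img inj C finite_imageD card_image by (metis, metis)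
    moreover have "D \<subseteq> N" by (auto simp: D_def)
    moreover have "R {x, y}" if "x \<in> D" "y \<in> D" "x \<noteq> y" for x y
    proof -
      have "pt j ` {x, y} \<in> E" using C(4)[of "pt j x" "pt j y"] that by (simp add: D_def)
      then show ?thesis using edge_pt[OF jv(1), of "{x, y}"] that by (simp add: D_def)
    qed
    ultimately show False using \<open>clique_free n R N\<close> unfolding clique_free_def by blast
  qed
  ultimately obtain V' E' \<pi>' where V': "finite V'" "E' \<subseteq> Pow V'"
    "\<forall>Y\<in>E'. P (\<pi>' ` Y) \<and> card Y = r" "kfree \<longrightarrow> clique_free n (\<lambda>X. X \<in> E') V'"
    and col: "mono_fibres F R \<A> c V E \<pi> V' E' \<pi>'"
    using partite_iterate[OF assms(1-3), of V E P \<pi> r kfree n R c] kfree by auto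
  have "\<exists>\<xi>'. (\<forall>e. \<xi>' e < c) \<and> (\<forall>\<beta>\<in>\<B>.
      (\<exists>f. inj_on f N \<and> f ` N \<subseteq> V' \<and> (\<forall>X\<subseteq>N. f ` X \<in> E' \<longleftrightarrow> R X) \<and>
        (\<forall>e\<in>copies F R N {X. X \<subseteq> N \<and> R X}. restrict (\<beta> \<circ> e) F \<in> \<A> \<longrightarrow>
          \<xi> (restrict (f \<circ> e) F) = \<xi>' (restrict (\<beta> \<circ> e) F))))"
    if \<xi>: "\<forall>e. \<xi> e < c" for \<xi>
  proof -
    from col \<xi> obtain f where f: "partite_embedding V E \<pi> V' E' \<pi>' f"
      and "\<forall>\<alpha>\<in>\<A>. \<exists>col. \<forall>e\<in>copies_over F R V E \<pi> \<alpha>. \<xi> (restrict (f \<circ> e) F) = col"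
      unfolding mono_fibres_def by blast
    then obtain k where k: "\<And>\<alpha> e. \<alpha> \<in> \<A> \<Longrightarrow> e \<in> copies_over F R V E \<pi> \<alpha> \<Longrightarrow>
      \<xi> (restrict (f \<circ> e) F) = k \<alpha>" by metis
    define \<xi>' where "\<xi>' \<alpha> = (if k \<alpha> < c then k \<alpha> else 0)" for \<alpha>
    have "\<exists>g. inj_on g N \<and> g ` N \<subseteq> V' \<and> (\<forall>X\<subseteq>N. g ` X \<in> E' \<longleftrightarrow> R X) \<and>
        (\<forall>e\<in>copies F R N {X. X \<subseteq> N \<and> R X}. restrict (\<beta> \<circ> e) F \<in> \<A> \<longrightarrow>
          \<xi> (restrict (g \<circ> e) F) = \<xi>' (restrict (\<beta> \<circ> e) F))" if \<beta>: "\<beta> \<in> \<B>" for \<beta>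
    proof -
      obtain j where j: "j < J" "\<beta> = bet j" using bet \<beta> by blast
      have ptV: "pt j ` N \<subseteq> V" using j by (auto simp: V_def)
      have injN: "inj_on (pt j) N" using inj_pt by (meson inj_on_subset subset_UNIV)
      have "inj_on (f \<circ> pt j) N"
        using f ptV injN by (meson comp_inj_on inj_on_subset partite_embedding_def)
      moreover have "(f \<circ> pt j) ` N \<subseteq> V'" using f ptV by (auto simp: partite_embedding_def)
      moreover have "(f \<circ> pt j) ` X \<in> E' \<longleftrightarrow> R X" if "X \<subseteq> N" for X
      proof -
        have "pt j ` X \<subseteq> V" using that ptV by blast
        then have "f ` pt j ` X \<in> E' \<longleftrightarrow> pt j ` X \<in> E" using f by (simp add: partite_embedding_def)
        then show ?thesis using edge_pt[OF j(1) that] by (simp add: image_comp)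
      qed
      moreover have "\<xi> (restrict ((f \<circ> pt j) \<circ> e) F) = \<xi>' (restrict (\<beta> \<circ> e) F)"
        if e: "e \<in> copies F R N {X. X \<subseteq> N \<and> R X}" and \<alpha>: "restrict (\<beta> \<circ> e) F \<in> \<A>" for e
      proof -
        have "restrict (pt j \<circ> e) F \<in> copies F R V E"
          using e injN ptV edge_pt[OF j(1)] by (intro copies_compose[OF e]) auto
        then have "restrict (pt j \<circ> e) F \<in> copies_over F R V E \<pi> (restrict (\<beta> \<circ> e) F)"
          using j by (simp add: copies_over_def)
        from k[OF \<alpha> this] have "\<xi> (restrict (f \<circ> restrict (pt j \<circ> e) F) F) = k (restrict (\<beta> \<circ> e) F)" .
        moreover have "restrict (f \<circ> restrict (pt j \<circ> e) F) F = restrict ((f \<circ> pt j) \<circ> e) F"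
          by (auto simp: fun_eq_iff)
        ultimately show ?thesis using \<xi> unfolding \<xi>'_def by metis
      qed
      ultimately show ?thesis by (intro exI[of _ "f \<circ> pt j"]) blast
    qed
    moreover have "\<forall>e. \<xi>' e < c" using False by (simp add: \<xi>'_def)
    ultimately show ?thesis by blast
  qed
  then have "fibre_colouring F R N \<A> \<B> c V' E'" unfolding fibre_colouring_def by blast
  moreover have "\<forall>Y\<in>E'. card Y = r" using V'(3) by blast
  ultimately show ?thesis using V'(1,2,4) by (intro exI[of _ V'] exI[of _ E'] conjI)
qed

section \<open>The Ramsey property of the automorphism group\<close>

definition same_order :: "nat set \<Rightarrow> (nat \<Rightarrow> nat) \<Rightarrow> (nat \<Rightarrow> nat) \<Rightarrow> bool" where
  "same_order F e e' \<longleftrightarrow> (\<forall>x\<in>F. \<forall>y\<in>F. e x < e y \<longleftrightarrow> e' x < e' y)"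

text \<open>Only the pattern \<open>N\<close> is ordered, by the natural numbers. The target
  \<open>(V, E)\<close> carries no order and \<open>f\<close> need not be monotone: two copies of
  \<open>F\<close> are compared inside \<open>N\<close>.\<close>

definition order_colouring :: "nat set \<Rightarrow> (nat set \<Rightarrow> bool) \<Rightarrow> nat set \<Rightarrow> nat \<Rightarrow>
    nat set \<Rightarrow> nat set set \<Rightarrow> bool" where
  "order_colouring F R N c V E \<longleftrightarrow> (\<forall>\<xi>. (\<forall>e. \<xi> e < c) \<longrightarrow>
      (\<exists>f. inj_on f N \<and> f ` N \<subseteq> V \<and> (\<forall>X\<subseteq>N. f ` X \<in> E \<longleftrightarrow> R X) \<and>
        (\<forall>e\<in>copies F R N {X. X \<subseteq> N \<and> R X}. \<forall>e'\<in>copies F R N {X. X \<subseteq> N \<and> R X}.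
          same_order F e e' \<longrightarrow> \<xi> (restrict (f \<circ> e) F) = \<xi> (restrict (f \<circ> e') F))))"

section \<open>Ramsey theorems for finite structures up to order type\<close>

lemma ramsey_finite_colours:
  fixes Cs :: "'c set"
  assumes "finite Cs"
  shows "\<exists>p. \<forall>h :: nat set \<Rightarrow> 'c. (\<forall>X. h X \<in> Cs) \<longrightarrow>
    (\<exists>H\<subseteq>{..<p}. card H = b \<and> (\<exists>col. \<forall>X\<subseteq>H. card X = a \<longrightarrow> h X = col))"
proof -
  obtain i :: "'c \<Rightarrow> nat" and k where i: "i ` Cs = {..<k}" "inj_on i Cs"
    using finite_imp_inj_to_nat_seg[OF assms] by (auto simp: lessThan_def)
  obtain p :: nat where p: "partn_lst {..<p} (replicate k b) a" using ramsey_full[of "replicate k b" a] by blast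
  show ?thesis
  proof (intro exI[of _ p] allI impI)
    fix h :: "nat set \<Rightarrow> 'c" assume h: "\<forall>X. h X \<in> Cs"
    have "(\<lambda>X. i (h X)) \<in> nsets {..<p} a \<rightarrow> {..<k}" using h i by auto
    then obtain j H where j: "j < k" "H \<in> nsets {..<p} b" "(\<lambda>X. i (h X)) ` nsets H a \<subseteq> {j}"
      using partn_lstE[OF p, of "\<lambda>X. i (h X)" k] by auto
    have H: "H \<subseteq> {..<p}" "finite H" "card H = b" using j(2) by (auto simp: nsets_def)
    have "h X = inv_into Cs i j" if "X \<subseteq> H" "card X = a" for X
    proof -
      have "X \<in> nsets H a" using that H finite_subset by (auto simp: nsets_def)
      then have "i (h X) = j" using j(3) by blast
      then show ?thesis using i h by (metis inv_into_f_f)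
    qed
    then show "\<exists>H\<subseteq>{..<p}. card H = b \<and> (\<exists>col. \<forall>X\<subseteq>H. card X = a \<longrightarrow> h X = col)"
      using H by blast
  qed
qed

text \<open>The index set is \<open>{..<p}\<close> for a Ramsey number \<open>p\<close>, with all
  injections of \<open>F\<close> into it as projections. The colouring of projections becomes a
  colouring of sets of size \<open>card F\<close>. A homogeneous set \<open>H\<close> of size
  \<open>card N\<close> is the image of an increasing map on \<open>N\<close>, and the partite
  construction supplies a copy of \<open>N\<close> over that map.\<close>

lemma order_ramsey_unrestricted:
  fixes c :: nat
  assumes "finite F" "finite N" and unif: "\<forall>X. X \<subseteq> N \<longrightarrow> R X \<longrightarrow> card X = r"
  shows "\<exists>V E. finite V \<and> E \<subseteq> Pow V \<and> (\<forall>Y\<in>E. card Y = r) \<and>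
    order_colouring F R N c V E"
proof -
  \<comment> \<open>\<open>T\<close> contains all rank vectors: a rank counts elements of
    \<open>F\<close>, hence the bound \<open>card F\<close>.\<close>
  define T where "T = F \<rightarrow>\<^sub>E {..card F}"
  have en: "bij_betw (enumerate A) {..<card A} A \<and> strict_mono_on {..<card A} (enumerate A)"
    if "finite A" for A :: "nat set"
    using that by (simp add: finite_bij_enumerate finite_enumerate_mono strict_mono_on_def)
  have "finite (T \<rightarrow>\<^sub>E {..<c})" using assms(1) by (simp add: T_def finite_PiE)
  from ramsey_finite_colours[OF this, of "card N" "card F"]
  obtain p :: nat where p: "\<forall>h. (\<forall>X. h X \<in> T \<rightarrow>\<^sub>E {..<c}) \<longrightarrow>
    (\<exists>H\<subseteq>{..<p}. card H = card N \<and> (\<exists>col. \<forall>X\<subseteq>H. card X = card F \<longrightarrow> h X = col))"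
    by (elim exE) (rule that, assumption)
  define \<A> where "\<A> = {\<alpha> \<in> F \<rightarrow>\<^sub>E {..<p}. inj_on \<alpha> F}"
  define \<B> where "\<B> = N \<rightarrow>\<^sub>E {..<p}"
  have fin: "finite \<A>" "finite \<B>" using assms by (simp_all add: \<A>_def \<B>_def finite_PiE)
  from partite_construction[OF fin(1) _ assms(1,2) fin(2) unif, of "\<lambda>_. True" False 0 c]
  obtain V E where V: "finite V" "E \<subseteq> Pow V" "\<forall>Y\<in>E. card Y = r"
    and col: "fibre_colouring F R N \<A> \<B> c V E"
    by (auto simp: \<A>_def)
  have main: "\<exists>f. inj_on f N \<and> f ` N \<subseteq> V \<and> (\<forall>X\<subseteq>N. f ` X \<in> E \<longleftrightarrow> R X) \<and>
        (\<forall>e\<in>copies F R N {X. X \<subseteq> N \<and> R X}. \<forall>e'\<in>copies F R N {X. X \<subseteq> N \<and> R X}.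
          same_order F e e' \<longrightarrow> \<xi> (restrict (f \<circ> e) F) = \<xi> (restrict (f \<circ> e') F))"
    if \<xi>: "\<forall>e. \<xi> e < c" for \<xi>
  proof -
    from spec[OF col[unfolded fibre_colouring_def], of \<xi>] \<xi> obtain \<xi>' where \<xi>': "\<forall>e. \<xi>' e < c"
      and f: "\<forall>\<beta>\<in>\<B>. (\<exists>f. inj_on f N \<and> f ` N \<subseteq> V \<and> (\<forall>X\<subseteq>N. f ` X \<in> E \<longleftrightarrow> R X) \<and>
        (\<forall>e\<in>copies F R N {X. X \<subseteq> N \<and> R X}. restrict (\<beta> \<circ> e) F \<in> \<A> \<longrightarrow>
          \<xi> (restrict (f \<circ> e) F) = \<xi>' (restrict (\<beta> \<circ> e) F)))" by blast
    \<comment> \<open>The colour of a set lists the colours of all placements of \<open>F\<close>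
      into it by ranks, so homogeneity fixes all of them simultaneously.\<close>
    define h where "h X = (\<lambda>\<tau>\<in>T. \<xi>' (restrict (enumerate X \<circ> \<tau>) F))" for X
    have "\<forall>X. h X \<in> T \<rightarrow>\<^sub>E {..<c}" using \<xi>' by (auto simp: h_def)
    from spec[OF p, of h, THEN mp, OF this] obtain H hcol where H: "H \<subseteq> {..<p}" "card H = card N"
      and hcol: "\<forall>X\<subseteq>H. card X = card F \<longrightarrow> h X = hcol"
      by (elim exE conjE) (rule that)
    have "finite H" using H(1) finite_subset by blast
    \<comment> \<open>The increasing bijection from \<open>N\<close> onto \<open>H\<close>.\<close>
    define b where "b = enumerate H \<circ> inv_into {..<card N} (enumerate N)"
    have bijN: "bij_betw (inv_into {..<card N} (enumerate N)) N {..<card N}"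
      using en[OF assms(2)] by (simp add: bij_betw_inv_into)
    then have b1: "bij_betw b N H"
      unfolding b_def using en[OF \<open>finite H\<close>] H(2) by (simp add: bij_betw_trans)
    have b2: "strict_mono_on N b"
    proof (rule strict_mono_onI)
      fix x y assume xy: "x \<in> N" "y \<in> N" "x < y"
      define i j where "i = inv_into {..<card N} (enumerate N) x"
        and "j = inv_into {..<card N} (enumerate N) y"
      have ij: "i < card N" "j < card N" "enumerate N i = x" "enumerate N j = y"
        using en[OF assms(2)] bijN xy
        by (auto simp: i_def j_def bij_betw_def f_inv_into_f)
      then have "i < j"
        using xy(3) en[OF assms(2)] strict_mono_on_less[of "{..<card N}" "enumerate N" i j] by simp
      then show "b x < b y"
        using ij en[OF \<open>finite H\<close>] H(2) strict_mono_onD[of "{..<card H}" "enumerate H" i j]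
        by (simp add: b_def i_def j_def)
    qed
    note b = b1 b2
    have "restrict b N \<in> \<B>" using b(1) H(1) by (auto simp: \<B>_def bij_betw_def)
    from bspec[OF f this] obtain f where f: "inj_on f N" "f ` N \<subseteq> V" "\<forall>X\<subseteq>N. f ` X \<in> E \<longleftrightarrow> R X"
      and f\<xi>: "\<And>e. e \<in> copies F R N {X. X \<subseteq> N \<and> R X} \<Longrightarrow> restrict (restrict b N \<circ> e) F \<in> \<A> \<Longrightarrow>
          \<xi> (restrict (f \<circ> e) F) = \<xi>' (restrict (restrict b N \<circ> e) F)" by blast
    \<comment> \<open>The position of \<open>z\<close> in the order pulled back along
      \<open>e\<close>; it is determined by the order type.\<close>
    define rk where "rk e = (\<lambda>z\<in>F. card {w \<in> F. e w < e z})" for e :: "nat \<Rightarrow> nat"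
    have key: "\<xi> (restrict (f \<circ> e) F) = hcol (rk e)"
      if e: "e \<in> copies F R N {X. X \<subseteq> N \<and> R X}" for e
    proof -
      have eF: "e ` F \<subseteq> N" "inj_on e F" using e by (auto simp: copies_def)
      define \<alpha> where "\<alpha> = restrict (restrict b N \<circ> e) F"
      have \<alpha>z: "\<alpha> z = b (e z)" if "z \<in> F" for z using that eF by (auto simp: \<alpha>_def)
      have inj_b: "inj_on b N" using b(1) by (simp add: bij_betw_def)
      have inj: "inj_on \<alpha> F"
      proof (rule inj_onI)
        fix x y assume xy: "x \<in> F" "y \<in> F" "\<alpha> x = \<alpha> y"
        then have "e x = e y" using \<alpha>z inj_onD[OF inj_b] eF by (metis image_subset_iff)
        then show "x = y" using xy eF inj_onD by metis
      qed
      have \<alpha>H: "\<alpha> ` F \<subseteq> H" using \<alpha>z b(1) eF by (auto simp: bij_betw_def)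
      have "\<alpha> \<in> extensional F" by (simp add: \<alpha>_def)
      moreover have "\<alpha> ` F \<subseteq> {..<p}" using \<alpha>H H(1) by (rule subset_trans)
      ultimately have "\<alpha> \<in> F \<rightarrow>\<^sub>E {..<p}" by (simp add: PiE_def image_subset_iff_funcset)
      then have "\<alpha> \<in> \<A>" using inj by (simp add: \<A>_def)
      from f\<xi>[OF e] this have 1: "\<xi> (restrict (f \<circ> e) F) = \<xi>' \<alpha>" by (simp add: \<alpha>_def)
      define A where "A = \<alpha> ` F"
      have cA: "card A = card F" unfolding A_def using inj by (rule card_image)
      have finA: "finite A" using assms(1) by (simp add: A_def)
      have "\<alpha> z = enumerate A (rk e z)" if z: "z \<in> F" for z
      proof -
        have "\<alpha> z \<in> A" using z by (simp add: A_def)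
        then obtain i where i: "i < card A" "\<alpha> z = enumerate A i"
          using en[OF finA] by (auto simp: bij_betw_def)
        have mono: "enumerate A j < enumerate A k \<longleftrightarrow> j < k" if "j < card A" "k < card A" for j k
          using en[OF finA] that strict_mono_on_less by blast
        have inj_en: "inj_on (enumerate A) {..<i}"
          using en[OF finA] i(1) by (auto simp: bij_betw_def intro: inj_on_subset)
        have "{x \<in> A. x < \<alpha> z} = enumerate A ` {..<i}"
        proof
          show "{x \<in> A. x < \<alpha> z} \<subseteq> enumerate A ` {..<i}"
          proof
            fix x assume x: "x \<in> {x \<in> A. x < \<alpha> z}"
            then obtain j where "j < card A" "x = enumerate A j"
              using en[OF finA] by (auto simp: bij_betw_def)
            then show "x \<in> enumerate A ` {..<i}" using x i mono by auto
          qed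
          show "enumerate A ` {..<i} \<subseteq> {x \<in> A. x < \<alpha> z}"
            using en[OF finA] i mono by (auto simp: bij_betw_def)
        qed
        then have "card {x \<in> A. x < \<alpha> z} = i" using card_image[OF inj_en] by simp
        moreover have "{x \<in> A. x < \<alpha> z} = \<alpha> ` {w \<in> F. e w < e z}"
        proof -
          have "\<alpha> w < \<alpha> z \<longleftrightarrow> e w < e z" if "w \<in> F" for w
            using \<alpha>z that z b(2) eF(1) strict_mono_on_less[OF b(2)] by (simp add: image_subset_iff)
          then show ?thesis by (auto simp: A_def)
        qed
        moreover have "card (\<alpha> ` {w \<in> F. e w < e z}) = card {w \<in> F. e w < e z}"
          using inj by (intro card_image) (auto intro: inj_on_subset)
        ultimately show ?thesis using i z by (simp add: rk_def)
      qed
      then have "\<alpha> = restrict (enumerate A \<circ> rk e) F" by (auto simp: \<alpha>_def fun_eq_iff)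
      moreover have "rk e \<in> T" using assms(1) by (auto simp: T_def rk_def intro!: card_mono)
      ultimately have "\<xi>' \<alpha> = h A (rk e)" by (simp add: h_def)
      also have "\<dots> = hcol (rk e)" using hcol \<alpha>H cA by (simp add: A_def)
      finally show ?thesis using 1 by simp
    qed
    have "rk e = rk e'" if "same_order F e e'" for e e'
      using that by (auto simp: rk_def same_order_def fun_eq_iff intro!: arg_cong[where f = card])
    then have "\<xi> (restrict (f \<circ> e) F) = \<xi> (restrict (f \<circ> e') F)"
      if "e \<in> copies F R N {X. X \<subseteq> N \<and> R X}" "e' \<in> copies F R N {X. X \<subseteq> N \<and> R X}"
        "same_order F e e'" for e e'
      unfolding key[OF that(1)] key[OF that(2)] using that(3) by simp
    then show ?thesis using f by (intro exI[of _ f]) blast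
  qed
  have "order_colouring F R N c V E" unfolding order_colouring_def by (intro allI impI, rule main)
  then show ?thesis using V by blast
qed

text \<open>For cliques to be avoided, the partite construction is repeated over an unrestricted Ramsey
  object: then all projections are homomorphisms.\<close>

lemma order_ramsey_clique_free:
  fixes c :: nat
  assumes "finite F" "finite N" and unif: "\<forall>X. X \<subseteq> N \<longrightarrow> R X \<longrightarrow> card X = 2"
    and free: "n > 0" "clique_free n R N"
  shows "\<exists>V E. finite V \<and> E \<subseteq> Pow V \<and> (\<forall>Y\<in>E. card Y = 2) \<and> clique_free n (\<lambda>X. X \<in> E) V \<and>
    order_colouring F R N c V E"
proof -
  from order_ramsey_unrestricted[OF assms(1-3), of c]
  obtain V0 E0 where V0: "finite V0" "E0 \<subseteq> Pow V0" "\<forall>Y\<in>E0. card Y = 2"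
    and col0: "order_colouring F R N c V0 E0"
    by (elim exE conjE) (rule that, assumption+)
  define \<A> where "\<A> = copies F R V0 E0"
  define \<B> where "\<B> = {\<beta> \<in> N \<rightarrow>\<^sub>E V0. inj_on \<beta> N \<and> (\<forall>X\<subseteq>N. \<beta> ` X \<in> E0 \<longleftrightarrow> R X)}"
  have fin: "finite \<A>" "finite \<B>" using assms V0 finite_copies
    by (auto simp: \<A>_def \<B>_def finite_PiE intro: finite_subset[of _ "N \<rightarrow>\<^sub>E V0"])
  have inj: "\<forall>\<alpha>\<in>\<A>. inj_on \<alpha> F" by (simp add: \<A>_def copies_def)
  have P: "\<forall>\<beta>\<in>\<B>. \<forall>X. X \<subseteq> N \<longrightarrow> R X \<longrightarrow> \<beta> ` X \<in> E0" by (simp add: \<B>_def)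
  have hom: "R {z \<in> F. \<alpha> z \<in> Z}" if "\<alpha> \<in> \<A>" "Z \<in> E0" "Z \<subseteq> \<alpha> ` F" for \<alpha> Z
  proof -
    define D where "D = {z \<in> F. \<alpha> z \<in> Z}"
    have "D \<subseteq> F" by (auto simp: D_def)
    then have "\<alpha> ` D \<in> E0 \<longleftrightarrow> R D" using that(1) by (simp add: \<A>_def copies_def)
    moreover have "\<alpha> ` D = Z" using that(3) by (auto simp: D_def)
    ultimately show ?thesis using that(2) by (simp add: D_def)
  qed
  then have kf: "True \<longrightarrow> 2 = (2::nat) \<and> n > 0 \<and> clique_free n R N \<and>
      (\<forall>\<alpha>\<in>\<A>. \<forall>Z. Z \<in> E0 \<longrightarrow> Z \<subseteq> \<alpha> ` F \<longrightarrow> R {z \<in> F. \<alpha> z \<in> Z})" using free by blast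
  from partite_construction[OF fin(1) inj assms(1,2) fin(2) unif P kf, of c]
  obtain V E where V: "finite V" "E \<subseteq> Pow V" "\<forall>Y\<in>E. card Y = 2" "True \<longrightarrow> clique_free n (\<lambda>X. X \<in> E) V"
    and col: "fibre_colouring F R N \<A> \<B> c V E"
    by (elim exE conjE) (rule that, assumption+)
  have main: "\<exists>f. inj_on f N \<and> f ` N \<subseteq> V \<and> (\<forall>X\<subseteq>N. f ` X \<in> E \<longleftrightarrow> R X) \<and>
        (\<forall>e\<in>copies F R N {X. X \<subseteq> N \<and> R X}. \<forall>e'\<in>copies F R N {X. X \<subseteq> N \<and> R X}.
          same_order F e e' \<longrightarrow> \<xi> (restrict (f \<circ> e) F) = \<xi> (restrict (f \<circ> e') F))"
    if \<xi>: "\<forall>e. \<xi> e < c" for \<xi>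
  proof -
    from spec[OF col[unfolded fibre_colouring_def], of \<xi>] \<xi> obtain \<xi>' where \<xi>': "\<forall>e. \<xi>' e < c"
      and f: "\<forall>\<beta>\<in>\<B>. (\<exists>f. inj_on f N \<and> f ` N \<subseteq> V \<and> (\<forall>X\<subseteq>N. f ` X \<in> E \<longleftrightarrow> R X) \<and>
        (\<forall>e\<in>copies F R N {X. X \<subseteq> N \<and> R X}. restrict (\<beta> \<circ> e) F \<in> \<A> \<longrightarrow>
          \<xi> (restrict (f \<circ> e) F) = \<xi>' (restrict (\<beta> \<circ> e) F)))" by blast
    \<comment> \<open>The Ramsey property of \<open>(V0, E0)\<close>, applied to the colouring of
      projections, picks the embedding \<open>b\<close> over which the copy of \<open>N\<close> is
      taken.\<close>
    from spec[OF col0[unfolded order_colouring_def], of \<xi>'] \<xi>' obtain b where b: "inj_on b N" "b ` N \<subseteq> V0"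
      "\<forall>X\<subseteq>N. b ` X \<in> E0 \<longleftrightarrow> R X"
      and bcol: "\<forall>e\<in>copies F R N {X. X \<subseteq> N \<and> R X}. \<forall>e'\<in>copies F R N {X. X \<subseteq> N \<and> R X}.
          same_order F e e' \<longrightarrow> \<xi>' (restrict (b \<circ> e) F) = \<xi>' (restrict (b \<circ> e') F)" by blast
    have "restrict b N ` X = b ` X" if "X \<subseteq> N" for X using that by force
    then have "restrict b N \<in> \<B>" using b by (auto simp: \<B>_def inj_on_restrict_eq)
    from bspec[OF f this] obtain f where f: "inj_on f N" "f ` N \<subseteq> V" "\<forall>X\<subseteq>N. f ` X \<in> E \<longleftrightarrow> R X"
      and f\<xi>: "\<And>e. e \<in> copies F R N {X. X \<subseteq> N \<and> R X} \<Longrightarrow> restrict (restrict b N \<circ> e) F \<in> \<A> \<Longrightarrow>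
          \<xi> (restrict (f \<circ> e) F) = \<xi>' (restrict (restrict b N \<circ> e) F)" by blast
    have f\<xi>': "\<xi> (restrict (f \<circ> e) F) = \<xi>' (restrict (b \<circ> e) F)"
      if e: "e \<in> copies F R N {X. X \<subseteq> N \<and> R X}" for e
    proof -
      have "e ` F \<subseteq> N" using e by (auto simp: copies_def)
      then have eq: "restrict (restrict b N \<circ> e) F = restrict (b \<circ> e) F" by (auto simp: fun_eq_iff)
      have "restrict (b \<circ> e) F \<in> \<A>" unfolding \<A>_def
        using b by (intro copies_compose[OF e]) auto
      then show ?thesis using f\<xi>[OF e] eq by simp
    qed
    have "\<xi> (restrict (f \<circ> e) F) = \<xi> (restrict (f \<circ> e') F)"
      if "e \<in> copies F R N {X. X \<subseteq> N \<and> R X}" "e' \<in> copies F R N {X. X \<subseteq> N \<and> R X}"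
        "same_order F e e'" for e e'
      unfolding f\<xi>'[OF that(1)] f\<xi>'[OF that(2)] using bcol that by blast
    then show ?thesis using f by (intro exI[of _ f]) blast
  qed
  have "order_colouring F R N c V E" unfolding order_colouring_def by (intro allI impI, rule main)
  then show ?thesis using V by blast
qed

text \<open>The maps \<open>restrict g F\<close> correspond to the left cosets of the pointwise
  stabiliser of \<open>F\<close>, so \<open>\<xi>\<close> amounts to a colouring of these cosets. A
  left translation by \<open>g\<close> makes it depend on the order type alone, for cosets that map
  \<open>F\<close> into \<open>N\<close>.\<close>

definition ramsey_group :: "(nat \<Rightarrow> nat) set \<Rightarrow> bool" where
  "ramsey_group G \<longleftrightarrow> (\<forall>F N. finite F \<longrightarrow> finite N \<longrightarrow>
    (\<forall>(c::nat) \<xi>. (\<forall>e. \<xi> e < c) \<longrightarrow> (\<exists>g\<in>G. \<forall>h\<in>G. \<forall>h'\<in>G.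
      h ` F \<subseteq> N \<longrightarrow> h' ` F \<subseteq> N \<longrightarrow> same_order F h h' \<longrightarrow>
      \<xi> (restrict (g \<circ> h) F) = \<xi> (restrict (g \<circ> h') F))))"

text \<open>The finite Ramsey object embeds into \<open>R\<close>. The copy of \<open>N\<close>
  found in it is, by ultrahomogeneity, the image of \<open>N\<close> under an automorphism
  \<open>g\<close>, while group elements that map \<open>F\<close> into \<open>N\<close> restrict to
  copies of \<open>F\<close> in \<open>N\<close>.\<close>

lemma ramsey_group_Aut:
  assumes hom: "ultrahomogeneous R"
    and R: "\<And>F N (c::nat). finite F \<Longrightarrow> finite N \<Longrightarrow> \<exists>V E. E \<subseteq> Pow V \<and> embeds_into V (\<lambda>X. X \<in> E) R \<and>
    order_colouring F R N c V E"
  shows "ramsey_group (Aut R)"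
  unfolding ramsey_group_def
proof (intro allI impI)
  fix F N :: "nat set" and c :: nat and \<xi> :: "(nat \<Rightarrow> nat) \<Rightarrow> nat"
  assume fin: "finite F" "finite N" and \<xi>: "\<forall>e. \<xi> e < c"
  from R[OF fin, of c] obtain V E where E: "E \<subseteq> Pow V" "embeds_into V (\<lambda>X. X \<in> E) R"
    and col: "order_colouring F R N c V E"
    by (elim exE conjE) (rule that, assumption+)
  obtain \<phi> where \<phi>: "inj_on \<phi> V" "\<And>C. C \<subseteq> V \<Longrightarrow> C \<in> E \<longleftrightarrow> R (\<phi> ` C)"
    using E(2) by (auto simp: embeds_into_def)
  define \<xi>0 where "\<xi>0 e = \<xi> (restrict (\<phi> \<circ> e) F)" for e
  have "\<forall>e. \<xi>0 e < c" using \<xi> by (simp add: \<xi>0_def)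
  with spec[OF col[unfolded order_colouring_def], of \<xi>0] obtain f where f: "inj_on f N" "f ` N \<subseteq> V"
    "\<forall>X\<subseteq>N. f ` X \<in> E \<longleftrightarrow> R X"
    and fcol: "\<forall>e\<in>copies F R N {X. X \<subseteq> N \<and> R X}. \<forall>e'\<in>copies F R N {X. X \<subseteq> N \<and> R X}.
          same_order F e e' \<longrightarrow> \<xi>0 (restrict (f \<circ> e) F) = \<xi>0 (restrict (f \<circ> e') F)" by blast
  have "R ((\<phi> \<circ> f) ` C) \<longleftrightarrow> R C" if "C \<subseteq> N" for C
  proof -
    have "f ` C \<subseteq> V" using that f(2) by blast
    then have "f ` C \<in> E \<longleftrightarrow> R (\<phi> ` f ` C)" by (rule \<phi>(2))
    then show ?thesis using f(3) that by (simp add: image_comp)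
  qed
  moreover have "bij_betw (\<phi> \<circ> f) N ((\<phi> \<circ> f) ` N)"
    using f \<phi> by (meson comp_inj_on inj_on_imp_bij_betw inj_on_subset)
  ultimately have "partial_iso R (\<phi> \<circ> f) N ((\<phi> \<circ> f) ` N)" by (simp add: partial_iso_def)
  then obtain g where g: "g \<in> Aut R" "\<forall>a\<in>N. g a = (\<phi> \<circ> f) a"
    using hom fin(2) unfolding ultrahomogeneous_def by blast
  have copy: "restrict h F \<in> copies F R N {X. X \<subseteq> N \<and> R X}" if "h \<in> Aut R" "h ` F \<subseteq> N" for h
  proof -
    have "inj_on h F" using that(1) by (auto simp: Aut_def bij_def intro: inj_on_subset)
    moreover have "restrict h F ` C \<subseteq> N \<and> R (restrict h F ` C) \<longleftrightarrow> R C" if "C \<subseteq> F" for C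
    proof -
      have "restrict h F ` C = h ` C" using that by force
      then show ?thesis using that \<open>h \<in> Aut R\<close> \<open>h ` F \<subseteq> N\<close> by (auto simp: Aut_def)
    qed
    ultimately show ?thesis using that(2) by (auto simp: copies_def inj_on_restrict_eq)
  qed
  have eq: "\<xi> (restrict (g \<circ> h) F) = \<xi>0 (restrict (f \<circ> restrict h F) F)" if "h ` F \<subseteq> N" for h
  proof -
    have "restrict (g \<circ> h) F = restrict (\<phi> \<circ> restrict (f \<circ> restrict h F) F) F"
      using g(2) that by (auto simp: fun_eq_iff)
    then show ?thesis by (simp add: \<xi>0_def)
  qed
  show "\<exists>g\<in>Aut R. \<forall>h\<in>Aut R. \<forall>h'\<in>Aut R. h ` F \<subseteq> N \<longrightarrow> h' ` F \<subseteq> N \<longrightarrow> same_order F h h' \<longrightarrow>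
      \<xi> (restrict (g \<circ> h) F) = \<xi> (restrict (g \<circ> h') F)"
  proof (intro bexI[OF _ g(1)] ballI impI)
    fix h h' assume h: "h \<in> Aut R" "h' \<in> Aut R" "h ` F \<subseteq> N" "h' ` F \<subseteq> N" "same_order F h h'"
    then have "same_order F (restrict h F) (restrict h' F)" by (simp add: same_order_def)
    then show "\<xi> (restrict (g \<circ> h) F) = \<xi> (restrict (g \<circ> h') F)"
      using fcol copy[OF h(1,3)] copy[OF h(2,4)] eq h by auto
  qed
qed

lemma ramsey_group_Kn_free:
  assumes "random_Kn_free_graph n R" "n > 0"
  shows "ramsey_group (Aut R)"
proof (rule ramsey_group_Aut)
  show "ultrahomogeneous R" using assms by (simp add: random_Kn_free_graph_def)
  fix F N :: "nat set" and c :: nat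
  assume fin: "finite F" "finite N"
  have unif: "\<forall>X. X \<subseteq> N \<longrightarrow> R X \<longrightarrow> card X = 2"
    using assms by (simp add: random_Kn_free_graph_def uniform_struct_def)
  have free: "clique_free n R N"
    using assms unfolding random_Kn_free_graph_def clique_free_def by blast
  from order_ramsey_clique_free[OF fin unif assms(2) free, of c]
  obtain V E where V: "finite V" "E \<subseteq> Pow V" "\<forall>Y\<in>E. card Y = 2" "clique_free n (\<lambda>X. X \<in> E) V"
    and col: "order_colouring F R N c V E"
    by (elim exE conjE) (rule that, assumption+)
  have "uniform_struct 2 (\<lambda>X. X \<in> E)"
    using V by (auto simp: uniform_struct_def intro: finite_subset[of _ V])
  then have "embeds_into V (\<lambda>X. X \<in> E) R"
    using assms V unfolding random_Kn_free_graph_def by blast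
  then show "\<exists>V E. E \<subseteq> Pow V \<and> embeds_into V (\<lambda>X. X \<in> E) R \<and>
    order_colouring F R N c V E"
    using V(2) col by (intro exI[of _ V] exI[of _ E] conjI)
qed

lemma ramsey_group_hypergraph:
  assumes "random_uniform_hypergraph r R"
  shows "ramsey_group (Aut R)"
proof (rule ramsey_group_Aut)
  show "ultrahomogeneous R" using assms by (simp add: random_uniform_hypergraph_def)
  fix F N :: "nat set" and c :: nat
  assume fin: "finite F" "finite N"
  have unif: "\<forall>X. X \<subseteq> N \<longrightarrow> R X \<longrightarrow> card X = r"
    using assms by (simp add: random_uniform_hypergraph_def uniform_struct_def)
  from order_ramsey_unrestricted[OF fin unif, of c]
  obtain V E where V: "finite V" "E \<subseteq> Pow V" "\<forall>Y\<in>E. card Y = r"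
    and col: "order_colouring F R N c V E"
    by (elim exE conjE) (rule that, assumption+)
  have "uniform_struct r (\<lambda>X. X \<in> E)"
    using V by (auto simp: uniform_struct_def intro: finite_subset[of _ V])
  then have "embeds_into V (\<lambda>X. X \<in> E) R"
    using assms V unfolding random_uniform_hypergraph_def by blast
  then show "\<exists>V E. E \<subseteq> Pow V \<and> embeds_into V (\<lambda>X. X \<in> E) R \<and>
    order_colouring F R N c V E"
    using V(2) col by (intro exI[of _ V] exI[of _ E] conjI)
qed

section \<open>Minimal flows of Ramsey groups\<close>

locale perm_group =
  fixes G :: "(nat \<Rightarrow> nat) set"
  assumes id_mem: "id \<in> G"
    and comp_mem: "g \<in> G \<Longrightarrow> h \<in> G \<Longrightarrow> g \<circ> h \<in> G"
    and inv_mem: "g \<in> G \<Longrightarrow> inv g \<in> G"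
    and bij_mem: "g \<in> G \<Longrightarrow> bij g"

lemma perm_group_Aut: "perm_group (Aut R)"
proof
  show "id \<in> Aut R" by (simp add: Aut_def)
  show "g \<circ> h \<in> Aut R" if "g \<in> Aut R" "h \<in> Aut R" for g h
  proof -
    have "R ((g \<circ> h) ` A) \<longleftrightarrow> R A" for A
      using that unfolding image_comp[symmetric] Aut_def by blast
    then show ?thesis using that by (simp add: Aut_def bij_comp)
  qed
  show "inv g \<in> Aut R" if "g \<in> Aut R" for g
  proof -
    have g: "bij g" "\<And>A. R (g ` A) \<longleftrightarrow> R A" using that by (auto simp: Aut_def)
    have "R (inv g ` A) \<longleftrightarrow> R A" for A
      using g(2)[of "inv g ` A"] g(1) by (simp add: image_f_inv_f bij_is_surj)
    then show ?thesis using g(1) by (simp add: Aut_def bij_imp_bij_inv)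
  qed
qed (simp add: Aut_def)

lemma group_top_nhd_id:
  assumes "openin (group_top G) B" "id \<in> B"
  shows "\<exists>F. finite F \<and> (\<forall>v\<in>G. (\<forall>z\<in>F. v z = z) \<longrightarrow> v \<in> B)"
proof -
  obtain T where T: "openin (product_topology (\<lambda>_. discrete_topology (UNIV::nat set)) UNIV) T"
    "B = T \<inter> G"
    using assms(1) by (auto simp: group_top_def openin_subtopology)
  then have "id \<in> T" using assms(2) by blast
  from product_topology_open_contains_basis[OF T(1) this]
  obtain X where X: "id \<in> (\<Pi>\<^sub>E i\<in>UNIV. X i)"
    "finite {i. X i \<noteq> topspace (discrete_topology (UNIV::nat set))}" "(\<Pi>\<^sub>E i\<in>UNIV. X i) \<subseteq> T"
    by blast
  define F where "F = {i. X i \<noteq> UNIV}"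
  have "v \<in> B" if "v \<in> G" "\<forall>z\<in>F. v z = z" for v
  proof -
    have "v i \<in> X i" for i
    proof (cases "i \<in> F")
      case True
      have "id i \<in> X i" using X(1) by blast
      then show ?thesis using True that by simp
    qed (simp add: F_def)
    then show ?thesis using X(3) that T(2) by auto
  qed
  moreover have "finite F" using X(2) by (simp add: F_def)
  ultimately show ?thesis by blast
qed

lemma compact_space_subcover:
  assumes "compact_space X" "\<And>x. x \<in> topspace X \<Longrightarrow> openin X (U x) \<and> x \<in> U x"
  obtains P where "finite P" "P \<subseteq> topspace X" "topspace X \<subseteq> (\<Union>x\<in>P. U x)"
proof -
  have "\<forall>V\<in>U ` topspace X. openin X V" "topspace X \<subseteq> \<Union>(U ` topspace X)" using assms(2) by auto
  then obtain \<F> where "finite \<F>" "\<F> \<subseteq> U ` topspace X" "topspace X \<subseteq> \<Union>\<F>"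
    using assms(1) unfolding compact_space_alt by meson
  then show thesis using that by (metis finite_subset_image)
qed

context perm_group
begin

text \<open>Joint continuity at \<open>(y, id)\<close> gives a finite set for each \<open>y\<close>;
  compactness makes one finite set work for all points. The halves of \<open>e\<close> pay for
  comparing both values with the centre of the covering set.\<close>

lemma flow_act_uniform_nhd:
  fixes u :: "'a \<Rightarrow> real"
  assumes flow: "G_flow G X act" and u: "continuous_map X euclideanreal u" and e: "e > 0"
  shows "\<exists>F. finite F \<and> (\<forall>y\<in>topspace X. \<forall>v\<in>G. (\<forall>z\<in>F. v z = z) \<longrightarrow> \<bar>u (act y v) - u y\<bar> < e)"
proof -
  let ?P = "prod_topology X (group_top G)"
  have act: "continuous_map ?P X (\<lambda>(x, g). act x g)" using flow by (simp add: G_flow_def)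
  have top: "topspace (group_top G) = G" by (simp add: group_top_def)
  have "\<exists>A F. openin X A \<and> y \<in> A \<and> finite F \<and>
    (\<forall>z\<in>A. \<forall>v\<in>G. (\<forall>k\<in>F. v k = k) \<longrightarrow> \<bar>u (act z v) - u y\<bar> < e / 2)" if y: "y \<in> topspace X" for y
  proof -
    define W where "W = {p \<in> topspace ?P. (u \<circ> (\<lambda>(x, g). act x g)) p \<in> ball (u y) (e / 2)}"
    have "openin ?P W" unfolding W_def
      by (rule openin_continuous_map_preimage[OF continuous_map_compose[OF act u]]) simp
    moreover have "(y, id) \<in> W"
      using y flow id_mem e by (simp add: W_def top G_flow_def)
    ultimately obtain A B where AB: "openin X A" "openin (group_top G) B" "y \<in> A" "id \<in> B" "A \<times> B \<subseteq> W"
      unfolding openin_prod_topology_alt by meson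
    obtain F where F: "finite F" "\<forall>v\<in>G. (\<forall>z\<in>F. v z = z) \<longrightarrow> v \<in> B"
      using group_top_nhd_id[OF AB(2,4)] by blast
    have "\<bar>u (act z v) - u y\<bar> < e / 2" if "z \<in> A" "v \<in> G" "\<forall>k\<in>F. v k = k" for z v
    proof -
      have "(z, v) \<in> W" using F that AB(5) by blast
      then show ?thesis by (simp add: W_def dist_real_def abs_minus_commute)
    qed
    then show ?thesis using AB F by blast
  qed
  then obtain A F where AF: "\<And>y. y \<in> topspace X \<Longrightarrow> openin X (A y) \<and> y \<in> A y"
    "\<And>y. y \<in> topspace X \<Longrightarrow> finite (F y)"
    "\<And>y z v. y \<in> topspace X \<Longrightarrow> z \<in> A y \<Longrightarrow> v \<in> G \<Longrightarrow> (\<forall>k\<in>F y. v k = k) \<Longrightarrow>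
      \<bar>u (act z v) - u y\<bar> < e / 2" by metis
  have "compact_space X" using flow by (simp add: G_flow_def)
  from compact_space_subcover[OF this AF(1)] obtain P where P: "finite P" "P \<subseteq> topspace X"
    "topspace X \<subseteq> (\<Union>x\<in>P. A x)" by blast
  have "\<bar>u (act z v) - u z\<bar> < e"
    if z: "z \<in> topspace X" and v: "v \<in> G" "\<forall>k\<in>(\<Union>y\<in>P. F y). v k = k" for z v
  proof -
    obtain y where y: "y \<in> P" "z \<in> A y" using P z by blast
    then have yX: "y \<in> topspace X" using P by blast
    have "\<bar>u (act z v) - u y\<bar> < e / 2" using AF(3)[OF yX y(2) v(1)] v(2) y(1) by blast
    moreover have "\<bar>u z - u y\<bar> < e / 2"
    proof -
      have "act z id = z" using z flow by (simp add: G_flow_def)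
      then show ?thesis using AF(3)[OF yX y(2) id_mem] by simp
    qed
    ultimately show ?thesis using e by linarith
  qed
  then show ?thesis using P AF(2) by (intro exI[of _ "\<Union>y\<in>P. F y"]) auto
qed

text \<open>If \<open>g\<close> and \<open>h\<close> agree on \<open>F\<close> then
  \<open>v = inv h \<circ> g\<close> fixes \<open>F\<close> pointwise, and acting by
  \<open>g\<close> is acting by \<open>h\<close> and then by \<open>v\<close>. For a right action
  this is the left uniformity of the group.\<close>

lemma flow_act_uniform:
  fixes u :: "'a \<Rightarrow> real"
  assumes flow: "G_flow G X act" and u: "continuous_map X euclideanreal u" and e: "e > 0"
  shows "\<exists>F. finite F \<and> (\<forall>y\<in>topspace X. \<forall>g\<in>G. \<forall>h\<in>G. (\<forall>z\<in>F. g z = h z) \<longrightarrow>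
    \<bar>u (act y g) - u (act y h)\<bar> < e)"
proof -
  obtain F where F: "finite F"
    "\<forall>y\<in>topspace X. \<forall>v\<in>G. (\<forall>z\<in>F. v z = z) \<longrightarrow> \<bar>u (act y v) - u y\<bar> < e"
    using flow_act_uniform_nhd[OF assms] by blast
  have "\<bar>u (act y g) - u (act y h)\<bar> < e"
    if y: "y \<in> topspace X" and gh: "g \<in> G" "h \<in> G" "\<forall>z\<in>F. g z = h z" for y g h
  proof -
    have b: "bij h" using bij_mem gh by blast
    define v where "v = inv h \<circ> g"
    have v: "v \<in> G" using gh by (simp add: v_def comp_mem inv_mem)
    have "v z = z" if "z \<in> F" for z
      using gh(3) that b by (simp add: v_def bij_is_inj)
    moreover have "act y h \<in> topspace X" using flow y gh by (simp add: G_flow_def)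
    ultimately have "\<bar>u (act (act y h) v) - u (act y h)\<bar> < e" using F v by blast
    moreover have "act (act y h) v = act y (h \<circ> v)" using flow y gh v by (simp add: G_flow_def)
    moreover have "h \<circ> v = g" using b by (simp add: v_def fun_eq_iff surj_f_inv_f bij_is_surj)
    ultimately show ?thesis by simp
  qed
  then show ?thesis using F(1) by blast
qed

lemma flow_continuous_act:
  assumes "G_flow G X act" "g \<in> G"
  shows "continuous_map X X (\<lambda>x. act x g)"
proof -
  have top: "topspace (group_top G) = G" by (simp add: group_top_def)
  have "continuous_map X (prod_topology X (group_top G)) (\<lambda>x. (x, g))"
    using assms(2) by (simp add: continuous_map_pairwise comp_def top)
  moreover have "continuous_map (prod_topology X (group_top G)) X (\<lambda>(x, g). act x g)"
    using assms(1) by (simp add: G_flow_def)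
  ultimately have "continuous_map X X ((\<lambda>(x, g). act x g) \<circ> (\<lambda>x. (x, g)))"
    by (rule continuous_map_compose)
  then show ?thesis by (simp add: comp_def)
qed

text \<open>The injection \<open>p\<close> encodes a linear order on \<open>N\<close>.\<close>

definition order_like :: "nat set \<Rightarrow> nat set \<Rightarrow> real \<Rightarrow> ((nat \<Rightarrow> nat) \<Rightarrow> real) \<Rightarrow> bool" where
  "order_like F N d w \<longleftrightarrow> (\<exists>p. inj_on p N \<and> (\<forall>h\<in>G. \<forall>h'\<in>G. h ` F \<subseteq> N \<longrightarrow> h' ` F \<subseteq> N \<longrightarrow>
    same_order F (p \<circ> h) (p \<circ> h') \<longrightarrow> \<bar>w h - w h'\<bar> \<le> d))"

lemma order_like_subset:
  "order_like F N d w \<Longrightarrow> N' \<subseteq> N \<Longrightarrow> order_like F N' d w"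
  unfolding order_like_def by (meson inj_on_subset subset_trans)

lemma order_like_translate:
  assumes "order_like F (g ` N) d w" "g \<in> G"
  shows "order_like F N d (\<lambda>h. w (g \<circ> h))"
proof -
  obtain p where p: "inj_on p (g ` N)" "\<forall>h\<in>G. \<forall>h'\<in>G. h ` F \<subseteq> g ` N \<longrightarrow> h' ` F \<subseteq> g ` N \<longrightarrow>
    same_order F (p \<circ> h) (p \<circ> h') \<longrightarrow> \<bar>w h - w h'\<bar> \<le> d"
    using assms(1) unfolding order_like_def by blast
  have "inj_on (p \<circ> g) N"
    using p(1) bij_mem[OF assms(2)] by (meson bij_is_inj comp_inj_on inj_on_subset subset_UNIV)
  moreover have "\<bar>w (g \<circ> h) - w (g \<circ> h')\<bar> \<le> d"
    if "h \<in> G" "h' \<in> G" "h ` F \<subseteq> N" "h' ` F \<subseteq> N" "same_order F (p \<circ> g \<circ> h) (p \<circ> g \<circ> h')" for h h'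
  proof -
    have "(g \<circ> h) ` F \<subseteq> g ` N" "(g \<circ> h') ` F \<subseteq> g ` N" using that by auto
    moreover have "same_order F (p \<circ> (g \<circ> h)) (p \<circ> (g \<circ> h'))" using that by (simp add: comp_assoc)
    ultimately show ?thesis using p(2) comp_mem that assms(2) by blast
  qed
  ultimately show ?thesis unfolding order_like_def by blast
qed

text \<open>The Ramsey property is applied to the cell of width 1/8 containing the coefficient at a
  representative. Values in one cell differ by less than 1/8, and passing to representatives costs
  1/32 on either side, which stays below 1/4. The order is that of the natural numbers, so
  \<open>p\<close> is the identity; other orders arise by translation.\<close>

lemma order_like_exists:
  fixes u :: "'a \<Rightarrow> real"
  assumes flow: "G_flow G X act" and R: "ramsey_group G" and u: "\<forall>y\<in>topspace X. 0 \<le> u y \<and> u y \<le> 1"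
    and F: "finite F" "\<forall>y\<in>topspace X. \<forall>g\<in>G. \<forall>h\<in>G. (\<forall>z\<in>F. g z = h z) \<longrightarrow>
      \<bar>u (act y g) - u (act y h)\<bar> < 1/32"
    and x: "x \<in> topspace X" and N: "finite N"
  shows "\<exists>g\<in>G. order_like F N (1/4) (\<lambda>h. u (act (act x g) h))"
proof -
  \<comment> \<open>The coefficient is determined by the values on \<open>F\<close> only up to 1/32,
    so an exact colouring of restrictions needs a chosen extension.\<close>
  define rep where "rep e = (SOME g. g \<in> G \<and> (\<forall>z\<in>F. g z = e z))" for e
  have rep: "rep (restrict g F) \<in> G \<and> (\<forall>z\<in>F. rep (restrict g F) z = g z)" if "g \<in> G" for g
  proof -
    have "\<exists>k. k \<in> G \<and> (\<forall>z\<in>F. k z = restrict g F z)" using that by auto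
    from someI_ex[OF this] show ?thesis by (simp add: rep_def)
  qed
  \<comment> \<open>Nine colours: \<open>u\<close> may take the value 1, which gives the colour
    8.\<close>
  define \<xi> where "\<xi> e = (if rep e \<in> G then nat \<lfloor>8 * u (act x (rep e))\<rfloor> else 0)" for e
  have uact: "0 \<le> u (act x g) \<and> u (act x g) \<le> 1" if "g \<in> G" for g
    using u flow x that by (simp add: G_flow_def)
  have "\<forall>e. \<xi> e < 9"
  proof
    fix e
    show "\<xi> e < 9"
      using uact[of "rep e"] by (cases "rep e \<in> G") (auto simp: \<xi>_def, linarith)
  qed
  from R[unfolded ramsey_group_def, THEN spec[of _ F], THEN spec[of _ N], THEN mp, OF F(1),
      THEN mp, OF N, THEN spec[of _ 9], THEN spec[of _ \<xi>], THEN mp, OF this]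
  obtain g where g: "g \<in> G" and gcol: "\<forall>h\<in>G. \<forall>h'\<in>G.
      h ` F \<subseteq> N \<longrightarrow> h' ` F \<subseteq> N \<longrightarrow> same_order F h h' \<longrightarrow>
      \<xi> (restrict (g \<circ> h) F) = \<xi> (restrict (g \<circ> h') F)"
    by blast
  have "\<bar>u (act (act x g) h) - u (act (act x g) h')\<bar> \<le> 1/4"
    if h: "h \<in> G" "h' \<in> G" "h ` F \<subseteq> N" "h' ` F \<subseteq> N" "same_order F h h'" for h h'
  proof -
    let ?r = "rep (restrict (g \<circ> h) F)" and ?r' = "rep (restrict (g \<circ> h') F)"
    have gh: "g \<circ> h \<in> G" "g \<circ> h' \<in> G" using g h comp_mem by auto
    have r: "?r \<in> G" "?r' \<in> G" using rep gh by auto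
    have "nat \<lfloor>8 * u (act x ?r)\<rfloor> = nat \<lfloor>8 * u (act x ?r')\<rfloor>"
      using gcol h r unfolding \<xi>_def by metis
    then have "\<lfloor>8 * u (act x ?r)\<rfloor> = \<lfloor>8 * u (act x ?r')\<rfloor>"
      using uact[OF r(1)] uact[OF r(2)] by (simp add: nat_eq_iff)
    then have "\<bar>8 * u (act x ?r) - 8 * u (act x ?r')\<bar> < 1" by linarith
    moreover have "\<bar>u (act x ?r) - u (act x (g \<circ> h))\<bar> < 1/32" using F(2) x rep gh by blast
    moreover have "\<bar>u (act x ?r') - u (act x (g \<circ> h'))\<bar> < 1/32" using F(2) x rep gh by blast
    ultimately have "\<bar>u (act x (g \<circ> h)) - u (act x (g \<circ> h'))\<bar> \<le> 1/4" by linarith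
    then show ?thesis using flow x g h by (simp add: G_flow_def)
  qed
  then have "order_like F N (1/4) (\<lambda>h. u (act (act x g) h))"
    unfolding order_like_def by (intro exI[of _ id]) simp
  then show ?thesis using g by blast
qed

text \<open>By minimality and compactness finitely many translates of a neighbourhood of \<open>y\<close> cover the
  flow, so the order-like points found by Ramsey on the union of finitely many copies of \<open>N\<close> come
  close to \<open>y\<close> on one of these copies.\<close>

lemma order_like_minimal:
  fixes u :: "'a \<Rightarrow> real"
  assumes min: "minimal_flow G X act" and R: "ramsey_group G"
    and cont: "continuous_map X euclideanreal u" and u: "\<forall>y\<in>topspace X. 0 \<le> u y \<and> u y \<le> 1"
    and F: "finite F" "\<forall>y\<in>topspace X. \<forall>g\<in>G. \<forall>h\<in>G. (\<forall>z\<in>F. g z = h z) \<longrightarrow>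
      \<bar>u (act y g) - u (act y h)\<bar> < 1/32"
    and y: "y \<in> topspace X" and N: "finite N"
  shows "order_like F N (1/2) (\<lambda>h. u (act y h))"
proof -
  have flow: "G_flow G X act" using min by (simp add: minimal_flow_def)
  define rep where "rep e = (SOME g. g \<in> G \<and> (\<forall>z\<in>F. g z = e z))" for e
  define reps where "reps = G \<inter> rep ` (F \<rightarrow>\<^sub>E N)"
  have "finite reps" using F(1) N by (simp add: reps_def finite_PiE)
  have rep: "\<exists>k\<in>reps. \<forall>z\<in>F. k z = h z" if "h \<in> G" "h ` F \<subseteq> N" for h
  proof -
    have "\<exists>k. k \<in> G \<and> (\<forall>z\<in>F. k z = restrict h F z)" using that by auto
    from someI_ex[OF this] have "rep (restrict h F) \<in> G \<and> (\<forall>z\<in>F. rep (restrict h F) z = h z)"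
      by (simp add: rep_def)
    moreover have "restrict h F \<in> F \<rightarrow>\<^sub>E N" using that by auto
    ultimately show ?thesis by (auto simp: reps_def)
  qed
  \<comment> \<open>Only finitely many restrictions of group elements map \<open>F\<close> into
    \<open>N\<close>; on this neighbourhood the coefficients at their representatives are those of
    \<open>y\<close> up to 1/32.\<close>
  define V where "V = (\<Inter>k\<in>reps. {z \<in> topspace X. u (act z k) \<in> ball (u (act y k)) (1/32)}) \<inter> topspace X"
  have "openin X V" unfolding V_def
  proof (rule openin_INT[OF \<open>finite reps\<close>])
    fix k assume "k \<in> reps"
    then have "k \<in> G" by (simp add: reps_def)
    have "continuous_map X euclideanreal (u \<circ> (\<lambda>x. act x k))"
      by (rule continuous_map_compose[OF flow_continuous_act[OF flow \<open>k \<in> G\<close>] cont])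
    then show "openin X {z \<in> topspace X. u (act z k) \<in> ball (u (act y k)) (1/32)}"
      using openin_continuous_map_preimage[of X euclideanreal "u \<circ> (\<lambda>x. act x k)" "ball (u (act y k)) (1/32)"]
      by simp
  qed
  have Vd: "\<bar>u (act z k) - u (act y k)\<bar> < 1/32" if "z \<in> V" "k \<in> reps" for z k
    using that by (auto simp: V_def dist_real_def abs_minus_commute)
  have yV: "y \<in> V" using y by (simp add: V_def)
  define C where "C g = {x \<in> topspace X. act x g \<in> V}" for g
  have "\<exists>g\<in>G. x \<in> C g" if x: "x \<in> topspace X" for x
  proof -
    have "y \<in> X closure_of (orbit G act x)" using min x y by (simp add: minimal_flow_def)
    then obtain w where "w \<in> orbit G act x" "w \<in> V"
      using \<open>openin X V\<close> yV unfolding in_closure_of by blast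
    then show ?thesis using x by (auto simp: orbit_def C_def)
  qed
  then obtain gx where gx: "\<And>x. x \<in> topspace X \<Longrightarrow> gx x \<in> G \<and> x \<in> C (gx x)" by metis
  have "openin X (C g)" if "g \<in> G" for g
    unfolding C_def by (rule openin_continuous_map_preimage[OF flow_continuous_act[OF flow that] \<open>openin X V\<close>])
  then have "openin X (C (gx x)) \<and> x \<in> C (gx x)" if "x \<in> topspace X" for x using gx that by blast
  moreover have "compact_space X" using flow by (simp add: G_flow_def)
  ultimately obtain P where P: "finite P" "P \<subseteq> topspace X" "topspace X \<subseteq> (\<Union>x\<in>P. C (gx x))"
    using compact_space_subcover[of X "\<lambda>x. C (gx x)"] by blast
  \<comment> \<open>The element \<open>g\<close> is found only after this set is fixed, so all
    translates that might bring the resulting point into \<open>V\<close> are included.\<close>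
  define N' where "N' = (\<Union>x\<in>P. gx x ` N)"
  have "finite N'" using P N by (simp add: N'_def)
  from order_like_exists[OF flow R u F y this] obtain g where g: "g \<in> G"
    "order_like F N' (1/4) (\<lambda>h. u (act (act y g) h))" by blast
  define x where "x = act y g"
  have x: "x \<in> topspace X" using flow y g by (simp add: x_def G_flow_def)
  then obtain q where q: "q \<in> P" "x \<in> C (gx q)" using P by blast
  let ?k = "gx q"
  have k: "?k \<in> G" "?k ` N \<subseteq> N'" using q P gx by (auto simp: N'_def)
  have "order_like F N (1/4) (\<lambda>h. u (act x (?k \<circ> h)))"
    using order_like_translate[OF order_like_subset[OF g(2) k(2)] k(1)] by (simp add: x_def)
  moreover have act: "act x (?k \<circ> h) = act (act x ?k) h" if "h \<in> G" for h
    using flow x k that by (simp add: G_flow_def)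
  ultimately obtain p where p: "inj_on p N"
    and near: "\<And>h h'. h \<in> G \<Longrightarrow> h' \<in> G \<Longrightarrow> h ` F \<subseteq> N \<Longrightarrow> h' ` F \<subseteq> N \<Longrightarrow>
      same_order F (p \<circ> h) (p \<circ> h') \<Longrightarrow> \<bar>u (act (act x ?k) h) - u (act (act x ?k) h')\<bar> \<le> 1/4"
    unfolding order_like_def by metis
  have xk: "act x ?k \<in> V" "act x ?k \<in> topspace X" using q by (auto simp: C_def V_def)
  \<comment> \<open>Three errors of 1/32: to the representative at \<open>y\<close>, across
    \<open>V\<close>, and back to \<open>h\<close>. Twice 3/32 together with 1/4 is below
    1/2.\<close>
  have "\<bar>u (act y h) - u (act (act x ?k) h)\<bar> < 3/32" if h: "h \<in> G" "h ` F \<subseteq> N" for h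
  proof -
    obtain r where r: "r \<in> reps" "\<forall>z\<in>F. r z = h z" using rep[OF h] by blast
    have rG: "r \<in> G" using r by (simp add: reps_def)
    have "\<bar>u (act y r) - u (act y h)\<bar> < 1/32" using F(2) y rG h r by blast
    moreover have "\<bar>u (act (act x ?k) r) - u (act (act x ?k) h)\<bar> < 1/32"
      using F(2) xk(2) rG h r by blast
    moreover have "\<bar>u (act (act x ?k) r) - u (act y r)\<bar> < 1/32" using Vd xk(1) r by blast
    ultimately show ?thesis by linarith
  qed
  note * = this
  have "\<bar>u (act y h) - u (act y h')\<bar> \<le> 1/2"
    if "h \<in> G" "h' \<in> G" "h ` F \<subseteq> N" "h' ` F \<subseteq> N" "same_order F (p \<circ> h) (p \<circ> h')" for h h'
    using near[OF that] *[OF that(1,3)] *[OF that(2,4)] by linarith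
  then show ?thesis using p unfolding order_like_def by blast
qed

end

section \<open>The greatest ambit and enveloping semigroups\<close>

lemma LUC_I:
  assumes "\<And>x. x \<notin> G \<Longrightarrow> f x = 0" "\<And>x. x \<in> G \<Longrightarrow> \<bar>f x\<bar> \<le> B"
    "\<And>e. e > 0 \<Longrightarrow> \<exists>F. finite F \<and> (\<forall>x\<in>G. \<forall>y\<in>G. (\<forall>a\<in>F. x a = y a) \<longrightarrow> \<bar>f x - f y\<bar> < e)"
  shows "f \<in> LUC G"
  using assms unfolding LUC_def by (auto simp: bounded_iff)

lemma LUC_bound:
  assumes "f \<in> LUC G"
  obtains B where "B > 0" "\<And>x. x \<in> G \<Longrightarrow> \<bar>f x\<bar> \<le> B"
proof -
  have "bounded (f ` G)" using assms by (simp add: LUC_def)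
  then show thesis using that unfolding bounded_pos by auto
qed

lemma LUC_uniform:
  assumes "f \<in> LUC G" "e > 0"
  obtains F where "finite F" "\<And>x y. x \<in> G \<Longrightarrow> y \<in> G \<Longrightarrow> (\<forall>a\<in>F. x a = y a) \<Longrightarrow> \<bar>f x - f y\<bar> < e"
  using assms unfolding LUC_def by blast

lemma LUC_zero: "f \<in> LUC G \<Longrightarrow> x \<notin> G \<Longrightarrow> f x = 0"
  by (simp add: LUC_def)

lemma LUC_add:
  assumes f: "f \<in> LUC G" and h: "h \<in> LUC G"
  shows "(\<lambda>x. f x + h x) \<in> LUC G"
proof -
  obtain A B where AB: "\<And>x. x \<in> G \<Longrightarrow> \<bar>f x\<bar> \<le> A" "\<And>x. x \<in> G \<Longrightarrow> \<bar>h x\<bar> \<le> B"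
    using LUC_bound[OF f] LUC_bound[OF h] by metis
  show ?thesis
  proof (rule LUC_I[of _ _ "A + B"])
    show "\<bar>f x + h x\<bar> \<le> A + B" if "x \<in> G" for x using AB[OF that] by linarith
    fix e :: real assume "e > 0"
    then have e: "e / 2 > 0" by simp
    obtain F where F: "finite F"
      "\<And>x y. x \<in> G \<Longrightarrow> y \<in> G \<Longrightarrow> (\<forall>a\<in>F. x a = y a) \<Longrightarrow> \<bar>f x - f y\<bar> < e / 2"
      using LUC_uniform[OF f e] by blast
    obtain F' where F': "finite F'"
      "\<And>x y. x \<in> G \<Longrightarrow> y \<in> G \<Longrightarrow> (\<forall>a\<in>F'. x a = y a) \<Longrightarrow> \<bar>h x - h y\<bar> < e / 2"
      using LUC_uniform[OF h e] by blast
    have "\<bar>f x + h x - (f y + h y)\<bar> < e" if "x \<in> G" "y \<in> G" "\<forall>a\<in>F \<union> F'. x a = y a" for x y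
    proof -
      have "\<bar>f x - f y\<bar> < e / 2" "\<bar>h x - h y\<bar> < e / 2" using F(2) F'(2) that by auto
      then show ?thesis by linarith
    qed
    then show "\<exists>F. finite F \<and> (\<forall>x\<in>G. \<forall>y\<in>G. (\<forall>a\<in>F. x a = y a) \<longrightarrow> \<bar>f x + h x - (f y + h y)\<bar> < e)"
      using F(1) F'(1) by (intro exI[of _ "F \<union> F'"]) simp
  qed (use LUC_zero[OF f] LUC_zero[OF h] in auto)
qed

lemma LUC_mult:
  assumes f: "f \<in> LUC G" and h: "h \<in> LUC G"
  shows "(\<lambda>x. f x * h x) \<in> LUC G"
proof -
  obtain A where A: "A > 0" "\<And>x. x \<in> G \<Longrightarrow> \<bar>f x\<bar> \<le> A" using LUC_bound[OF f] by blast
  obtain B where B: "B > 0" "\<And>x. x \<in> G \<Longrightarrow> \<bar>h x\<bar> \<le> B" using LUC_bound[OF h] by blast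
  show ?thesis
  proof (rule LUC_I[of _ _ "A * B"])
    show "\<bar>f x * h x\<bar> \<le> A * B" if "x \<in> G" for x
      using A B that by (simp add: abs_mult mult_mono)
    fix e :: real assume "e > 0"
    then have e: "e / (2 * B) > 0" "e / (2 * A) > 0" using A B by auto
    obtain F where F: "finite F"
      "\<And>x y. x \<in> G \<Longrightarrow> y \<in> G \<Longrightarrow> (\<forall>a\<in>F. x a = y a) \<Longrightarrow> \<bar>f x - f y\<bar> < e / (2 * B)"
      using LUC_uniform[OF f e(1)] by blast
    obtain F' where F': "finite F'"
      "\<And>x y. x \<in> G \<Longrightarrow> y \<in> G \<Longrightarrow> (\<forall>a\<in>F'. x a = y a) \<Longrightarrow> \<bar>h x - h y\<bar> < e / (2 * A)"
      using LUC_uniform[OF h e(2)] by blast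
    have "\<bar>f x * h x - f y * h y\<bar> < e" if xy: "x \<in> G" "y \<in> G" "\<forall>a\<in>F \<union> F'. x a = y a" for x y
    proof -
      have d: "\<bar>f x - f y\<bar> < e / (2 * B)" "\<bar>h x - h y\<bar> < e / (2 * A)" using F(2) F'(2) xy by auto
      have "f x * h x - f y * h y = (f x - f y) * h x + f y * (h x - h y)"
        by (simp add: algebra_simps)
      then have "\<bar>f x * h x - f y * h y\<bar> \<le> \<bar>f x - f y\<bar> * \<bar>h x\<bar> + \<bar>f y\<bar> * \<bar>h x - h y\<bar>"
        by (metis abs_mult abs_triangle_ineq)
      also have "\<dots> \<le> \<bar>f x - f y\<bar> * B + A * \<bar>h x - h y\<bar>"
        using A(2)[OF xy(2)] B(2)[OF xy(1)] by (intro add_mono mult_left_mono mult_right_mono) auto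
      also have "\<dots> < e / (2 * B) * B + A * (e / (2 * A))"
        using d A(1) B(1) by (intro add_strict_mono mult_strict_right_mono mult_strict_left_mono) auto
      also have "\<dots> = e" using A(1) B(1) by simp
      finally show ?thesis .
    qed
    then show "\<exists>F. finite F \<and> (\<forall>x\<in>G. \<forall>y\<in>G. (\<forall>a\<in>F. x a = y a) \<longrightarrow> \<bar>f x * h x - f y * h y\<bar> < e)"
      using F(1) F'(1) by (intro exI[of _ "F \<union> F'"]) simp
  qed (use LUC_zero[OF f] LUC_zero[OF h] in auto)
qed

lemma unitG_LUC: "unitG G \<in> LUC G"
  by (rule LUC_I[of _ _ 1]) (auto simp: unitG_def intro: exI[of _ "{}"])

lemma LUC_scale:
  assumes "f \<in> LUC G"
  shows "(\<lambda>x. c * f x) \<in> LUC G"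
proof -
  have "(\<lambda>x. c * unitG G x) \<in> LUC G"
    by (rule LUC_I[of _ _ "\<bar>c\<bar>"]) (auto simp: unitG_def intro: exI[of _ "{}"])
  from LUC_mult[OF this assms] have "(\<lambda>x. c * unitG G x * f x) \<in> LUC G" .
  moreover have "(\<lambda>x. c * unitG G x * f x) = (\<lambda>x. c * f x)"
    using LUC_zero[OF assms] by (auto simp: unitG_def fun_eq_iff)
  ultimately show ?thesis by simp
qed

lemma evaluation_in_Samuel:
  assumes "g \<in> G" shows "(\<lambda>f\<in>LUC G. f g) \<in> topspace (Samuel_top G)"
  using assms
  by (auto simp: Samuel_top_def characters_def LUC_add LUC_scale LUC_mult unitG_LUC)
    (simp add: unitG_def)

context perm_group
begin

text \<open>Agreement of \<open>x \<circ> g\<close> and \<open>y \<circ> g\<close> on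
  \<open>F\<close> is agreement of \<open>x\<close> and \<open>y\<close> on the image of
  \<open>F\<close> under \<open>g\<close>.\<close>

lemma LUC_translate:
  assumes f: "f \<in> LUC G" and g: "g \<in> G"
  shows "(\<lambda>y. if y \<in> G then f (y \<circ> g) else 0) \<in> LUC G"
proof -
  obtain B where B: "\<And>x. x \<in> G \<Longrightarrow> \<bar>f x\<bar> \<le> B" using LUC_bound[OF f] by blast
  show ?thesis
  proof (rule LUC_I[of _ _ B])
    show "\<bar>if x \<in> G then f (x \<circ> g) else 0\<bar> \<le> B" if "x \<in> G" for x
      using that B comp_mem g by simp
    fix e :: real assume "e > 0"
    then obtain F where F: "finite F"
      "\<And>x y. x \<in> G \<Longrightarrow> y \<in> G \<Longrightarrow> (\<forall>a\<in>F. x a = y a) \<Longrightarrow> \<bar>f x - f y\<bar> < e"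
      using LUC_uniform[OF f] by blast
    have "\<bar>f (x \<circ> g) - f (y \<circ> g)\<bar> < e" if "x \<in> G" "y \<in> G" "\<forall>a\<in>g ` F. x a = y a" for x y
      using that comp_mem g by (intro F(2)) auto
    then show "\<exists>F. finite F \<and> (\<forall>x\<in>G. \<forall>y\<in>G. (\<forall>a\<in>F. x a = y a) \<longrightarrow>
        \<bar>(if x \<in> G then f (x \<circ> g) else 0) - (if y \<in> G then f (y \<circ> g) else 0)\<bar> < e)"
      using F(1) by (intro exI[of _ "g ` F"]) simp
  qed simp
qed

lemma Samuel_act_pt:
  assumes "g \<in> G" shows "Samuel_act G (Samuel_pt G) g = (\<lambda>f\<in>LUC G. f g)"
  using assms LUC_translate id_mem
  by (auto simp: Samuel_act_def Samuel_pt_def fun_eq_iff)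

text \<open>Evaluation at \<open>f\<close> is continuous on the Samuel compactification and is
  carried over by the inverse homeomorphism. Equivariance and the base points force point evaluation
  at \<open>g\<close> to correspond to the translation by \<open>g\<close>.\<close>

lemma ambit_iso_LUC_extension:
  assumes flow: "G_flow G M act" and f: "f \<in> LUC G"
    and iso: "ambit_iso G (Samuel_top G) (Samuel_act G) (Samuel_pt G)
      (env_top G M act) (env_act M act) (env_pt M act)"
  shows "\<exists>\<Phi>. continuous_map (env_top G M act) euclideanreal \<Phi> \<and>
    (\<forall>g\<in>G. \<Phi> (\<lambda>x\<in>topspace M. act x g) = f g)"
proof -
  obtain \<pi> where \<pi>: "G_map G (Samuel_top G) (Samuel_act G) (env_top G M act) (env_act M act) \<pi>"
    "homeomorphic_map (Samuel_top G) (env_top G M act) \<pi>" "\<pi> (Samuel_pt G) = env_pt M act"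
    using iso by (auto simp: ambit_iso_def)
  obtain \<pi>' where \<pi>': "continuous_map (env_top G M act) (Samuel_top G) \<pi>'"
    "\<And>x. x \<in> topspace (Samuel_top G) \<Longrightarrow> \<pi>' (\<pi> x) = x"
    using \<pi>(2) by (auto simp: homeomorphic_map_maps homeomorphic_maps_def)
  have "continuous_map (Samuel_top G) euclideanreal (\<lambda>\<phi>. \<phi> f)"
    unfolding Samuel_top_def using f
    by (intro continuous_map_from_subtopology continuous_map_product_projection)
  from continuous_map_compose[OF \<pi>'(1) this]
  have "continuous_map (env_top G M act) euclideanreal ((\<lambda>\<phi>. \<phi> f) \<circ> \<pi>')" .
  moreover have "((\<lambda>\<phi>. \<phi> f) \<circ> \<pi>') (\<lambda>x\<in>topspace M. act x g) = f g" if g: "g \<in> G" for g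
  proof -
    have pt: "Samuel_pt G \<in> topspace (Samuel_top G)"
      unfolding Samuel_pt_def by (rule evaluation_in_Samuel[OF id_mem])
    have "\<pi> (Samuel_act G (Samuel_pt G) g) = env_act M act (env_pt M act) g"
      using \<pi>(1,3) pt g by (simp add: G_map_def)
    also have "\<dots> = (\<lambda>x\<in>topspace M. act x g)"
      using flow by (auto simp: env_act_def env_pt_def G_flow_def fun_eq_iff)
    finally have "\<pi>' (\<lambda>x\<in>topspace M. act x g) = (\<lambda>f\<in>LUC G. f g)"
      using \<pi>'(2) evaluation_in_Samuel[OF g] Samuel_act_pt[OF g] by metis
    then show ?thesis using f by simp
  qed
  ultimately show ?thesis by blast
qed

text \<open>Around each point of a compact set containing the translations with
  \<open>f g = 0\<close>, a basic box of the product avoids all translations with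
  \<open>f h = 1\<close>. Urysohn functions at the finitely many constrained coordinates turn
  leaving the box into a gap above 1/2, and a finite subcover leaves finitely many pairs.\<close>

lemma env_functions_separate:
  assumes flow: "G_flow G M act" and \<Phi>: "continuous_map (env_top G M act) euclideanreal \<Phi>"
    and val: "\<forall>g\<in>G. \<Phi> (\<lambda>x\<in>topspace M. act x g) = f g" and f01: "\<forall>g\<in>G. f g = 0 \<or> f g = (1::real)"
  shows "\<exists>Q. finite Q \<and> (\<forall>(x, u)\<in>Q. x \<in> topspace M \<and> continuous_map M (top_of_set {0..1::real}) u) \<and>
    (\<forall>g\<in>G. \<forall>h\<in>G. (\<forall>(x, u)\<in>Q. \<bar>u (act x g) - u (act x h)\<bar> \<le> 1/2) \<longrightarrow> f g = f h)"
proof -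
  let ?P = "product_topology (\<lambda>_. M) (topspace M)" and ?E = "env_top G M act"
  define \<rho> where "\<rho> g = (\<lambda>x\<in>topspace M. act x g)" for g
  have M: "compact_space M" "Hausdorff_space M" using flow by (simp_all add: G_flow_def)
  have creg: "completely_regular_space M"
    using M compact_Hausdorff_or_regular_imp_normal_space normal_imp_completely_regular_space by blast
  have "compact_space ?P" using M by (simp add: compact_space_product_topology)
  then have "compact_space ?E"
    unfolding env_top_def
    by (intro compact_space_subtopology closedin_compact_space) (simp_all add: env_set_def)
  have topE: "topspace ?E = env_set G M act"
    unfolding env_top_def topspace_subtopology env_set_def
    by (intro inf.absorb2 closure_of_subset_topspace)
  have \<rho>E: "\<rho> g \<in> topspace ?E" if "g \<in> G" for g
  proof -
    have "\<rho> ` G \<subseteq> topspace ?P" using flow by (auto simp: \<rho>_def G_flow_def)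
    then have "\<rho> ` G \<subseteq> ?P closure_of (\<rho> ` G)" by (rule closure_of_subset)
    then show ?thesis using that by (auto simp: topE env_set_def \<rho>_def)
  qed
  define K where "K = {p \<in> topspace ?E. \<Phi> p \<in> {..1/4}}"
  have "closedin ?E K" unfolding K_def
    by (rule closedin_continuous_map_preimage[OF \<Phi>]) simp
  then have "compactin ?E K" using \<open>compact_space ?E\<close> closedin_compact_space by blast
  define sep where "sep p B Q \<longleftrightarrow> openin ?E B \<and> p \<in> B \<and> finite Q \<and>
     (\<forall>(x, u)\<in>Q. x \<in> topspace M \<and> continuous_map M (top_of_set {0..1::real}) u) \<and>
     (\<forall>g\<in>G. \<forall>h\<in>G. \<rho> g \<in> B \<longrightarrow> f h = 1 \<longrightarrow> (\<exists>(x, u)\<in>Q. \<bar>u (act x g) - u (act x h)\<bar> > 1/2))"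
    for p B Q
  have "\<exists>B Q. sep p B Q"
    if p: "p \<in> K" for p
  proof -
    have pE: "p \<in> topspace ?E" "\<Phi> p \<le> 1/4" using p by (auto simp: K_def)
    define O' where "O' = {q \<in> topspace ?E. \<Phi> q \<in> {..<1/2}}"
    have "openin ?E O'" unfolding O'_def by (rule openin_continuous_map_preimage[OF \<Phi>]) simp
    then obtain T where T: "openin ?P T" "O' = T \<inter> env_set G M act"
      by (auto simp: env_top_def openin_subtopology)
    have "p \<in> O'" using pE by (simp add: O'_def)
    then have "p \<in> T" using T by blast
    from product_topology_open_contains_basis[OF T(1) this] obtain X where
      X: "p \<in> (\<Pi>\<^sub>E i\<in>topspace M. X i)" "\<And>i. openin M (X i)" "finite {i. X i \<noteq> topspace M}"
        "(\<Pi>\<^sub>E i\<in>topspace M. X i) \<subseteq> T" by blast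
    define J where "J = {i \<in> topspace M. X i \<noteq> topspace M}"
    have J: "finite J" "J \<subseteq> topspace M" using X(3) by (auto simp: J_def)
    have "\<exists>u. continuous_map M (top_of_set {0..1::real}) u \<and> u (p i) = 0 \<and>
      u ` (topspace M - X i) \<subseteq> {1}" if "i \<in> J" for i
    proof -
      have "p i \<in> X i" using X(1) J(2) that by blast
      moreover have "X i \<subseteq> topspace M" using X(2) openin_subset by blast
      ultimately show ?thesis using creg X(2)[of i] unfolding completely_regular_space_def
        by (metis Diff_Diff_Int Diff_iff closedin_diff closedin_topspace in_mono inf.absorb2)
    qed
    then obtain u where u: "\<And>i. i \<in> J \<Longrightarrow> continuous_map M (top_of_set {0..1::real}) (u i)"
      "\<And>i. i \<in> J \<Longrightarrow> u i (p i) = 0" "\<And>i. i \<in> J \<Longrightarrow> u i ` (topspace M - X i) \<subseteq> {1}" by metis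
    \<comment> \<open>On \<open>B\<close> every \<open>u i\<close> is below 1/2 at its coordinate,
      while a translation outside the box attains the value 1 at one of these coordinates.\<close>
    define B where "B = (\<Inter>i\<in>J. {q \<in> topspace ?E. (u i \<circ> (\<lambda>q. q i)) q \<in> {..<1/2}}) \<inter> topspace ?E"
    have "openin ?E B" unfolding B_def
    proof (rule openin_INT[OF J(1)])
      fix i assume i: "i \<in> J"
      then have iM: "i \<in> topspace M" using J by blast
      have "continuous_map ?E M (\<lambda>q. q i)" unfolding env_top_def
        using continuous_map_from_subtopology[OF continuous_map_product_projection[OF iM]] .
      moreover have "continuous_map M euclideanreal (u i)"
        using u(1)[OF i] continuous_map_in_subtopology by blast
      ultimately have "continuous_map ?E euclideanreal (u i \<circ> (\<lambda>q. q i))"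
        by (rule continuous_map_compose)
      from openin_continuous_map_preimage[OF this, of "{..<1/2}"]
      show "openin ?E {q \<in> topspace ?E. (u i \<circ> (\<lambda>q. q i)) q \<in> {..<1/2}}" by simp
    qed
    moreover have "p \<in> B" using pE u(2) by (simp add: B_def)
    moreover have "\<exists>(x, u)\<in>(\<lambda>i. (i, u i)) ` J. \<bar>u (act x g) - u (act x h)\<bar> > 1/2"
      if gh: "g \<in> G" "h \<in> G" "\<rho> g \<in> B" "f h = 1" for g h
    proof -
      have "\<rho> h \<notin> O'" using val gh by (simp add: O'_def \<rho>_def)
      then have "\<rho> h \<notin> (\<Pi>\<^sub>E i\<in>topspace M. X i)" using T(2) X(4) \<rho>E[OF gh(2)] topE by blast
      moreover have "\<rho> h \<in> extensional (topspace M)" by (simp add: \<rho>_def)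
      ultimately obtain i where i: "i \<in> topspace M" "\<rho> h i \<notin> X i" by (auto simp: PiE_def)
      have hi: "act i h \<in> topspace M" using flow i gh by (simp add: G_flow_def)
      then have "i \<in> J" using i by (auto simp: J_def \<rho>_def)
      moreover have "u i (act i h) = 1" using u(3)[OF \<open>i \<in> J\<close>] hi i by (auto simp: \<rho>_def)
      moreover have "u i (\<rho> g i) < 1/2" using gh(3) \<open>i \<in> J\<close> by (simp add: B_def)
      then have "u i (act i g) < 1/2" using i(1) by (simp add: \<rho>_def)
      ultimately show ?thesis by (auto intro!: bexI[of _ i])
    qed
    ultimately have "sep p B ((\<lambda>i. (i, u i)) ` J)" using J u(1) unfolding sep_def by auto
    then show ?thesis by blast
  qed
  then obtain B Q where BQ: "\<And>p. p \<in> K \<Longrightarrow> sep p (B p) (Q p)" by metis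
  have "\<forall>U\<in>B ` K. openin ?E U" "K \<subseteq> \<Union>(B ` K)" using BQ by (auto simp: sep_def)
  then obtain \<F> where "finite \<F>" "\<F> \<subseteq> B ` K" "K \<subseteq> \<Union>\<F>"
    using \<open>compactin ?E K\<close> unfolding compactin_def by meson
  then obtain P where P: "finite P" "P \<subseteq> K" "K \<subseteq> (\<Union>p\<in>P. B p)" by (metis finite_subset_image)
  define QQ where "QQ = (\<Union>p\<in>P. Q p)"
  have one: "\<exists>(x, u)\<in>QQ. \<bar>u (act x g) - u (act x h)\<bar> > 1/2"
    if gh: "g \<in> G" "h \<in> G" "f g = 0" "f h = 1" for g h
  proof -
    have "\<rho> g \<in> K" using \<rho>E gh val by (simp add: K_def \<rho>_def)
    then obtain p where p: "p \<in> P" "\<rho> g \<in> B p" using P by blast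
    then have "\<exists>(x, u)\<in>Q p. \<bar>u (act x g) - u (act x h)\<bar> > 1/2"
      using BQ[of p] gh P(2) unfolding sep_def by blast
    then show ?thesis using p(1) unfolding QQ_def by blast
  qed
  have "f g = f h" if gh: "g \<in> G" "h \<in> G" "\<forall>(x, u)\<in>QQ. \<bar>u (act x g) - u (act x h)\<bar> \<le> 1/2" for g h
  proof (rule ccontr)
    assume "f g \<noteq> f h"
    then consider "f g = 0" "f h = 1" | "f h = 0" "f g = 1" using f01 gh by metis
    then show False
    proof cases
      case 1
      then show False using one[of g h] gh by fastforce
    next
      case 2
      then show False using one[of h g] gh by (fastforce simp: abs_minus_commute)
    qed
  qed
  moreover have "finite QQ" using P BQ unfolding QQ_def sep_def by blast
  moreover have "\<forall>(x, u)\<in>QQ. x \<in> topspace M \<and> continuous_map M (top_of_set {0..1::real}) u"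
    using BQ P(2) unfolding QQ_def sep_def by blast
  ultimately show ?thesis by blast
qed

end

section \<open>Complicated sets of pairs\<close>

text \<open>The structure obtained from \<open>R\<close> by pulling back along \<open>p\<close> is a blow-up: points are replaced
  by independent sets.\<close>

definition closed_under_blowup :: "(nat set \<Rightarrow> bool) \<Rightarrow> bool" where
  "closed_under_blowup R \<longleftrightarrow>
    (\<forall>V p. finite V \<longrightarrow> embeds_into V (\<lambda>C. C \<subseteq> V \<and> inj_on p C \<and> R (p ` C)) R)"

lemma uniform_struct_blowup:
  assumes "uniform_struct r R" "finite V"
  shows "uniform_struct r (\<lambda>C. C \<subseteq> V \<and> inj_on p C \<and> R (p ` C))"
  using assms unfolding uniform_struct_def by (metis card_image finite_subset)

text \<open>Two points of one fibre are never joined, so \<open>p\<close> is injective on a clique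
  of the blow-up and maps it to a clique of the same size in \<open>R\<close>.\<close>

lemma closed_under_blowup_Kn_free:
  assumes R: "random_Kn_free_graph n R"
  shows "closed_under_blowup R"
  unfolding closed_under_blowup_def
proof (intro allI impI)
  fix V :: "nat set" and p :: "nat \<Rightarrow> nat"
  assume fin: "finite V"
  let ?R = "\<lambda>C. C \<subseteq> V \<and> inj_on p C \<and> R (p ` C)"
  have "clique_free n ?R V"
    unfolding clique_free_def
  proof
    assume "\<exists>C\<subseteq>V. finite C \<and> card C = n \<and> (\<forall>x\<in>C. \<forall>y\<in>C. x \<noteq> y \<longrightarrow> ?R {x, y})"
    then obtain C where C: "finite C" "card C = n"
      "\<And>x y. x \<in> C \<Longrightarrow> y \<in> C \<Longrightarrow> x \<noteq> y \<Longrightarrow> ?R {x, y}" by blast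
    have "inj_on p C"
    proof (rule inj_onI, rule ccontr)
      fix x y assume xy: "x \<in> C" "y \<in> C" "p x = p y" "x \<noteq> y"
      then have "inj_on p {x, y}" using C(3) by blast
      then show False using xy by simp
    qed
    then have "card (p ` C) = n" using C(2) card_image by blast
    moreover have "\<forall>x\<in>p ` C. \<forall>y\<in>p ` C. x \<noteq> y \<longrightarrow> R {x, y}" using C(3) by force
    moreover have "clique_free n R UNIV" using R by (simp add: random_Kn_free_graph_def)
    ultimately show False using C(1) unfolding clique_free_def by (metis finite_imageI subset_UNIV)
  qed
  moreover have "uniform_struct 2 ?R"
    using R fin by (intro uniform_struct_blowup) (simp_all add: random_Kn_free_graph_def)
  moreover have "\<forall>C. ?R C \<longrightarrow> C \<subseteq> V" by blast
  ultimately show "embeds_into V ?R R" using R fin unfolding random_Kn_free_graph_def by blast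
qed

lemma closed_under_blowup_hypergraph:
  assumes R: "random_uniform_hypergraph r R"
  shows "closed_under_blowup R"
  unfolding closed_under_blowup_def
proof (intro allI impI)
  fix V :: "nat set" and p :: "nat \<Rightarrow> nat"
  assume fin: "finite V"
  let ?R = "\<lambda>C. C \<subseteq> V \<and> inj_on p C \<and> R (p ` C)"
  have "uniform_struct r ?R"
    using R fin by (intro uniform_struct_blowup) (simp_all add: random_uniform_hypergraph_def)
  moreover have "\<forall>C. ?R C \<longrightarrow> C \<subseteq> V" by blast
  ultimately show "embeds_into V ?R R" using R fin unfolding random_uniform_hypergraph_def by blast
qed

text \<open>Rows \<open>\<alpha> i\<close> and columns \<open>\<beta> W\<close> combine freely, with
  the other points below \<open>n\<close> held at \<open>\<phi>\<close>. Columns are indexed by sets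
  of rows so that a relation can be made to shatter the rows.\<close>

definition pair_block :: "(nat \<Rightarrow> nat) set \<Rightarrow> nat \<Rightarrow> nat \<Rightarrow> (nat \<Rightarrow> nat) \<Rightarrow> (nat set \<Rightarrow> nat) \<Rightarrow>
    (nat \<Rightarrow> nat) \<Rightarrow> bool" where
  "pair_block G n s \<alpha> \<beta> \<phi> \<longleftrightarrow> inj_on \<alpha> {..<s} \<and> inj_on \<beta> (Pow {..<s}) \<and>
    (\<forall>i<s. \<forall>W\<subseteq>{..<s}. \<exists>g\<in>G. g 0 = \<alpha> i \<and> g 1 = \<beta> W \<and> (\<forall>z. 2 \<le> z \<longrightarrow> z < n \<longrightarrow> g z = \<phi> z))"

text \<open>In the structure on the points below \<open>n\<close>, together with \<open>0\<close>
  and \<open>1\<close>, the point \<open>0\<close> is blown up to \<open>t\<close> points,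
  \<open>1\<close> to \<open>2^s\<close> points, and the others are kept single. Every transversal
  is isomorphic to the original, so ultrahomogeneity realises it by an automorphism.\<close>

lemma pair_block_exists:
  assumes hom: "ultrahomogeneous R" and bl: "closed_under_blowup R" and X: "finite X"
  shows "\<exists>\<alpha> \<beta> \<phi>. pair_block (Aut R) n s \<alpha> \<beta> \<phi> \<and> \<alpha> ` {..<s} \<inter> X = {}"
proof -
  \<comment> \<open>At most \<open>card X\<close> copies of \<open>0\<close> land in
    \<open>X\<close>, so at least \<open>s\<close> remain outside.\<close>
  define t where "t = s + card X"
  define pt where "pt z i = prod_encode (z, i)" for z i :: nat
  define p where "p k = fst (prod_decode k)" for k
  have p_pt [simp]: "p (pt z i) = z" for z i by (simp add: p_def pt_def)
  have pt_eq [simp]: "pt z i = pt z' i' \<longleftrightarrow> z = z' \<and> i = i'" for z i z' i' by (simp add: pt_def)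
  define V where "V = (\<lambda>z. pt z 0) ` {2..<n} \<union> pt 0 ` {..<t} \<union> (pt 1 \<circ> set_encode) ` Pow {..<s}"
  have "finite V" by (simp add: V_def)
  then have "embeds_into V (\<lambda>C. C \<subseteq> V \<and> inj_on p C \<and> R (p ` C)) R"
    using bl by (simp add: closed_under_blowup_def)
  then obtain f where f1: "inj_on f V"
    and "\<forall>C. C \<subseteq> V \<longrightarrow> (C \<subseteq> V \<and> inj_on p C \<and> R (p ` C)) = R (f ` C)"
    unfolding embeds_into_def by (elim exE conjE) (rule that)
  then have f2: "\<And>C. C \<subseteq> V \<Longrightarrow> (inj_on p C \<and> R (p ` C)) \<longleftrightarrow> R (f ` C)" by simp
  note f = f1 f2
  have inj0: "inj_on (\<lambda>i. f (pt 0 i)) {..<t}"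
  proof (rule inj_onI)
    fix i j assume ij: "i \<in> {..<t}" "j \<in> {..<t}" "f (pt 0 i) = f (pt 0 j)"
    have "pt 0 i = pt 0 j"
      by (rule inj_onD[OF f(1) ij(3)]) (use ij in \<open>simp_all add: V_def\<close>)
    then show "i = j" by simp
  qed
  define I where "I = {i \<in> {..<t}. f (pt 0 i) \<notin> X}"
  have "card {i \<in> {..<t}. f (pt 0 i) \<in> X} \<le> card X"
    using X inj0 by (intro card_inj_on_le[of "\<lambda>i. f (pt 0 i)"]) (auto intro: inj_on_subset)
  moreover have "card I = t - card {i \<in> {..<t}. f (pt 0 i) \<in> X}"
  proof -
    have "I = {..<t} - {i \<in> {..<t}. f (pt 0 i) \<in> X}" by (auto simp: I_def)
    moreover have "{i \<in> {..<t}. f (pt 0 i) \<in> X} \<subseteq> {..<t}" by blast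
    ultimately show ?thesis
      using card_Diff_subset[of "{i \<in> {..<t}. f (pt 0 i) \<in> X}" "{..<t}"] finite_subset by auto
  qed
  ultimately have "s \<le> card I" by (simp add: t_def)
  then obtain I' where I': "I' \<subseteq> I" "card I' = s" "finite I'"
    by (meson obtain_subset_with_card_n)
  obtain \<iota> where \<iota>: "bij_betw \<iota> {..<s} I'"
    using ex_bij_betw_nat_finite[OF I'(3)] I'(2) by (auto simp: atLeast0LessThan)
  define \<alpha> where "\<alpha> i = f (pt 0 (\<iota> i))" for i
  define \<beta> where "\<beta> W = f (pt 1 (set_encode W))" for W
  define \<phi> where "\<phi> z = f (pt z 0)" for z
  have \<iota>I: "\<iota> i < t \<and> f (pt 0 (\<iota> i)) \<notin> X" if "i < s" for i
    using \<iota> I'(1) that by (auto simp: bij_betw_def I_def)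
  have "inj_on \<alpha> {..<s}"
  proof (rule inj_onI)
    fix i j assume ij: "i \<in> {..<s}" "j \<in> {..<s}" "\<alpha> i = \<alpha> j"
    then have "\<iota> i = \<iota> j" using inj_onD[OF inj0, of "\<iota> i" "\<iota> j"] \<iota>I by (simp add: \<alpha>_def)
    then show "i = j" using \<iota> ij by (auto simp: bij_betw_def dest: inj_onD)
  qed
  moreover have "inj_on \<beta> (Pow {..<s})"
  proof (rule inj_onI)
    fix W W' assume W: "W \<in> Pow {..<s}" "W' \<in> Pow {..<s}" "\<beta> W = \<beta> W'"
    then have "pt 1 (set_encode W) = pt 1 (set_encode W')"
      using inj_onD[OF f(1), of "pt 1 (set_encode W)" "pt 1 (set_encode W')"]
      by (auto simp: \<beta>_def V_def)
    moreover have "finite W" "finite W'" using W finite_subset by auto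
    ultimately show "W = W'" by (simp add: set_encode_eq)
  qed
  moreover have "\<exists>g\<in>Aut R. g 0 = \<alpha> i \<and> g 1 = \<beta> W \<and> (\<forall>z. 2 \<le> z \<longrightarrow> z < n \<longrightarrow> g z = \<phi> z)"
    if i: "i < s" and W: "W \<subseteq> {..<s}" for i W
  proof -
    define q where "q z = (if z = 0 then pt 0 (\<iota> i) else if z = 1 then pt 1 (set_encode W) else pt z 0)"
      for z :: nat
    \<comment> \<open>The points \<open>0\<close> and \<open>1\<close> are included even when
      \<open>n < 2\<close>.\<close>
    define A where "A = insert 0 (insert 1 {2..<n})"
    have qV: "q ` A \<subseteq> V" using \<iota>I[OF i] W by (auto simp: q_def A_def V_def)
    have pq: "p (q z) = z" for z by (simp add: q_def)
    have injq: "inj_on q A" using pq by (metis inj_onI)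
    have inj: "inj_on (f \<circ> q) A" using injq f(1) qV by (meson comp_inj_on inj_on_subset)
    have "R ((f \<circ> q) ` C) \<longleftrightarrow> R C" if C: "C \<subseteq> A" for C
    proof -
      have "q ` C \<subseteq> V" using C qV by blast
      moreover have "inj_on p (q ` C)" using pq by (intro inj_onI) auto
      moreover have "p ` q ` C = C" by (simp add: image_image pq)
      ultimately have "R C \<longleftrightarrow> R (f ` q ` C)" using f(2)[of "q ` C"] by simp
      then show ?thesis by (simp add: image_comp)
    qed
    then have "partial_iso R (f \<circ> q) A ((f \<circ> q) ` A)"
      using inj_on_imp_bij_betw[OF inj] unfolding partial_iso_def by blast
    moreover have "finite A" by (simp add: A_def)
    ultimately obtain g where g: "g \<in> Aut R" "\<forall>a\<in>A. g a = (f \<circ> q) a"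
      using hom unfolding ultrahomogeneous_def by blast
    have "g z = \<phi> z" if "2 \<le> z" "z < n" for z using that g(2) by (simp add: A_def q_def \<phi>_def)
    moreover have "g 0 = \<alpha> i" "g 1 = \<beta> W" using g(2) by (simp_all add: A_def q_def \<alpha>_def \<beta>_def)
    ultimately show ?thesis using g(1) by blast
  qed
  moreover have "\<alpha> ` {..<s} \<inter> X = {}" using \<iota>I by (auto simp: \<alpha>_def)
  ultimately show ?thesis unfolding pair_block_def by blast
qed

text \<open>The witness is \<open>s = 2^m\<close> with \<open>m = 4 * n\<close>: the base is at most
  \<open>2^(m + 1)\<close>, and \<open>n * (m + 1) < 2^m\<close> compares the exponents.\<close>

lemma exp_beats_power: "\<exists>s::nat. (n + s + 1) ^ n < 2 ^ s"
proof -
  define m where "m = 4 * n"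
  have n: "n < 2 ^ n" by (rule less_exp)
  have "4 * n + 1 \<le> 2 ^ (3 * n)" for n :: nat
  proof (induction n)
    case (Suc n)
    have "4 * Suc n + 1 \<le> 8 * (4 * n + 1)" by simp
    also have "\<dots> \<le> 8 * 2 ^ (3 * n)" using Suc by simp
    also have "\<dots> = (2::nat) ^ (3 * Suc n)" by (simp add: power_add)
    finally show ?case .
  qed simp
  then have "n * (m + 1) \<le> n * 2 ^ (3 * n)" unfolding m_def by (rule mult_le_mono2)
  also have "\<dots> < 2 ^ n * 2 ^ (3 * n)" using n by simp
  also have "\<dots> = 2 ^ m" by (simp add: m_def flip: power_add)
  finally have 1: "n * (m + 1) < 2 ^ m" .
  have "n + 1 \<le> 2 ^ m"
  proof -
    have "(2::nat) ^ n \<le> 2 ^ m" by (simp add: m_def)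
    then show ?thesis using n by linarith
  qed
  then have "n + 2 ^ m + 1 \<le> 2 ^ (m + 1)" by simp
  then have "(n + 2 ^ m + 1) ^ n \<le> (2 ^ (m + 1)) ^ n" by (rule power_mono) simp
  also have "\<dots> = 2 ^ (n * (m + 1))" by (metis power_mult mult.commute)
  also have "\<dots> < 2 ^ 2 ^ m" using 1 by simp
  finally show ?thesis by blast
qed

text \<open>The blocks are built one after another, each with rows outside those used before. A row
  therefore determines its block and its index, and \<open>S\<close> can be declared to be
  membership on each block without conflict, even if columns of different blocks coincide.\<close>

lemma complicated_pairs:
  assumes hom: "ultrahomogeneous R" and bl: "closed_under_blowup R"
  shows "\<exists>S :: nat \<Rightarrow> nat \<Rightarrow> bool. \<forall>n. \<exists>s \<alpha> \<beta> \<phi>. (n + s + 1) ^ n < 2 ^ s \<and>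
    pair_block (Aut R) n s \<alpha> \<beta> \<phi> \<and> (\<forall>i<s. \<forall>W\<subseteq>{..<s}. S (\<alpha> i) (\<beta> W) \<longleftrightarrow> i \<in> W)"
proof -
  obtain s where s: "\<And>n. (n + s n + 1) ^ n < 2 ^ s n" using exp_beats_power by metis
  define P where "P n X t \<longleftrightarrow> (case t of (\<alpha>, \<beta>, \<phi>) \<Rightarrow>
      pair_block (Aut R) n (s n) \<alpha> \<beta> \<phi> \<and> \<alpha> ` {..<s n} \<inter> X = {})" for n X t
  define t where "t n X = (SOME t. P n X t)" for n X
  have t: "P n X (t n X)" if "finite X" for n X
    unfolding t_def
    by (rule someI_ex)
      (use pair_block_exists[OF hom bl that, of n "s n"] in \<open>simp add: P_def split_paired_Ex\<close>)
  define a where "a n X = fst (t n X)" for n X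
  define b where "b n X = fst (snd (t n X))" for n X
  define c where "c n X = snd (snd (t n X))" for n X
  have abc: "pair_block (Aut R) n (s n) (a n X) (b n X) (c n X) \<and> a n X ` {..<s n} \<inter> X = {}"
    if "finite X" for n X
    using t[OF that, of n] by (simp add: P_def a_def b_def c_def case_prod_unfold)
  \<comment> \<open>\<open>used n\<close> collects the rows of all blocks with index below
    \<open>n\<close>.\<close>
  define used where "used = rec_nat {} (\<lambda>n X. X \<union> a n X ` {..<s n})"
  have used_Suc: "used (Suc n) = used n \<union> a n (used n) ` {..<s n}" for n by (simp add: used_def)
  have fin: "finite (used n)" for n by (induction n) (simp_all add: used_Suc, simp add: used_def)
  have mono: "used m \<subseteq> used n" if "m \<le> n" for m n
    using that by (induction rule: dec_induct) (auto simp: used_Suc)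
  define \<alpha> where "\<alpha> n = a n (used n)" for n
  define \<beta> where "\<beta> n = b n (used n)" for n
  have block: "pair_block (Aut R) n (s n) (\<alpha> n) (\<beta> n) (c n (used n))"
    "\<alpha> n ` {..<s n} \<inter> used n = {}" for n
    using abc[OF fin] by (auto simp: \<alpha>_def \<beta>_def)
  have earlier: "\<alpha> m i \<in> used n" if "m < n" "i < s m" for m n i
  proof -
    have "\<alpha> m i \<in> used (Suc m)" using that by (auto simp: used_Suc \<alpha>_def)
    then show ?thesis using mono[of "Suc m" n] that by auto
  qed
  have disj: "m = n" if "\<alpha> m i = \<alpha> n j" "i < s m" "j < s n" for m n i j
  proof (rule ccontr)
    assume "m \<noteq> n"
    then consider "m < n" | "n < m" by linarith
    then show False
    proof cases
      case 1
      then show False using earlier[OF 1 that(2)] block(2)[of n] that by auto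
    next
      case 2
      then show False using earlier[OF 2 that(3)] block(2)[of m] that by auto
    qed
  qed
  define S where "S v w \<longleftrightarrow> (\<exists>n i W. i < s n \<and> W \<subseteq> {..<s n} \<and> v = \<alpha> n i \<and> w = \<beta> n W \<and> i \<in> W)"
    for v w
  have S: "S (\<alpha> n i) (\<beta> n W) \<longleftrightarrow> i \<in> W" if iW: "i < s n" "W \<subseteq> {..<s n}" for n i W
  proof
    assume "S (\<alpha> n i) (\<beta> n W)"
    then obtain m j W' where j: "j < s m" "W' \<subseteq> {..<s m}" "\<alpha> n i = \<alpha> m j" "\<beta> n W = \<beta> m W'" "j \<in> W'"
      unfolding S_def by blast
    then have "n = m" using disj iW by blast
    moreover have inj: "inj_on (\<alpha> m) {..<s m}" "inj_on (\<beta> m) (Pow {..<s m})"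
      using block(1)[of m] by (auto simp: pair_block_def)
    ultimately have "i = j" "W = W'"
      using inj_onD[OF inj(1), of i j] inj_onD[OF inj(2), of W W'] j iW by auto
    then show "i \<in> W" using j by simp
  qed (use iW in \<open>auto simp: S_def\<close>)
  show ?thesis
  proof (intro exI[of _ S] allI)
    fix n
    have "\<forall>i<s n. \<forall>W\<subseteq>{..<s n}. S (\<alpha> n i) (\<beta> n W) \<longleftrightarrow> i \<in> W" using S by blast
    then show "\<exists>s \<alpha> \<beta> \<phi>. (n + s + 1) ^ n < 2 ^ s \<and>
      pair_block (Aut R) n s \<alpha> \<beta> \<phi> \<and> (\<forall>i<s. \<forall>W\<subseteq>{..<s}. S (\<alpha> i) (\<beta> W) \<longleftrightarrow> i \<in> W)"
      using s[of n] block(1)[of n]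
      by (intro exI[of _ "s n"] exI[of _ "\<alpha> n"] exI[of _ "\<beta> n"] exI[of _ "c n (used n)"] conjI)
  qed
qed

section \<open>The counting argument\<close>

text \<open>Only \<open>s + n + 1\<close> initial segments of a chain of \<open>s + n\<close> points are possible, so with \<open>k\<close> linear
  orders at most \<open>(s + n + 1)^k < 2^s\<close> of the \<open>2^s\<close> points \<open>\<beta> W\<close> can be told apart.\<close>

lemma same_position:
  fixes P :: "'q \<Rightarrow> nat \<Rightarrow> nat" and \<beta> :: "nat set \<Rightarrow> nat"
  assumes "finite Q" "card Q \<le> n" "finite Z" "card Z \<le> n + s" "(n + s + 1) ^ n < 2 ^ s"
    and inj: "\<And>q. q \<in> Q \<Longrightarrow> inj_on (P q) Z"
  shows "\<exists>W W'. W \<subseteq> {..<s} \<and> W' \<subseteq> {..<s} \<and> W \<noteq> W' \<and>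
    (\<forall>q\<in>Q. \<forall>z\<in>Z. P q z < P q (\<beta> W) \<longleftrightarrow> P q z < P q (\<beta> W'))"
proof -
  define D where "D q W = {z \<in> Z. P q z < P q (\<beta> W)}" for q W
  \<comment> \<open>In a linear order an initial segment is given by its size, so these numbers
    record the position of \<open>\<beta> W\<close> in every order.\<close>
  define c where "c W = (\<lambda>q\<in>Q. card (D q W))" for W
  have D: "finite (D q W)" "card (D q W) \<le> n + s" for q W
    using assms(3,4) card_mono[of Z "D q W"] by (auto simp: D_def)
  have "c ` Pow {..<s} \<subseteq> Q \<rightarrow>\<^sub>E {..n + s}" using D(2) by (auto simp: c_def)
  then have "card (c ` Pow {..<s}) \<le> card (Q \<rightarrow>\<^sub>E {..n + s})"
    using assms(1) by (intro card_mono) (simp_all add: finite_PiE)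
  also have "\<dots> = (n + s + 1) ^ card Q" using assms(1) by (simp add: card_PiE)
  also have "\<dots> \<le> (n + s + 1) ^ n" using assms(2) by (intro power_increasing) auto
  also have "\<dots> < card (Pow {..<s})" using assms(5) by (simp add: card_Pow)
  finally have "\<not> inj_on c (Pow {..<s})" using card_image by fastforce
  then obtain W W' where W: "W \<subseteq> {..<s}" "W' \<subseteq> {..<s}" "W \<noteq> W'" "c W = c W'"
    by (auto simp: inj_on_def)
  have "P q z < P q (\<beta> W) \<longleftrightarrow> P q z < P q (\<beta> W')" if q: "q \<in> Q" and z: "z \<in> Z" for q z
  proof -
    have "card (D q W) = card (D q W')" using fun_cong[OF W(4), of q] q by (simp add: c_def)
    \<comment> \<open>Initial segments of one order are nested; equal size then forces
      equality.\<close>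
    moreover have "D q W \<subseteq> D q W' \<or> D q W' \<subseteq> D q W" by (auto simp: D_def)
    ultimately have "D q W = D q W'" using D(1) card_subset_eq by metis
    then show ?thesis using z by (auto simp: D_def)
  qed
  then show ?thesis using W by blast
qed

text \<open>Two group elements in one row of a block agree on \<open>F\<close> except at
  \<open>1\<close>. If their columns have the same position in all orders, every coefficient changes
  by at most 1/2, which is the tolerance below which the coefficients determine \<open>f\<close>;
  yet the row can be chosen so that \<open>f\<close> differs.\<close>

lemma ambit_not_iso:
  fixes M :: "'m topology"
  assumes hom: "ultrahomogeneous R" and bl: "closed_under_blowup R" and ram: "ramsey_group (Aut R)"
    and min: "minimal_flow (Aut R) M act"
  shows "\<not> ambit_iso (Aut R) (Samuel_top (Aut R)) (Samuel_act (Aut R)) (Samuel_pt (Aut R))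
    (env_top (Aut R) M act) (env_act M act) (env_pt M act)"
proof
  define G where "G = Aut R"
  interpret perm_group G unfolding G_def by (rule perm_group_Aut)
  assume "ambit_iso (Aut R) (Samuel_top (Aut R)) (Samuel_act (Aut R)) (Samuel_pt (Aut R))
    (env_top (Aut R) M act) (env_act M act) (env_pt M act)"
  then have iso: "ambit_iso G (Samuel_top G) (Samuel_act G) (Samuel_pt G)
    (env_top G M act) (env_act M act) (env_pt M act)" by (simp add: G_def)
  have flow: "G_flow G M act" using min by (simp add: minimal_flow_def G_def)
  obtain S :: "nat \<Rightarrow> nat \<Rightarrow> bool" where S: "\<forall>n. \<exists>s \<alpha> \<beta> \<phi>. (n + s + 1) ^ n < 2 ^ s \<and>
    pair_block G n s \<alpha> \<beta> \<phi> \<and> (\<forall>i<s. \<forall>W\<subseteq>{..<s}. S (\<alpha> i) (\<beta> W) \<longleftrightarrow> i \<in> W)"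
    using complicated_pairs[OF hom bl] unfolding G_def by blast
  define f :: "(nat \<Rightarrow> nat) \<Rightarrow> real" where "f g = (if g \<in> G \<and> S (g 0) (g 1) then 1 else 0)" for g
  have "f \<in> LUC G"
  proof (rule LUC_I[of _ _ 1])
    fix e :: real assume "e > 0"
    then show "\<exists>F. finite F \<and> (\<forall>x\<in>G. \<forall>y\<in>G. (\<forall>a\<in>F. x a = y a) \<longrightarrow> \<bar>f x - f y\<bar> < e)"
      by (intro exI[of _ "{0, 1}"]) (simp add: f_def)
  qed (simp_all add: f_def)
  from ambit_iso_LUC_extension[OF flow this iso] obtain \<Phi> where \<Phi>:
    "continuous_map (env_top G M act) euclideanreal \<Phi>"
    "\<forall>g\<in>G. \<Phi> (\<lambda>x\<in>topspace M. act x g) = f g" by blast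
  have "\<forall>g\<in>G. f g = 0 \<or> f g = 1" by (simp add: f_def)
  from env_functions_separate[OF flow \<Phi> this] obtain Q where Q: "finite Q"
    "\<forall>(x, u)\<in>Q. x \<in> topspace M \<and> continuous_map M (top_of_set {0..1::real}) u"
    "\<forall>g\<in>G. \<forall>h\<in>G. (\<forall>(x, u)\<in>Q. \<bar>u (act x g) - u (act x h)\<bar> \<le> 1/2) \<longrightarrow> f g = f h" by blast
  have "\<forall>q\<in>Q. \<exists>F. finite F \<and> (\<forall>y\<in>topspace M. \<forall>g\<in>G. \<forall>h\<in>G. (\<forall>z\<in>F. g z = h z) \<longrightarrow>
      \<bar>snd q (act y g) - snd q (act y h)\<bar> < 1/32)"
  proof
    fix q assume "q \<in> Q"
    then have "continuous_map M euclideanreal (snd q)"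
      using Q(2) by (auto simp: continuous_map_in_subtopology)
    from flow_act_uniform[OF flow this, of "1/32"]
    show "\<exists>F. finite F \<and> (\<forall>y\<in>topspace M. \<forall>g\<in>G. \<forall>h\<in>G. (\<forall>z\<in>F. g z = h z) \<longrightarrow>
      \<bar>snd q (act y g) - snd q (act y h)\<bar> < 1/32)" by simp
  qed
  then obtain Fq where Fq: "\<And>q. q \<in> Q \<Longrightarrow> finite (Fq q)"
    "\<And>q y g h. q \<in> Q \<Longrightarrow> y \<in> topspace M \<Longrightarrow> g \<in> G \<Longrightarrow> h \<in> G \<Longrightarrow> (\<forall>z\<in>Fq q. g z = h z) \<Longrightarrow>
      \<bar>snd q (act y g) - snd q (act y h)\<bar> < 1/32" by metis
  have "finite (\<Union>q\<in>Q. Fq q)" using Q(1) Fq(1) by blast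
  then obtain n0 where n0: "(\<Union>q\<in>Q. Fq q) \<subseteq> {..<n0}" by (metis finite_nat_bounded)
  \<comment> \<open>Large enough for \<open>{..<n}\<close> to contain every \<open>Fq q\<close> and
    the points \<open>0\<close> and \<open>1\<close>, and for \<open>n\<close> to bound the number
    of coefficients.\<close>
  define n where "n = n0 + card Q + 2"
  define F where "F = {..<n}"
  have unif: "\<forall>y\<in>topspace M. \<forall>g\<in>G. \<forall>h\<in>G. (\<forall>z\<in>F. g z = h z) \<longrightarrow>
      \<bar>snd q (act y g) - snd q (act y h)\<bar> < 1/32" if "q \<in> Q" for q
  proof (intro ballI impI)
    fix y g h assume *: "y \<in> topspace M" "g \<in> G" "h \<in> G" "\<forall>z\<in>F. g z = h z"
    have "Fq q \<subseteq> F" using n0 that by (force simp: F_def n_def)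
    then show "\<bar>snd q (act y g) - snd q (act y h)\<bar> < 1/32" using * Fq(2)[OF that] by blast
  qed
  obtain s \<alpha> \<beta> \<phi> where s: "(n + s + 1) ^ n < 2 ^ s" and block: "pair_block G n s \<alpha> \<beta> \<phi>"
    and Sab: "\<forall>i<s. \<forall>W\<subseteq>{..<s}. S (\<alpha> i) (\<beta> W) \<longleftrightarrow> i \<in> W"
    using spec[OF S, of n] by (elim exE conjE) (rule that)
  have "\<forall>i W. \<exists>g. i < s \<longrightarrow> W \<subseteq> {..<s} \<longrightarrow>
      g \<in> G \<and> g 0 = \<alpha> i \<and> g 1 = \<beta> W \<and> (\<forall>z. 2 \<le> z \<longrightarrow> z < n \<longrightarrow> g z = \<phi> z)"
    using block unfolding pair_block_def by blast
  then obtain e where e: "\<And>i W. i < s \<Longrightarrow> W \<subseteq> {..<s} \<Longrightarrow>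
      e i W \<in> G \<and> e i W 0 = \<alpha> i \<and> e i W 1 = \<beta> W \<and> (\<forall>z. 2 \<le> z \<longrightarrow> z < n \<longrightarrow> e i W z = \<phi> z)"
    by metis
  \<comment> \<open>The possible images of points of \<open>F\<close> other than \<open>1\<close>;
    the columns are located relative to these.\<close>
  define Z where "Z = \<phi> ` {2..<n} \<union> \<alpha> ` {..<s}"
  define N where "N = Z \<union> \<beta> ` Pow {..<s}"
  have "finite N" "finite Z" by (simp_all add: N_def Z_def)
  have cardZ: "card Z \<le> n + s"
  proof -
    have "card Z \<le> card (\<phi> ` {2..<n}) + card (\<alpha> ` {..<s})" unfolding Z_def by (rule card_Un_le)
    also have "\<dots> \<le> card {2..<n} + card {..<s}" by (intro add_mono card_image_le) simp_all
    finally show ?thesis by simp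
  qed
  have "\<forall>q\<in>Q. order_like F N (1/2) (\<lambda>h. snd q (act (fst q) h))"
  proof
    fix q assume q: "q \<in> Q"
    have x: "fst q \<in> topspace M" and u: "continuous_map M (top_of_set {0..1::real}) (snd q)"
      using Q(2) q by auto
    have "continuous_map M euclideanreal (snd q)" "\<forall>y\<in>topspace M. 0 \<le> snd q y \<and> snd q y \<le> 1"
      using u by (auto simp: continuous_map_in_subtopology image_subset_iff)
    then show "order_like F N (1/2) (\<lambda>h. snd q (act (fst q) h))"
      using min ram unif[OF q] x \<open>finite N\<close> unfolding G_def[symmetric]
      by (intro order_like_minimal) (auto simp: F_def)
  qed
  then obtain P where P: "\<And>q. q \<in> Q \<Longrightarrow> inj_on (P q) N"
    "\<And>q h h'. q \<in> Q \<Longrightarrow> h \<in> G \<Longrightarrow> h' \<in> G \<Longrightarrow> h ` F \<subseteq> N \<Longrightarrow> h' ` F \<subseteq> N \<Longrightarrow>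
      same_order F (P q \<circ> h) (P q \<circ> h') \<Longrightarrow>
      \<bar>snd q (act (fst q) h) - snd q (act (fst q) h')\<bar> \<le> 1/2"
    unfolding order_like_def by metis
  have "card Q \<le> n" by (simp add: n_def)
  moreover have "inj_on (P q) Z" if "q \<in> Q" for q
    using P(1)[OF that] by (rule inj_on_subset) (simp add: N_def)
  ultimately obtain W W' where W: "W \<subseteq> {..<s}" "W' \<subseteq> {..<s}" "W \<noteq> W'"
    and pos: "\<And>q z. q \<in> Q \<Longrightarrow> z \<in> Z \<Longrightarrow> P q z < P q (\<beta> W) \<longleftrightarrow> P q z < P q (\<beta> W')"
    using same_position[OF Q(1) _ \<open>finite Z\<close> cardZ s, of P \<beta>] by blast
  \<comment> \<open>A row in the symmetric difference of \<open>W\<close> and \<open>W'\<close>: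
    there \<open>S\<close> separates the two columns.\<close>
  obtain i where i: "i < s" "i \<in> W \<longleftrightarrow> i \<notin> W'" using W by blast
  have eF: "e i U ` F \<subseteq> N" "\<And>z. z \<in> F \<Longrightarrow> z \<noteq> 1 \<Longrightarrow> e i U z \<in> Z" if U: "U \<subseteq> {..<s}" for U
  proof -
    show Zi: "e i U z \<in> Z" if "z \<in> F" "z \<noteq> 1" for z
      using e[OF i(1) U] that i(1) by (cases "z = 0") (auto simp: Z_def F_def)
    show "e i U ` F \<subseteq> N"
    proof
      fix w assume "w \<in> e i U ` F"
      then obtain z where "z \<in> F" "w = e i U z" by blast
      then show "w \<in> N" using Zi[of z] e[OF i(1) U] U by (cases "z = 1") (auto simp: N_def)
    qed
  qed
  have eq: "e i W z = e i W' z" if "z \<in> F" "z \<noteq> 1" for z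
    using e[OF i(1) W(1)] e[OF i(1) W(2)] that by (cases "z = 0") (auto simp: F_def)
  have b: "e i U 1 = \<beta> U" if "U \<subseteq> {..<s}" for U using e[OF i(1) that] by simp
  \<comment> \<open>The counting only compares points of \<open>Z\<close> from below with a column;
    injectivity of \<open>P q\<close> on \<open>N\<close> supplies the reverse comparison.\<close>
  have flip: "P q (\<beta> U) < P q (e i U z) \<longleftrightarrow> \<not> P q (e i U z) < P q (\<beta> U)"
    if U: "U \<subseteq> {..<s}" and q: "q \<in> Q" and z: "z \<in> F" "z \<noteq> 1" for U q z
  proof -
    have "inj (e i U)" using e[OF i(1) U] bij_mem bij_is_inj by blast
    then have "e i U z \<noteq> \<beta> U" using z(2) b[OF U] by (metis injD)
    moreover have "e i U z \<in> N" "\<beta> U \<in> N" using eF(2)[OF U z] U by (auto simp: N_def)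
    ultimately have "P q (e i U z) \<noteq> P q (\<beta> U)" using inj_onD[OF P(1)[OF q]] by blast
    then show ?thesis by linarith
  qed
  have "same_order F (P q \<circ> e i W) (P q \<circ> e i W')" if q: "q \<in> Q" for q
    unfolding same_order_def
  proof (intro ballI)
    fix x y assume xy: "x \<in> F" "y \<in> F"
    show "(P q \<circ> e i W) x < (P q \<circ> e i W) y \<longleftrightarrow> (P q \<circ> e i W') x < (P q \<circ> e i W') y"
    proof (cases "x = 1")
      case x1: True
      show ?thesis
      proof (cases "y = 1")
        case False
        then show ?thesis
          using x1 flip[OF W(1) q xy(2) False] flip[OF W(2) q xy(2) False]
            pos[OF q eF(2)[OF W(1) xy(2) False]] eq[OF xy(2) False] b W by simp
      qed (use x1 in simp)
    next
      case x: False
      show ?thesis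
      proof (cases "y = 1")
        case True
        then show ?thesis
          using pos[OF q eF(2)[OF W(1) xy(1) x]] eq[OF xy(1) x] b W by simp
      next
        case False
        then show ?thesis using eq[OF xy(1) x] eq[OF xy(2) False] by simp
      qed
    qed
  qed
  then have "\<forall>(x, u)\<in>Q. \<bar>u (act x (e i W)) - u (act x (e i W'))\<bar> \<le> 1/2"
    using P(2) e[OF i(1) W(1)] e[OF i(1) W(2)] eF(1)[OF W(1)] eF(1)[OF W(2)] by force
  then have "f (e i W) = f (e i W')" using Q(3) e[OF i(1) W(1)] e[OF i(1) W(2)] by blast
  moreover have "f (e i U) = (if i \<in> U then 1 else 0)" if "U \<subseteq> {..<s}" for U
    using e[OF i(1) that] Sab[rule_format, OF i(1) that] by (simp add: f_def)
  ultimately show False using i(2) W by (auto split: if_splits)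
qed

text \<open>The complements of the finite sets \<open>A\<close> and \<open>B\<close> are infinite
  sets of natural numbers, so a bijection between them completes \<open>p\<close>.\<close>

lemma finite_partial_bij_extends:
  fixes p :: "nat \<Rightarrow> nat"
  assumes "finite A" "bij_betw p A B"
  shows "\<exists>g. bij g \<and> (\<forall>a\<in>A. g a = p a)"
proof -
  have "finite B" using assms bij_betw_finite by blast
  have "infinite (- A)" "infinite (- B)" using assms \<open>finite B\<close> by (simp_all add: Compl_eq_Diff_UNIV)
  then obtain q where q: "bij_betw q (- A) (- B)"
    by (metis bij_betw_trans bij_betw_inv bij_enumerate)
  define g where "g x = (if x \<in> A then p x else q x)" for x
  have "bij_betw g A B" using assms(2) by (simp add: g_def cong: bij_betw_cong)
  moreover have "bij_betw g (- A) (- B)"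
    using q bij_betw_cong[of "- A" g q "- B"] by (simp add: g_def)
  ultimately have "bij_betw g (A \<union> - A) (B \<union> - B)" by (rule bij_betw_combine) simp
  then show ?thesis by (auto simp: g_def)
qed

text \<open>This makes the set without structure a special case of the \<open>K\<^sub>n\<close>-free graphs.\<close>

lemma random_K2_free_graph_empty: "random_Kn_free_graph 2 (\<lambda>_. False)"
proof -
  have "embeds_into V R' (\<lambda>_. False)"
    if "uniform_struct 2 R'" "\<forall>C. R' C \<longrightarrow> C \<subseteq> V" "clique_free 2 R' V" for V R'
  proof -
    have "\<not> R' C" for C
    proof
      assume C: "R' C"
      then have "C \<subseteq> V" "finite C" "card C = 2" using that by (auto simp: uniform_struct_def)
      moreover obtain x y where "C = {x, y}" using \<open>card C = 2\<close> card_2_iff by metis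
      ultimately show False using that(3) C unfolding clique_free_def
        by (metis insert_commute insertE singletonD)
    qed
    then show ?thesis by (auto simp: embeds_into_def intro: exI[of _ id])
  qed
  moreover have "clique_free 2 (\<lambda>_. False) UNIV"
    unfolding clique_free_def by (auto simp: card_2_iff)
  moreover have "ultrahomogeneous (\<lambda>_. False)"
    unfolding ultrahomogeneous_def partial_iso_def Aut_def
    using finite_partial_bij_extends by auto
  ultimately show ?thesis by (simp add: random_Kn_free_graph_def uniform_struct_def)
qed

theorem mainTheorem1:
  fixes G :: "(nat \<Rightarrow> nat) set"
    and M :: "'m topology" and actM :: "'m \<Rightarrow> (nat \<Rightarrow> nat) \<Rightarrow> 'm"
  assumes "G = {g. bij g}
           \<or> (\<exists>n\<ge>3. \<exists>R. random_Kn_free_graph n R \<and> G = Aut R)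
           \<or> (\<exists>r\<ge>2. \<exists>R. random_uniform_hypergraph r R \<and> G = Aut R)"
    and "universal_minimal_flow G M actM"
  shows "\<not> ambit_iso G (Samuel_top G) (Samuel_act G) (Samuel_pt G)
                       (env_top G M actM) (env_act M actM) (env_pt M actM)"
proof -
  have min: "minimal_flow G M actM" using assms(2) by (simp add: universal_minimal_flow_def)
  have "{g. bij g} = Aut (\<lambda>_. False)" by (simp add: Aut_def)
  then consider n R where "n > 0" "random_Kn_free_graph n R" "G = Aut R"
    | r R where "random_uniform_hypergraph r R" "G = Aut R"
    using assms(1) random_K2_free_graph_empty
    by (metis not_gr_zero not_numeral_le_zero zero_neq_numeral)
  then show ?thesis
  proof cases
    case 1
    have "ultrahomogeneous R" using 1(2) by (simp add: random_Kn_free_graph_def)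
    then show ?thesis
      using ambit_not_iso closed_under_blowup_Kn_free[OF 1(2)] ramsey_group_Kn_free[OF 1(2,1)] min
      unfolding 1(3) by blast
  next
    case 2
    have "ultrahomogeneous R" using 2(1) by (simp add: random_uniform_hypergraph_def)
    then show ?thesis
      using ambit_not_iso closed_under_blowup_hypergraph[OF 2(1)] ramsey_group_hypergraph[OF 2(1)] min
      unfolding 2(2) by blast
  qed
qed

end
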